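(* In the single-sample semiparametric density model described in the context, suppose Assumptions 1 to 8 (written out in the context) hold. Let $\hat\tau=(\hat\theta,\hat h)$ be the penalized likelihood estimator and $\tilde\tau=(\tilde\theta,\tilde h)$ the minimizer of the quadratic criterion $\tilde{\mathfrak L}_{n,\lambda}$. Then, as $n\to\infty$, $\lambda\to0$ and $n\lambda^{1/r}\to\infty$, $$V_{\tau_0}\big[L_\theta(\hat\theta-\tilde\theta)+L_h(\hat h-\tilde h)\big]+\lambda J(\hat h-\tilde h)=O_p\big(n^{-1}\lambda^{-1/r}+\lambda\big),$$ and therefore $$V_{\tau_0}\big[L_\theta(\hat\theta-\theta_0)+L_h(\hat h-h_0)\big]+\lambda J(\hat h-h_0)=O_p\big(n^{-1}\lambda^{-1/r}+\lambda\big).$$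
   Context: Setting. $p\ge1$; $\mathcal X$ is a sample space (integrals are with respect to a reference measure $dx$); $\mathcal H$ is a real Hilbert space of functions with norm $\|\cdot\|$; $\mathcal Q=\mathbb R^p\times\mathcal H$. Write $\tau=(\theta,h)\in\mathcal Q$. $\eta:\mathcal Q\to L^2_0(\mathcal X)$ is a known map, with values written $\eta(x;\tau)=\eta(x;\theta,h)$, and $f_\tau(x)=e^{\eta(x;\tau)}/\int_{\mathcal X}e^{\eta(t;\tau)}dt$. The true parameter is $\tau_0=(\theta_0,h_0)$; $L^2_{\tau_0}(\mathcal X)$ is the space of functions with finite second moment under $f_{\tau_0}$ and $L^2_0(\mathcal X)=L^2_{\tau_0}(\mathcal X)\ominus\{1\}$ (constants removed). $X_1,\dots,X_n$ are iid from $f_{\tau_0}$; $\lambda>0$ is a smoothing parameter. $D_\theta,D_h$ are Fréchet partial derivatives. Put $\mu_\tau(\varphi)=\int\varphi f_\tau$, $V_\tau(\varphi_1,\varphi_2)=\mu_\tau(\varphi_1\varphi_2)-\mu_\tau(\varphi_1)\mu_\tau(\varphi_2)$, $V_\tau(\varphi)=V_\tau(\varphi,\varphi)$. $O_p$ statements are along arbitrary deterministic sequences $\lambda=\lambda_n$ with the stated limits. Criteria. $\mathfrak L_n(\theta,h)=-\frac1n\sum_{i=1}^n\eta(X_i;\theta,h)+\log\int_{\mathcal X}e^{\eta(x;\theta,h)}dx$ and $\mathfrak L_{n,\lambda}=\mathfrak L_n+\frac\lambda2J(h)$. It is assumed that $\mathfrak L_n$ is convex and that $\mathfrak L_{n,\lambda}$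 has a unique local minimum $\hat\tau=(\hat\theta,\hat h)$ in $\mathcal N_{\theta_0}\times\mathcal N_{h_0}$, which is the unique solution there of $D_\theta\mathfrak L_{n,\lambda}=0$, $D_h\mathfrak L_{n,\lambda}=0$. The quadratic criterion is $$\tilde{\mathfrak L}_{n,\lambda}(\theta,h)=-\tfrac1n\sum_{i}[D_\theta\eta(X_i;\tau_0)\theta+D_h\eta(X_i;\tau_0)h]+\mu_{\tau_0}[D_\theta\eta(\tau_0)\theta+D_h\eta(\tau_0)h]+\tfrac12V_{\tau_0}[D_\theta\eta(\tau_0)(\theta-\theta_0)+D_h\eta(\tau_0)(h-h_0)]+\tfrac\lambda2J(h),$$ with minimizer $\tilde\tau=(\tilde\theta,\tilde h)$; it is assumed that $\tilde\tau\in\mathcal N_{\theta_0}\times\mathcal N_{h_0}$. Assumption 1. $J$ is a square seminorm on $\mathcal H$ with finite-dimensional null space and semi-inner product $J(\cdot,\cdot)$; $J(h_0)<\infty$. Assumption 2. There are bounded linear operators $L_\theta:\mathbb R^p\to L^2_0(\mathcal X)$, $L_h:\mathcal H\to L^2_0(\mathcal X)$ with zero null spaces such that (i) there are positive constants $M_1,M_2$ (possibly depending on $\lambda$) with $M_1\|g\|^2\le V_{\tau_0}(L_hg)+\lambda J(g)\le M_2\|g\|^2$ for all $g\in\mathcal H$; (ii) there is $c_\delta>0$ with $V_{\tau_0}(L_\theta\zeta-L_hg)>c_\delta$ for all $\zeta\in\mathbb R^p$ with $\|\zeta\|_{l^2}=1$ and all $g\in\mathcal H$. There are neighborhoods $\mathcal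 N_{\theta_0}\subset\mathbb R^p$ of $\theta_0$ and $\mathcal N_{h_0}\subset\mathcal H$ of $h_0$ for which Assumptions 3–6 hold. Assumption 3. $\eta$ is one-to-one and three times continuously Fréchet differentiable on $\mathcal N_{\theta_0}\times\mathcal N_{h_0}$, and $\tau_0$ is the unique root there of $E[D_\theta\mathfrak L_n(\theta,h)]=0$, $E[D_h\mathfrak L_n(\theta,h)]=0$. Assumption 4. For all $(\theta_*,h_* )\in\mathcal N_{\theta_0}\times\mathcal N_{h_0}$, $D_\theta\eta(\theta_*,h_* ):\mathbb R^p\to L_0^2(\mathcal X)$ and $D_h\eta(\theta_*,h_* ):\mathcal H\to L_0^2(\mathcal X)$ are bounded linear, and there are constants $C_1,C_2>0$ with $C_1V_{\tau_0}(L_\theta\zeta+L_hg)\le V_{\tau_0}(D_\theta\eta(\theta_*,h_* )\zeta+D_h\eta(\theta_*,h_* )g)\le C_2V_{\tau_0}(L_\theta\zeta+L_hg)$ for all $(\zeta,g)\in\mathcal Q$. Assumption 5. There is a positive constant $C_d<2C_1$ such that for all $(\theta_1,h_1),(\theta_2,h_2)$ and $(\zeta,g)$ in $\mathcal N_{\theta_0}\times\mathcal N_{h_0}$, $V_{\tau_0}[(D_\theta\eta(\theta_1,h_1)-D_\theta\eta(\theta_2,h_2))\zeta+(D_h\eta(\theta_1,h_1)-D_h\eta(\theta_2,h_2))g]\le C_dV_{\tau_0}(L_\theta\zeta+L_hg)$. Assumption 6. $\mathcal N_{\theta_0}\times\mathcal N_{h_0}$ is convex and contains $\hat\tau$, and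 there are $C_3,C_4>0$ with $C_3V_{\tau_0}(f)\le V_\tau(f)\le C_4V_{\tau_0}(f)$ for all $\tau\in\mathcal N_{\theta_0}\times\mathcal N_{h_0}$ and $f\in L_0^2(\mathcal X)$. Assumption 7. The quadratic functional $g\mapsto V_{\tau_0}(L_hg)$ is completely continuous with respect to $J$ (for every $\epsilon>0$ there are finitely many continuous linear functionals $\ell_1,\dots,\ell_k$ such that $\ell_1(g)=\dots=\ell_k(g)=0$ implies $V_{\tau_0}(L_hg)\le\epsilon J(g)$). This yields eigenfunctions $\phi_\nu$ and eigenvalues $0\le\rho_\nu\to\infty$, $\nu=1,2,\dots$, with $V_{\tau_0}(L_h\phi_\nu,L_h\phi_\mu)=\delta_{\nu\mu}$, $J(\phi_\nu,\phi_\mu)=\rho_\nu\delta_{\nu\mu}$. Assumption 8. $\rho_\nu=\kappa_\nu\nu^r$ with $r>1$ and $\kappa_\nu\in(\beta_1,\beta_2)\subset(0,\infty)$. *)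

theory Defs
  imports "HOL-Probability.Probability"
begin

section \<open>The space of centred square-integrable functions\<close>

text \<open>
  The library has no type of square-integrable functions modulo null sets, so elements
  of that space are represented by functions and equality is equality almost everywhere.
\<close>

definition L2_norm :: "'x measure \<Rightarrow> ('x \<Rightarrow> real) \<Rightarrow> real" where
  "L2_norm P f = sqrt (\<integral>x. (f x)\<^sup>2 \<partial>P)"

text \<open>For a probability measure \<open>P\<close>: the orthogonal complement of the constants.\<close>

definition L20 :: "'x measure \<Rightarrow> ('x \<Rightarrow> real) set" where
  "L20 P = {f \<in> borel_measurable P. integrable P (\<lambda>x. (f x)\<^sup>2) \<and> (\<integral>x. f x \<partial>P) = 0}"

definition bounded_linear_L20 ::
    "'x measure \<Rightarrow> ('a::real_normed_vector \<Rightarrow> 'x \<Rightarrow> real) \<Rightarrow> bool" where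
  "bounded_linear_L20 P T \<longleftrightarrow>
     (\<forall>v. T v \<in> L20 P) \<and>
     (\<forall>c v w. AE x in P. T (c *\<^sub>R v + w) x = c * T v x + T w x) \<and>
     (\<exists>B. \<forall>v. L2_norm P (T v) \<le> B * norm v)"

definition trivial_kernel_L20 ::
    "'x measure \<Rightarrow> ('a::real_normed_vector \<Rightarrow> 'x \<Rightarrow> real) \<Rightarrow> bool" where
  "trivial_kernel_L20 P T \<longleftrightarrow> (\<forall>v. (AE x in P. T v x = 0) \<longrightarrow> v = 0)"

text \<open>
  \<open>Frechet_Ck_L20 P k S F D\<close>: on the open set \<open>S\<close> the map \<open>F\<close> into the centred
  square-integrable functions is \<open>k\<close> times continuously Frechet differentiable, and
  \<open>D a [v\<^sub>1, \<dots>, v\<^sub>j]\<close> is its \<open>j\<close>-th derivative at \<open>a\<close> in the directions \<open>v\<^sub>1, \<dots>, v\<^sub>j\<close>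
  (\<open>j \<le> k\<close>).  The \<open>j\<close>-th derivative is a \<open>j\<close>-linear map; all limits are taken in the
  operator norm of \<open>j\<close>-linear maps, i.e. uniformly relative to the product of the norms of
  the directions.
\<close>

definition Frechet_Ck_L20 ::
    "'x measure \<Rightarrow> nat \<Rightarrow> 'a::real_normed_vector set \<Rightarrow> ('a \<Rightarrow> 'x \<Rightarrow> real)
      \<Rightarrow> ('a \<Rightarrow> 'a list \<Rightarrow> 'x \<Rightarrow> real) \<Rightarrow> bool" where
  "Frechet_Ck_L20 P k S F D \<longleftrightarrow>
     (\<forall>a\<in>S. F a \<in> L20 P \<and> D a [] = F a) \<and>
     (\<forall>a\<in>S. \<forall>vs. length vs < k \<longrightarrow> bounded_linear_L20 P (\<lambda>v. D a (v # vs))) \<and>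
     (\<forall>a\<in>S. \<forall>j\<le>k. \<exists>B. \<forall>vs. length vs = j \<longrightarrow>
        L2_norm P (D a vs) \<le> B * prod_list (map norm vs)) \<and>
     (\<forall>a\<in>S. \<forall>j<k. \<forall>\<epsilon>>0. \<exists>d>0. \<forall>v. norm v < d \<and> a + v \<in> S \<longrightarrow>
        (\<forall>vs. length vs = j \<longrightarrow>
           L2_norm P (\<lambda>x. D (a + v) vs x - D a vs x - D a (v # vs) x)
             \<le> \<epsilon> * norm v * prod_list (map norm vs))) \<and>
     (\<forall>a\<in>S. \<forall>\<epsilon>>0. \<exists>d>0. \<forall>b\<in>S. dist b a < d \<longrightarrow>
        (\<forall>vs. length vs = k \<longrightarrow>
           L2_norm P (\<lambda>x. D b vs x - D a vs x) \<le> \<epsilon> * prod_list (map norm vs)))"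


section \<open>The density model\<close>

text \<open>
  \<open>M\<close> is the reference measure on the sample space, and \<open>\<eta> \<tau> x\<close> stands for \<open>\<eta>(x; \<tau>)\<close>
  with \<open>\<tau> = (\<theta>, h)\<close>.
\<close>

definition dens :: "'x measure \<Rightarrow> ('q \<Rightarrow> 'x \<Rightarrow> real) \<Rightarrow> 'q \<Rightarrow> 'x \<Rightarrow> real" where
  "dens M \<eta> \<tau> x = exp (\<eta> \<tau> x) / (\<integral>t. exp (\<eta> \<tau> t) \<partial>M)"

definition law :: "'x measure \<Rightarrow> ('q \<Rightarrow> 'x \<Rightarrow> real) \<Rightarrow> 'q \<Rightarrow> 'x measure" where
  "law M \<eta> \<tau> = density M (\<lambda>x. ennreal (dens M \<eta> \<tau> x))"

definition mean :: "'x measure \<Rightarrow> ('q \<Rightarrow> 'x \<Rightarrow> real) \<Rightarrow> 'q \<Rightarrow> ('x \<Rightarrow> real) \<Rightarrow> real" where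
  "mean M \<eta> \<tau> f = (\<integral>x. f x * dens M \<eta> \<tau> x \<partial>M)"

definition cov ::
    "'x measure \<Rightarrow> ('q \<Rightarrow> 'x \<Rightarrow> real) \<Rightarrow> 'q \<Rightarrow> ('x \<Rightarrow> real) \<Rightarrow> ('x \<Rightarrow> real) \<Rightarrow> real" where
  "cov M \<eta> \<tau> f g = mean M \<eta> \<tau> (\<lambda>x. f x * g x) - mean M \<eta> \<tau> f * mean M \<eta> \<tau> g"

abbreviation var :: "'x measure \<Rightarrow> ('q \<Rightarrow> 'x \<Rightarrow> real) \<Rightarrow> 'q \<Rightarrow> ('x \<Rightarrow> real) \<Rightarrow> real" where
  "var M \<eta> \<tau> f \<equiv> cov M \<eta> \<tau> f f"

definition density_model :: "'x measure \<Rightarrow> ('q \<Rightarrow> 'x \<Rightarrow> real) \<Rightarrow> 'q \<Rightarrow> bool" where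
  "density_model M \<eta> \<tau>0 \<longleftrightarrow>
     (\<forall>\<tau>. integrable M (\<lambda>x. exp (\<eta> \<tau> x))) \<and> (\<forall>\<tau>. \<eta> \<tau> \<in> L20 (law M \<eta> \<tau>0))"

text \<open>
  The partial Frechet derivatives of \<open>\<eta>\<close>, evaluated at a sample point \<open>x\<close>.  They are those
  of the section \<open>\<tau> \<mapsto> \<eta>(x; \<tau>)\<close>; \<open>smooth_identifiable\<close> below requires these
  sections to be differentiable (otherwise the derivatives of the sample criterion would not
  be defined) and requires the result to be the derivative of \<open>\<eta>\<close> as a map into the
  square-integrable functions.
\<close>

definition D_theta ::
    "('p::real_normed_vector \<times> 'h::real_normed_vector \<Rightarrow> 'x \<Rightarrow> real) \<Rightarrow> 'p \<times> 'h \<Rightarrow> 'p \<Rightarrow> 'x \<Rightarrow> real" where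
  "D_theta \<eta> \<tau> \<zeta> x = frechet_derivative (\<lambda>t. \<eta> (t, snd \<tau>) x) (at (fst \<tau>)) \<zeta>"

definition D_h ::
    "('p::real_normed_vector \<times> 'h::real_normed_vector \<Rightarrow> 'x \<Rightarrow> real) \<Rightarrow> 'p \<times> 'h \<Rightarrow> 'h \<Rightarrow> 'x \<Rightarrow> real" where
  "D_h \<eta> \<tau> g x = frechet_derivative (\<lambda>h. \<eta> (fst \<tau>, h) x) (at (snd \<tau>)) g"

definition D_joint ::
    "('p::real_normed_vector \<times> 'h::real_normed_vector \<Rightarrow> 'x \<Rightarrow> real) \<Rightarrow> 'p \<times> 'h \<Rightarrow> 'p \<times> 'h \<Rightarrow> 'x \<Rightarrow> real" where
  "D_joint \<eta> \<tau> \<delta> x = D_theta \<eta> \<tau> (fst \<delta>) x + D_h \<eta> \<tau> (snd \<delta>) x"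

definition L_joint ::
    "('p \<Rightarrow> 'x \<Rightarrow> real) \<Rightarrow> ('h \<Rightarrow> 'x \<Rightarrow> real) \<Rightarrow> 'p \<times> 'h \<Rightarrow> 'x \<Rightarrow> real" where
  "L_joint L\<theta> Lh \<delta> x = L\<theta> (fst \<delta>) x + Lh (snd \<delta>) x"


section \<open>Criteria\<close>

text \<open>
  The sample is \<open>xs 1, \<dots>, xs n\<close>; the penalty is \<open>J(h) = JB h h\<close> for the semi-inner product
  \<open>JB\<close>; \<open>l\<close> is the smoothing parameter.
\<close>

definition crit :: "'x measure \<Rightarrow> ('q \<Rightarrow> 'x \<Rightarrow> real) \<Rightarrow> nat \<Rightarrow> (nat \<Rightarrow> 'x) \<Rightarrow> 'q \<Rightarrow> real" where
  "crit M \<eta> n xs \<tau> = - (1 / real n) * (\<Sum>i=1..n. \<eta> \<tau> (xs i)) + ln (\<integral>x. exp (\<eta> \<tau> x) \<partial>M)"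

definition pen_crit ::
    "'x measure \<Rightarrow> ('p \<times> 'h \<Rightarrow> 'x \<Rightarrow> real) \<Rightarrow> ('h \<Rightarrow> 'h \<Rightarrow> real) \<Rightarrow> real
      \<Rightarrow> nat \<Rightarrow> (nat \<Rightarrow> 'x) \<Rightarrow> 'p \<times> 'h \<Rightarrow> real" where
  "pen_crit M \<eta> JB l n xs \<tau> = crit M \<eta> n xs \<tau> + l / 2 * JB (snd \<tau>) (snd \<tau>)"

definition quad_crit ::
    "'x measure \<Rightarrow> ('p::real_normed_vector \<times> 'h::real_normed_vector \<Rightarrow> 'x \<Rightarrow> real) \<Rightarrow> 'p \<times> 'h
      \<Rightarrow> ('h \<Rightarrow> 'h \<Rightarrow> real) \<Rightarrow> real \<Rightarrow> nat \<Rightarrow> (nat \<Rightarrow> 'x) \<Rightarrow> 'p \<times> 'h \<Rightarrow> real" where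
  "quad_crit M \<eta> \<tau>0 JB l n xs \<tau> =
     - (1 / real n) * (\<Sum>i=1..n. D_joint \<eta> \<tau>0 \<tau> (xs i))
     + mean M \<eta> \<tau>0 (D_joint \<eta> \<tau>0 \<tau>)
     + 1 / 2 * var M \<eta> \<tau>0 (D_joint \<eta> \<tau>0 (\<tau> - \<tau>0))
     + l / 2 * JB (snd \<tau>) (snd \<tau>)"

definition local_min :: "('q::topological_space \<Rightarrow> real) \<Rightarrow> 'q \<Rightarrow> bool" where
  "local_min F \<tau> \<longleftrightarrow> (\<forall>\<^sub>F s in nhds \<tau>. F \<tau> \<le> F s)"

definition stationary ::
    "('p::real_normed_vector \<times> 'h::real_normed_vector \<Rightarrow> real) \<Rightarrow> 'p \<times> 'h \<Rightarrow> bool" where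
  "stationary F \<tau> \<longleftrightarrow>
     ((\<lambda>t. F (t, snd \<tau>)) has_derivative (\<lambda>_. 0)) (at (fst \<tau>)) \<and>
     ((\<lambda>h. F (fst \<tau>, h)) has_derivative (\<lambda>_. 0)) (at (snd \<tau>))"

definition penalized_estimate ::
    "('p::real_normed_vector \<times> 'h::real_normed_vector \<Rightarrow> real) \<Rightarrow> ('p \<times> 'h) set \<Rightarrow> 'p \<times> 'h \<Rightarrow> bool" where
  "penalized_estimate F N \<tau> \<longleftrightarrow>
     {s \<in> N. local_min F s} = {\<tau>} \<and> {s \<in> N. stationary F s} = {\<tau>}"


section \<open>Assumptions\<close>

definition penalty_form :: "('h::real_inner \<Rightarrow> 'h \<Rightarrow> real) \<Rightarrow> bool" where
  "penalty_form JB \<longleftrightarrow>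
     bilinear JB \<and> (\<forall>f g. JB f g = JB g f) \<and> (\<forall>g. 0 \<le> JB g g) \<and>
     (\<exists>B. finite B \<and> {g. JB g g = 0} = span B)"

definition comparison_operators ::
    "'x measure \<Rightarrow> ('p::real_normed_vector \<times> 'h::real_normed_vector \<Rightarrow> 'x \<Rightarrow> real) \<Rightarrow> 'p \<times> 'h
      \<Rightarrow> ('h \<Rightarrow> 'h \<Rightarrow> real) \<Rightarrow> ('p \<Rightarrow> 'x \<Rightarrow> real) \<Rightarrow> ('h \<Rightarrow> 'x \<Rightarrow> real) \<Rightarrow> bool" where
  "comparison_operators M \<eta> \<tau>0 JB L\<theta> Lh \<longleftrightarrow>
     bounded_linear_L20 (law M \<eta> \<tau>0) L\<theta> \<and> trivial_kernel_L20 (law M \<eta> \<tau>0) L\<theta> \<and>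
     bounded_linear_L20 (law M \<eta> \<tau>0) Lh \<and> trivial_kernel_L20 (law M \<eta> \<tau>0) Lh \<and>
     (\<forall>l>0. \<exists>M1>0. \<exists>M2>0. \<forall>g.
        M1 * (norm g)\<^sup>2 \<le> var M \<eta> \<tau>0 (Lh g) + l * JB g g \<and>
        var M \<eta> \<tau>0 (Lh g) + l * JB g g \<le> M2 * (norm g)\<^sup>2) \<and>
     (\<exists>c>0. \<forall>\<zeta> g. norm \<zeta> = 1 \<longrightarrow> c < var M \<eta> \<tau>0 (\<lambda>x. L\<theta> \<zeta> x - Lh g x))"

text \<open>
  \<open>S\<close> is the underlying probability space and \<open>X 1, X 2, \<dots>\<close> the sample.  The last conjunct
  says that \<open>\<tau>0\<close> is the unique root in \<open>N\<close> of the expected partial derivatives of the sample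
  criterion.
\<close>

definition smooth_identifiable ::
    "'x measure \<Rightarrow> ('p::real_normed_vector \<times> 'h::real_normed_vector \<Rightarrow> 'x \<Rightarrow> real) \<Rightarrow> 'p \<times> 'h
      \<Rightarrow> ('p \<times> 'h) set \<Rightarrow> 'w measure \<Rightarrow> (nat \<Rightarrow> 'w \<Rightarrow> 'x) \<Rightarrow> bool" where
  "smooth_identifiable M \<eta> \<tau>0 N S X \<longleftrightarrow>
     (\<forall>\<tau>1\<in>N. \<forall>\<tau>2\<in>N. (AE x in law M \<eta> \<tau>0. \<eta> \<tau>1 x = \<eta> \<tau>2 x) \<longrightarrow> \<tau>1 = \<tau>2) \<and>
     (\<exists>D. Frechet_Ck_L20 (law M \<eta> \<tau>0) 3 N \<eta> D \<and>
        (\<forall>\<tau>\<in>N. \<forall>\<delta>. AE x in law M \<eta> \<tau>0. D \<tau> [\<delta>] x = D_joint \<eta> \<tau> \<delta> x)) \<and>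
     (\<forall>x\<in>space M. \<forall>\<tau>\<in>N. (\<lambda>\<tau>. \<eta> \<tau> x) differentiable (at \<tau>)) \<and>
     (\<forall>n\<ge>1. \<forall>\<tau>\<in>N.
        (\<forall>\<zeta>. (\<integral>\<omega>. frechet_derivative (\<lambda>t. crit M \<eta> n (\<lambda>i. X i \<omega>) (t, snd \<tau>)) (at (fst \<tau>)) \<zeta> \<partial>S) = 0) \<and>
        (\<forall>g. (\<integral>\<omega>. frechet_derivative (\<lambda>h. crit M \<eta> n (\<lambda>i. X i \<omega>) (fst \<tau>, h)) (at (snd \<tau>)) g \<partial>S) = 0)
        \<longleftrightarrow> \<tau> = \<tau>0)"

definition derivative_comparison ::
    "'x measure \<Rightarrow> ('p::real_normed_vector \<times> 'h::real_normed_vector \<Rightarrow> 'x \<Rightarrow> real) \<Rightarrow> 'p \<times> 'h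
      \<Rightarrow> ('p \<times> 'h) set \<Rightarrow> ('p \<Rightarrow> 'x \<Rightarrow> real) \<Rightarrow> ('h \<Rightarrow> 'x \<Rightarrow> real) \<Rightarrow> real \<Rightarrow> real \<Rightarrow> bool" where
  "derivative_comparison M \<eta> \<tau>0 N L\<theta> Lh C1 C2 \<longleftrightarrow>
     0 < C1 \<and> 0 < C2 \<and>
     (\<forall>\<tau>\<in>N. bounded_linear_L20 (law M \<eta> \<tau>0) (D_theta \<eta> \<tau>) \<and>
             bounded_linear_L20 (law M \<eta> \<tau>0) (D_h \<eta> \<tau>)) \<and>
     (\<forall>\<tau>\<in>N. \<forall>\<delta>.
        C1 * var M \<eta> \<tau>0 (L_joint L\<theta> Lh \<delta>) \<le> var M \<eta> \<tau>0 (D_joint \<eta> \<tau> \<delta>) \<and>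
        var M \<eta> \<tau>0 (D_joint \<eta> \<tau> \<delta>) \<le> C2 * var M \<eta> \<tau>0 (L_joint L\<theta> Lh \<delta>))"

definition derivative_variation ::
    "'x measure \<Rightarrow> ('p::real_normed_vector \<times> 'h::real_normed_vector \<Rightarrow> 'x \<Rightarrow> real) \<Rightarrow> 'p \<times> 'h
      \<Rightarrow> ('p \<times> 'h) set \<Rightarrow> ('p \<Rightarrow> 'x \<Rightarrow> real) \<Rightarrow> ('h \<Rightarrow> 'x \<Rightarrow> real) \<Rightarrow> real \<Rightarrow> bool" where
  "derivative_variation M \<eta> \<tau>0 N L\<theta> Lh C1 \<longleftrightarrow>
     (\<exists>Cd>0. Cd < 2 * C1 \<and>
        (\<forall>\<tau>1\<in>N. \<forall>\<tau>2\<in>N. \<forall>\<delta>\<in>N.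
           var M \<eta> \<tau>0 (\<lambda>x. D_joint \<eta> \<tau>1 \<delta> x - D_joint \<eta> \<tau>2 \<delta> x)
             \<le> Cd * var M \<eta> \<tau>0 (L_joint L\<theta> Lh \<delta>)))"

definition variance_comparison ::
    "'x measure \<Rightarrow> ('q \<Rightarrow> 'x \<Rightarrow> real) \<Rightarrow> 'q \<Rightarrow> 'q set \<Rightarrow> bool" where
  "variance_comparison M \<eta> \<tau>0 N \<longleftrightarrow>
     (\<exists>C3>0. \<exists>C4>0. \<forall>\<tau>\<in>N. \<forall>f\<in>L20 (law M \<eta> \<tau>0).
        C3 * var M \<eta> \<tau>0 f \<le> var M \<eta> \<tau> f \<and> var M \<eta> \<tau> f \<le> C4 * var M \<eta> \<tau>0 f)"

definition completely_continuous ::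
    "('h::real_normed_vector \<Rightarrow> real) \<Rightarrow> ('h \<Rightarrow> real) \<Rightarrow> bool" where
  "completely_continuous Q J \<longleftrightarrow>
     (\<forall>\<epsilon>>0. \<exists>F. finite F \<and> (\<forall>m\<in>F. bounded_linear (m :: 'h \<Rightarrow> real)) \<and>
        (\<forall>g. (\<forall>m\<in>F. m g = 0) \<longrightarrow> Q g \<le> \<epsilon> * J g))"

text \<open>
  The full eigensystem, indexed from 1, of \<open>JB\<close> relative to the form \<open>VB\<close>.  The density of
  the span says that no eigenfunction is missing; since both forms are continuous it also
  gives \<open>JB (\<phi> \<nu>) g = \<rho> \<nu> * VB (\<phi> \<nu>) g\<close> for all \<open>g\<close>.
\<close>

definition eigensystem ::
    "('h::real_normed_vector \<Rightarrow> 'h \<Rightarrow> real) \<Rightarrow> ('h \<Rightarrow> 'h \<Rightarrow> real)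
      \<Rightarrow> (nat \<Rightarrow> 'h) \<Rightarrow> (nat \<Rightarrow> real) \<Rightarrow> bool" where
  "eigensystem VB JB \<phi> \<rho> \<longleftrightarrow>
     (\<forall>\<nu>\<ge>1. \<forall>\<mu>\<ge>1. VB (\<phi> \<nu>) (\<phi> \<mu>) = (if \<nu> = \<mu> then 1 else 0)) \<and>
     (\<forall>\<nu>\<ge>1. \<forall>\<mu>\<ge>1. JB (\<phi> \<nu>) (\<phi> \<mu>) = (if \<nu> = \<mu> then \<rho> \<nu> else 0)) \<and>
     (\<forall>\<nu>\<ge>1. 0 \<le> \<rho> \<nu>) \<and> filterlim \<rho> at_top sequentially \<and>
     closure (span (\<phi> ` {1..})) = UNIV"

definition eigenvalue_growth :: "(nat \<Rightarrow> real) \<Rightarrow> real \<Rightarrow> bool" where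
  "eigenvalue_growth \<rho> r \<longleftrightarrow>
     1 < r \<and> (\<exists>\<beta>1 \<beta>2 \<kappa>. 0 < \<beta>1 \<and>
        (\<forall>\<nu>\<ge>1. \<rho> \<nu> = \<kappa> \<nu> * real \<nu> powr r \<and> \<beta>1 < \<kappa> \<nu> \<and> \<kappa> \<nu> < \<beta>2))"


section \<open>Stochastic order\<close>

text \<open>
  Both notions are stated through measurable sets that contain, or are contained in, the
  event in question.  For measurable events this is the usual definition, and it keeps its
  meaning if an event is not known to be measurable (\<open>measure\<close> is 0 on nonmeasurable sets).
\<close>

definition bounded_in_prob :: "'w measure \<Rightarrow> (nat \<Rightarrow> 'w \<Rightarrow> real) \<Rightarrow> (nat \<Rightarrow> real) \<Rightarrow> bool" where
  "bounded_in_prob S Y a \<longleftrightarrow>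
     (\<forall>\<epsilon>>0. \<exists>K. \<forall>\<^sub>F n in sequentially. \<exists>E\<in>sets S.
        {\<omega> \<in> space S. \<bar>Y n \<omega>\<bar> > K * a n} \<subseteq> E \<and> measure S E \<le> \<epsilon>)"

definition with_prob_tending_to_1 :: "'w measure \<Rightarrow> (nat \<Rightarrow> 'w \<Rightarrow> bool) \<Rightarrow> bool" where
  "with_prob_tending_to_1 S A \<longleftrightarrow>
     (\<exists>G. (\<forall>n. G n \<in> sets S) \<and> (\<forall>n. \<forall>\<omega>\<in>G n. A n \<omega>) \<and> (\<lambda>n. measure S (G n)) \<longlonglongrightarrow> 1)"

end

theory Submission
  imports Defs
begin

text \<open>
  Write \<open>loss v = - ln (f / f0)\<close> for the density \<open>f\<close> at \<open>\<tau>0 + v\<close>, and measure \<open>v = (\<zeta>, g)\<close> by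
  \<open>sqnorm l v = norm \<zeta> ^ 2 + V (Lh g) + l * J g\<close>, whose effective dimension is of order
  \<open>l powr (- 1 / r)\<close>. The sample criterion is convex, so the penalized estimate is a global minimum,
  and it suffices that the penalized criterion exceeds its value at \<open>\<tau>0\<close> on a sphere
  \<open>sqnorm l v = R * rate n l\<close>, uniformly and with high probability.

  The derivative of \<open>\<eta>\<close> varies with the parameter, so this is an empirical process bound and no Taylor
  argument. The variance comparison makes the density ratios bounded on the neighbourhood, and convexity
  turns this into a lower bound of the Hellinger distance by the norm. At the points of a net of
  exponential size, Chernoff's inequality for the square root of the likelihood ratio bounds the
  criterion from below. Between a net point \<open>a\<close> and \<open>v\<close> the loss exceeds its tangent at \<open>a\<close>, and since
  the increments are bounded the tangent may be truncated. The truncated linear process is controlled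
  uniformly over all directions by a PAC-Bayes inequality for random signs that requires second
  moments only and never evaluates the likelihood outside the neighbourhood.

  The quadratic criterion is handled by the Cauchy-Schwarz inequality in the coordinates of the
  eigensystem.
\<close>

section \<open>Tilted signs and truncated exponential moments\<close>

text \<open>The obstacle is the score: \<open>D a w\<close> is controlled in mean square only,
  without a bound on its size or its tails, and moving the base point may change it by an amount
  comparable to the norm itself. Linearizing at \<open>\<tau>0\<close> therefore leaves a remainder
  of the same order as the curvature, and Bernstein-type bounds for the score are out of reach. What
  is bounded is the loss, and convexity transfers this to the score on the one side that matters: an
  increment of the loss falls below its drift by at most \<open>4 * \<Lambda>\<close>.

  The net stops at a fixed small fraction of the radius, so that its log-cardinality is of the order
  of the effective dimension. The step from the net to \<open>v\<close> is charged to the signs,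
  which have variance \<open>1 / (n * (1 + \<tau> i))\<close> in coordinate \<open>i\<close>. Their
  total variance is the effective dimension over \<open>n\<close>, which is the stochastic part of
  the rate, and the entropy of shifting them is \<open>n\<close> times the weighted squared length
  of the step, a small fraction of the Hellinger gain at \<open>v\<close>.\<close>

text \<open>For a list of pairs \<open>(b, e)\<close>, \<open>tilt L G u\<close> is the expectation of \<open>G (u + \<Sum> \<plusminus>e)\<close> over
  independent signs with means \<open>b\<close>; \<open>flat L\<close> makes the signs fair. The recursion avoids product spaces.\<close>

fun tilt :: "(real \<times> 'q::real_vector) list \<Rightarrow> ('q \<Rightarrow> real) \<Rightarrow> 'q \<Rightarrow> real" where
  "tilt [] G u = G u"
| "tilt ((b, e) # L) G u = (1 + b) / 2 * tilt L G (u + e) + (1 - b) / 2 * tilt L G (u - e)"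

definition flat :: "(real \<times> 'q::real_vector) list \<Rightarrow> (real \<times> 'q) list" where
  "flat L = map (\<lambda>(b, e). (0, e)) L"

definition tilt_mean :: "(real \<times> 'q::real_vector) list \<Rightarrow> 'q" where
  "tilt_mean L = (\<Sum>(b, e)\<leftarrow>L. b *\<^sub>R e)"

lemma flat_simps [simp]: "flat [] = []" "flat ((b, e) # L) = (0, e) # flat L"
  by (simp_all add: flat_def)

lemma tilt_mean_simps [simp]:
  "tilt_mean [] = 0" "tilt_mean ((b, e) # L) = b *\<^sub>R e + tilt_mean L"
  by (simp_all add: tilt_mean_def)

definition tiltable :: "(real \<times> 'q::real_vector) list \<Rightarrow> bool" where
  "tiltable L \<longleftrightarrow> (\<forall>(b, e)\<in>set L. \<bar>b\<bar> \<le> 1)"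

lemma tiltable_simps [simp]:
  "tiltable []" "tiltable ((b, e) # L) \<longleftrightarrow> \<bar>b\<bar> \<le> 1 \<and> tiltable L"
  by (auto simp: tiltable_def)

lemma tiltable_flat [simp]: "tiltable (flat L)"
  by (auto simp: tiltable_def flat_def)

lemma tilt_mono:
  assumes "tiltable L" "\<And>v. G v \<le> H v"
  shows "tilt L G u \<le> tilt L H u"
  using assms(1)
proof (induction L arbitrary: u)
  case (Cons p L)
  obtain b e where p: "p = (b, e)" by force
  have "\<bar>b\<bar> \<le> 1" "tiltable L" using Cons.prems p by auto
  then show ?case
    unfolding p tilt.simps by (intro add_mono mult_left_mono Cons.IH) auto
qed (use assms in auto)

lemma tilt_add: "tilt L (\<lambda>v. G v + H v) u = tilt L G u + tilt L H u"
  by (induction L arbitrary: u) (auto simp: algebra_simps)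

lemma tilt_cmult: "tilt L (\<lambda>v. c * G v) u = c * tilt L G u"
  by (induction L arbitrary: u) (auto simp: algebra_simps)

lemma tilt_const [simp]: "tilt L (\<lambda>_. c) u = c"
  by (induction L arbitrary: u) (auto simp: field_simps)

lemma tilt_sum: "tilt L (\<lambda>v. \<Sum>i\<in>A. G i v) u = (\<Sum>i\<in>A. tilt L (G i) u)"
  by (induction A rule: infinite_finite_induct) (simp_all add: tilt_add)

lemma tilt_linear:
  assumes "linear (f :: 'q::real_vector \<Rightarrow> real)"
  shows "tilt L f u = f (u + tilt_mean L)"
proof (induction L arbitrary: u)
  case (Cons p L)
  obtain b e where p: "p = (b, e)" by force
  show ?case
    unfolding p tilt.simps Cons tilt_mean_simps
    by (simp add: linear_add[OF assms] linear_diff[OF assms] linear_cmul[OF assms] field_simps)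
qed auto

text \<open>Bias and variance: a sign of mean \<open>b\<close> has variance
  \<open>1 - b\<^sup>2\<close>, and independence removes the cross terms.\<close>

lemma tilt_quadratic:
  fixes B :: "'q::real_vector \<Rightarrow> 'q \<Rightarrow> real"
  assumes "bilinear B" "\<And>x y. B x y = B y x"
  shows "tilt L (\<lambda>v. B v v) u =
     B (u + tilt_mean L) (u + tilt_mean L) + (\<Sum>(b, e)\<leftarrow>L. (1 - b\<^sup>2) * B e e)"
proof (induction L arbitrary: u)
  case (Cons p L)
  obtain b e where p: "p = (b, e)" by force
  define y where "y = u + tilt_mean L"
  have sq: "B (y + c *\<^sub>R e) (y + c *\<^sub>R e) = B y y + 2 * c * B y e + c\<^sup>2 * B e e" for c
    by (simp add: bilinear_ladd[OF assms(1)] bilinear_radd[OF assms(1)] bilinear_lmul[OF assms(1)]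
      bilinear_rmul[OF assms(1)] assms(2)[of e y] power2_eq_square algebra_simps)
  have "u + e + tilt_mean L = y + 1 *\<^sub>R e" "u - e + tilt_mean L = y + (-1) *\<^sub>R e"
    "u + (b *\<^sub>R e + tilt_mean L) = y + b *\<^sub>R e"
    by (simp_all add: y_def)
  then show ?case
    unfolding p tilt.simps Cons tilt_mean_simps by (simp only: sq) (simp add: field_simps)
qed auto

text \<open>The relative entropy of a sign of mean \<open>b\<close> with respect to a fair one is at
  most its chi-square divergence \<open>b\<^sup>2\<close>. This is the change of measure for one
  sign.\<close>

lemma two_point_entropy:
  fixes b x y :: real
  assumes "\<bar>b\<bar> \<le> 1"
  shows "(1 + b) / 2 * x + (1 - b) / 2 * y \<le> ln ((exp x + exp y) / 2) + b\<^sup>2"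
proof -
  define s where "s = ln ((exp x + exp y) / 2)"
  have es: "exp s = (exp x + exp y) / 2"
    unfolding s_def by (simp add: add_pos_pos)
  \<comment> \<open>Young's inequality for the entropy at an outcome of probability
    \<open>p\<close>. Here \<open>2 * p\<close> is the density relative to the fair sign, and
    subtracting \<open>s\<close> makes the fair mean of \<open>exp (z - s)\<close> equal to
    1.\<close>
  have key: "p * (z - s) \<le> exp (z - s) / 2 - p + p * (2 * p - 1)" if "0 \<le> p" "p \<le> 1" for p z :: real
  proof (cases "p = 0")
    case False
    then have p: "p > 0" using that by simp
    have "z - s - ln (2 * p) \<le> exp (z - s - ln (2 * p)) - 1"
      using exp_ge_add_one_self[of "z - s - ln (2 * p)"] by linarith
    also have "exp (z - s - ln (2 * p)) = exp (z - s) / (2 * p)"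
      using p by (simp add: exp_diff)
    finally have "z - s \<le> exp (z - s) / (2 * p) - 1 + ln (2 * p)" by simp
    also have "\<dots> \<le> exp (z - s) / (2 * p) - 1 + (2 * p - 1)"
      using ln_le_minus_one[of "2 * p"] p by simp
    finally have "p * (z - s) \<le> p * (exp (z - s) / (2 * p) - 1 + (2 * p - 1))"
      using p by (intro mult_left_mono) auto
    then show ?thesis using p by (simp add: algebra_simps)
  qed simp
  have "(1 + b) / 2 * (x - s) + (1 - b) / 2 * (y - s)
     \<le> (exp (x - s) + exp (y - s)) / 2 - 1 + (1 + b) / 2 * b - (1 - b) / 2 * b"
  proof -
    have "(1 + b) / 2 * (x - s) \<le> exp (x - s) / 2 - (1 + b) / 2 + (1 + b) / 2 * (2 * ((1 + b) / 2) - 1)"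
      using assms by (intro key) auto
    moreover have "(1 - b) / 2 * (y - s) \<le> exp (y - s) / 2 - (1 - b) / 2 + (1 - b) / 2 * (2 * ((1 - b) / 2) - 1)"
      using assms by (intro key) auto
    ultimately show ?thesis by (simp add: add_divide_distrib diff_divide_distrib algebra_simps)
  qed
  also have "(exp (x - s) + exp (y - s)) / 2 = 1"
  proof -
    have "exp (x - s) + exp (y - s) = (exp x + exp y) / exp s"
      by (simp add: exp_diff add_divide_distrib)
    also have "exp x + exp y = 2 * exp s" using es by simp
    finally show ?thesis by simp
  qed
  finally show ?thesis
    unfolding s_def[symmetric] by (simp add: field_simps power2_eq_square)
qed

lemma tilt_pos: "tiltable L \<Longrightarrow> (\<And>v. 0 < G v) \<Longrightarrow> 0 < tilt L G u"
proof (induction L arbitrary: u)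
  case (Cons p L)
  obtain b e where p: "p = (b, e)" by force
  have b: "\<bar>b\<bar> \<le> 1" and L: "tiltable L" using Cons.prems p by auto
  have 1: "0 < tilt L G (u + e)" "0 < tilt L G (u - e)"
    using Cons.IH L Cons.prems by auto
  show ?case
  proof (cases "b > 0")
    case True
    then have "0 < (1 + b) / 2 * tilt L G (u + e)" using 1 by simp
    moreover have "0 \<le> (1 - b) / 2 * tilt L G (u - e)" using 1 b by simp
    ultimately show ?thesis by (simp add: p)
  next
    case False
    then have "0 < (1 - b) / 2 * tilt L G (u - e)" using 1 by simp
    moreover have "0 \<le> (1 + b) / 2 * tilt L G (u + e)" using 1 b by simp
    ultimately show ?thesis by (simp add: p)
  qed
qed auto

text \<open>The change-of-measure inequality behind PAC-Bayes bounds: the cost \<open>\<Sum> b\<^sup>2\<close> bounds the relative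
  entropy of the tilted signs with respect to the fair ones.\<close>

lemma tilt_le_ln_flat:
  assumes "tiltable L"
  shows "tilt L G u \<le> ln (tilt (flat L) (\<lambda>v. exp (G v)) u) + (\<Sum>(b, e)\<leftarrow>L. b\<^sup>2)"
  using assms
proof (induction L arbitrary: u)
  case (Cons p L)
  obtain b e where p: "p = (b, e)" by force
  have b: "\<bar>b\<bar> \<le> 1" and L: "tiltable L" using Cons.prems p by auto
  define S where "S = (\<Sum>(b, e)\<leftarrow>L. b\<^sup>2)"
  define W where "W = (\<lambda>u. tilt (flat L) (\<lambda>v. exp (G v)) u)"
  have W: "W u > 0" for u unfolding W_def by (rule tilt_pos) auto
  have IH: "tilt L G u \<le> ln (W u) + S" for u
    using Cons.IH[OF L] unfolding W_def S_def .
  have "tilt (p # L) G u \<le> (1 + b) / 2 * (ln (W (u + e)) + S) + (1 - b) / 2 * (ln (W (u - e)) + S)"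
    unfolding p tilt.simps using b by (intro add_mono mult_left_mono IH) auto
  also have "\<dots> = (1 + b) / 2 * ln (W (u + e)) + (1 - b) / 2 * ln (W (u - e)) + S"
    by (simp add: field_simps)
  also have "\<dots> \<le> ln ((W (u + e) + W (u - e)) / 2) + b\<^sup>2 + S"
    using two_point_entropy[OF b, of "ln (W (u + e))" "ln (W (u - e))"] W by simp
  finally show ?case
    by (simp add: p W_def S_def add_divide_distrib)
qed auto

lemma tilt_integral:
  assumes "\<And>v. integrable M (\<lambda>\<omega>. G \<omega> v)"
  shows "integrable M (\<lambda>\<omega>. tilt L (G \<omega>) u)"
    and "(\<integral>\<omega>. tilt L (G \<omega>) u \<partial>M) = tilt L (\<lambda>v. \<integral>\<omega>. G \<omega> v \<partial>M) u"
proof -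
  have "integrable M (\<lambda>\<omega>. tilt L (G \<omega>) u) \<and>
     (\<integral>\<omega>. tilt L (G \<omega>) u \<partial>M) = tilt L (\<lambda>v. \<integral>\<omega>. G \<omega> v \<partial>M) u"
  proof (induction L arbitrary: u)
    case (Cons p L)
    obtain b e where p: "p = (b, e)" by force
    show ?case unfolding p tilt.simps using Cons by (subst Bochner_Integration.integral_add) auto
  qed (use assms in auto)
  then show "integrable M (\<lambda>\<omega>. tilt L (G \<omega>) u)"
    and "(\<integral>\<omega>. tilt L (G \<omega>) u \<partial>M) = tilt L (\<lambda>v. \<integral>\<omega>. G \<omega> v \<partial>M) u" by auto
qed

text \<open>Catoni's influence function: it dominates the truncated identity, while the exponential of it is a
  polynomial, so that its exponential moments need second moments only.\<close>

definition catoni :: "real \<Rightarrow> real" where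
  "catoni z = ln (1 + z + z\<^sup>2)"

lemma catoni_arg_ge: "3 / 4 \<le> 1 + z + (z::real)\<^sup>2"
  using zero_le_power2[of "z + 1/2"] by (simp add: power2_eq_square algebra_simps)

lemma exp_catoni: "exp (catoni z) = 1 + z + z\<^sup>2"
  unfolding catoni_def using catoni_arg_ge[of z] by (intro exp_ln) linarith

lemma catoni_ge: "-1 \<le> catoni z"
proof -
  have "exp (-1 :: real) \<le> 3 / 4"
    using exp_ge_add_one_self[of 1] by (simp add: exp_minus field_simps)
  then have "exp (-1) \<le> exp (catoni z)" unfolding exp_catoni using catoni_arg_ge[of z] by linarith
  then show ?thesis by simp
qed

lemma min_le_catoni: "min t 1 \<le> catoni t"
proof -
  have *: "exp s \<le> 1 + s + s\<^sup>2" if "s \<le> 1" for s :: real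
  proof (cases "s \<ge> 0")
    case True then show ?thesis using exp_bound that by auto
  next
    case False
    have "exp s * (1 - s) \<le> 1"
      using exp_ge_add_one_self[of "-s"] False
      by (simp add: exp_minus field_simps)
    moreover have "s ^ 3 \<le> 0" using False by (simp add: power3_eq_cube mult_nonneg_nonpos2 mult_nonpos_nonpos mult_le_0_iff zero_le_mult_iff)
    then have "(1 + s + s\<^sup>2) * (1 - s) \<ge> 1" by (simp add: algebra_simps power2_eq_square power3_eq_cube)
    ultimately have "exp s * (1 - s) \<le> (1 + s + s\<^sup>2) * (1 - s)" by linarith
    then show ?thesis using False by (simp add: mult_le_cancel_right)
  qed
  show ?thesis
  proof (cases "t \<le> 1")
    case True
    then have "exp t \<le> exp (catoni t)" unfolding exp_catoni by (rule *)
    then show ?thesis by simp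
  next
    case False
    then have "1 + t + t\<^sup>2 \<ge> 1 + 1 + 1" by (intro add_mono) (auto simp: one_le_power)
    then have "exp 1 \<le> exp (catoni t)" unfolding exp_catoni using exp_le by linarith
    then show ?thesis by simp
  qed
qed

text \<open>Adding \<open>z\<^sup>2 / 6\<close> makes \<open>catoni\<close> convex, and the parabola
  comes from the tangent of that convex function at \<open>t\<close>. With
  \<open>p = 1 + z + z\<^sup>2\<close> the second derivative of the sum is
  \<open>(p - 3)\<^sup>2 / (3 * p\<^sup>2)\<close>, so \<open>1 / 6\<close> is the smallest possible
  coefficient.\<close>

lemma catoni_above_parabola:
  "\<exists>c. \<forall>z. catoni z \<ge> catoni t + c * (z - t) - (z - t)\<^sup>2 / 6"
proof -
  define f where "f = (\<lambda>z::real. catoni z + z\<^sup>2 / 6)"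
  define f' where "f' = (\<lambda>z::real. (1 + 2 * z) / (1 + z + z\<^sup>2) + z / 3)"
  define f'' where "f'' = (\<lambda>z::real. (2 * (1 + z + z\<^sup>2) - (1 + 2 * z)\<^sup>2) / (1 + z + z\<^sup>2)\<^sup>2 + 1 / 3)"
  have pos: "1 + z + z\<^sup>2 > 0" for z :: real using catoni_arg_ge[of z] by linarith
  have d1: "(f has_real_derivative f' z) (at z)" for z
    unfolding f_def f'_def catoni_def
    by (rule derivative_eq_intros refl | use pos[of z] in force)+
  have d2: "(f' has_real_derivative f'' z) (at z)" for z
    unfolding f'_def f''_def using pos[of z]
    by (auto intro!: derivative_eq_intros simp: power2_eq_square)
  have d3: "f'' z \<ge> 0" for z
  proof -
    let ?p = "1 + z + z\<^sup>2"
    have e: "(1 + 2 * z)\<^sup>2 = 4 * ?p - 3" by (simp add: power2_eq_square algebra_simps)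
    have "f'' z = ((?p - 3)\<^sup>2) / (3 * ?p\<^sup>2)"
    proof -
      have "(2 * p - (4 * p - 3)) / p\<^sup>2 + 1 / 3 = (p - 3)\<^sup>2 / (3 * p\<^sup>2)" if "p > 0" for p :: real
        using that by (simp add: divide_simps) (simp add: power2_eq_square algebra_simps)
      then show ?thesis unfolding f''_def e using pos[of z] by blast
    qed
    then show ?thesis by simp
  qed
  have conv: "convex_on UNIV f"
    by (rule f''_ge0_imp_convex[OF convex_UNIV d1 d2 d3])
  have *: "f z - f t \<ge> f' t * (z - t)" for z
    using convex_on_imp_above_tangent[OF conv, of t z] d1 by auto
  have "catoni z \<ge> catoni t + (f' t - t / 3) * (z - t) - (z - t)\<^sup>2 / 6" for z
  proof -
    have "(z - t)\<^sup>2 = z\<^sup>2 - 2 * z * t + t\<^sup>2" by (simp add: power2_eq_square algebra_simps)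
    moreover have "(f' t - t / 3) * (z - t) = f' t * (z - t) - z * t / 3 + t\<^sup>2 / 3"
      by (simp add: power2_eq_square field_simps)
    ultimately show ?thesis using *[of z] unfolding f_def by linarith
  qed
  then show ?thesis by blast
qed

text \<open>The summand \<open>min (q / 6) 2\<close> is going to compensate the averaging of
  \<open>catoni\<close> over signs. Because of its cap, its exponential is dominated by an affine
  function of \<open>q\<close>, so that expectations of the right-hand side involve second moments
  only.\<close>

lemma exp_catoni_bound:
  assumes "0 \<le> q"
  shows "exp (catoni z + min (q / 6) 2) \<le> 1 + z + 9 * z\<^sup>2 + 3 * (q::real)"
proof -
  define x where "x = min (q / 6) 2"
  define Y where "Y = exp x - 1"
  have x: "0 \<le> x" "x \<le> 2" "x \<le> q / 6" using assms by (auto simp: x_def)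
  have e2: "exp (2::real) \<le> 8"
  proof -
    have "exp (1::real) \<le> 2.8" using e_less_272 by simp
    then have "exp (1::real) * exp 1 \<le> 2.8 * 2.8" by (intro mult_mono) auto
    then show ?thesis by (simp add: exp_add[symmetric])
  qed
  have Y0: "0 \<le> Y" using x by (simp add: Y_def)
  have "exp x \<le> exp 2" using x by simp
  then have Y7: "Y \<le> 7" using e2 unfolding Y_def by linarith
  \<comment> \<open>The chord of \<open>exp\<close> over the interval from 0 to 2, of slope at most
    \<open>7 / 2\<close> since \<open>exp 2 \<le> 8\<close>.\<close>
  have "exp ((1 - x / 2) *\<^sub>R 0 + (x / 2) *\<^sub>R 2) \<le> (1 - x / 2) * exp 0 + (x / 2) * exp 2"
    using x by (intro convex_onD[OF exp_convex]) auto
  then have "exp x \<le> (1 - x / 2) * exp 0 + (x / 2) * exp 2" by simp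
  also have "\<dots> \<le> 1 + x / 2 * 7"
  proof -
    have "x / 2 * exp 2 \<le> x / 2 * 8" using x e2 by (intro mult_left_mono) auto
    then show ?thesis by simp
  qed
  finally have Yq: "Y \<le> q" using x by (simp add: Y_def)
  have zY: "z * Y \<le> z\<^sup>2 + Y\<^sup>2 / 4"
    using zero_le_power2[of "z - Y / 2"] by (simp add: power2_eq_square algebra_simps)
  have Y2: "Y\<^sup>2 \<le> 7 * Y" using Y0 Y7 by (simp add: power2_eq_square mult_right_mono)
  have z2Y: "z\<^sup>2 * Y \<le> z\<^sup>2 * 7" using Y7 by (intro mult_left_mono) auto
  have "exp (catoni z + x) = (1 + z + z\<^sup>2) * (1 + Y)"
    by (simp add: exp_add exp_catoni Y_def)
  also have "\<dots> = 1 + z + z\<^sup>2 + Y + z * Y + z\<^sup>2 * Y" by (simp add: algebra_simps)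
  also have "\<dots> \<le> 1 + z + 9 * z\<^sup>2 + 3 * q"
    using zY Y2 z2Y Yq Y0 by linarith
  finally show ?thesis unfolding x_def .
qed

text \<open>A reverse Jensen inequality. By the parabola below \<open>catoni\<close>, averaging over
  the signs loses at most a sixth of the variance of \<open>f\<close>. Since \<open>catoni\<close>
  is at least -1 and the left-hand side at most 1, the loss is also at most 2.\<close>

lemma min_le_tilt_catoni:
  fixes f :: "'q::real_vector \<Rightarrow> real"
  assumes "linear f" "tiltable L"
  shows "min (f (tilt_mean L)) 1
    \<le> tilt L (\<lambda>v. catoni (f v)) 0 + min ((\<Sum>(b, e)\<leftarrow>L. (f e)\<^sup>2) / 6) 2"
proof -
  define t where "t = f (tilt_mean L)"
  define q where "q = (\<Sum>(b, e)\<leftarrow>L. (f e)\<^sup>2)"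
  define c' where "c' = tilt L (\<lambda>v. catoni (f v)) 0"
  obtain c where c: "\<And>z. catoni z \<ge> catoni t + c * (z - t) - (z - t)\<^sup>2 / 6"
    using catoni_above_parabola by blast
  have "tilt L (\<lambda>v. -1) 0 \<le> c'" unfolding c'_def
    by (rule tilt_mono[OF assms(2)]) (rule catoni_ge)
  then have 1: "min t 1 \<le> c' + 2" by simp
  have bil: "bilinear (\<lambda>x y. f x * f y)"
    unfolding bilinear_def by (auto intro!: linearI simp: linear_add[OF assms(1)] linear_cmul[OF assms(1)] algebra_simps)
  \<comment> \<open>Average of the parabola: under the tilt \<open>f\<close> has mean
    \<open>t\<close>, so the unknown slope \<open>c\<close> cancels and only the variance
    remains.\<close>
  have "tilt L (\<lambda>v. (catoni t - c * t - t\<^sup>2 / 6) + ((c + t / 3) * f v + (-1/6) * (f v * f v))) 0 \<le> c'"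
    unfolding c'_def
  proof (rule tilt_mono[OF assms(2)])
    fix v show "(catoni t - c * t - t\<^sup>2 / 6) + ((c + t / 3) * f v + (-1/6) * (f v * f v)) \<le> catoni (f v)"
      using c[of "f v"] by (simp add: power2_eq_square field_simps)
  qed
  moreover have "tilt L (\<lambda>v. (catoni t - c * t - t\<^sup>2 / 6) + ((c + t / 3) * f v + (-1/6) * (f v * f v))) 0
     = catoni t - (\<Sum>(b, e)\<leftarrow>L. (1 - b\<^sup>2) * (f e * f e)) / 6"
    unfolding tilt_add tilt_cmult tilt_const tilt_linear[OF assms(1)] tilt_quadratic[OF bil mult.commute]
    by (simp add: t_def[symmetric] power2_eq_square field_simps)
  moreover have "(\<Sum>(b, e)\<leftarrow>L. (1 - b\<^sup>2) * (f e * f e)) \<le> q"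
  proof -
    have "(1 - b\<^sup>2) * (f e * f e) \<le> (f e)\<^sup>2" for b e
      using zero_le_power2[of "b * f e"] by (simp add: power2_eq_square algebra_simps)
    then show ?thesis unfolding q_def by (intro sum_list_mono) auto
  qed
  ultimately have "catoni t \<le> c' + q / 6" by linarith
  then have "min t 1 \<le> c' + q / 6" using min_le_catoni[of t] by linarith
  then have "min t 1 \<le> c' + min (q / 6) 2" using 1 by (cases "q / 6 \<le> 2") (auto simp: min_absorb1 min_absorb2)
  then show ?thesis unfolding t_def c'_def q_def .
qed

section \<open>Convex log-likelihoods\<close>

lemma exp_tangent: "exp y * (x - y) \<le> exp x - exp (y::real)"
proof -
  have "exp y * (1 + (x - y)) \<le> exp y * exp (x - y)"
    by (intro mult_left_mono exp_ge_add_one_self) auto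
  then show ?thesis by (simp add: exp_add[symmetric] algebra_simps)
qed

lemma abs_one_minus_exp_ge:
  assumes "\<bar>d\<bar> \<le> (K::real)"
  shows "exp (- K) * \<bar>d\<bar> \<le> \<bar>1 - exp (- d)\<bar>"
proof (cases "d \<ge> 0")
  case True
  have "exp (- K) * d \<le> exp (-d) * d" using assms True by (intro mult_right_mono) auto
  also have "\<dots> \<le> 1 - exp (-d)" using exp_tangent[of "-d" 0] by simp
  finally show ?thesis using True by simp
next
  case False
  have "exp (- K) * (-d) \<le> 1 * (-d)" using assms False by (intro mult_right_mono) auto
  also have "\<dots> \<le> exp (-d) - 1" using exp_ge_add_one_self[of "-d"] by simp
  finally show ?thesis using False by simp
qed

text \<open>Here \<open>l v\<close> is minus the log density ratio at displacement \<open>v\<close>,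
  and \<open>D a w\<close> the score at \<open>a\<close>, centred under the true law. By
  \<open>tangent\<close>, the gradient of the loss at \<open>a\<close> is the mean of
  \<open>D a\<close> under the law at \<open>a\<close> minus \<open>D a\<close> itself; this mean
  stands in for the derivative of the log normalizing constant. \<open>curvature\<close> bounds the
  information at \<open>a\<close> from below. The loss is constrained on \<open>Nb\<close> only,
  while \<open>D a\<close> is linear on the whole space, so random directions may leave
  \<open>Nb\<close>.\<close>

locale convex_likelihood = prob_space P
  for P :: "'x measure" +
  fixes l :: "'q::real_vector \<Rightarrow> 'x \<Rightarrow> real"
    and D :: "'q \<Rightarrow> 'q \<Rightarrow> 'x \<Rightarrow> real"
    and Nb :: "'q set"
    and B :: "'q \<Rightarrow> 'q \<Rightarrow> real"
    and \<Lambda> C c :: real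
  assumes measurable_l [measurable]: "\<And>v. v \<in> Nb \<Longrightarrow> l v \<in> borel_measurable P"
    and measurable_D [measurable]: "\<And>a w. a \<in> Nb \<Longrightarrow> D a w \<in> borel_measurable P"
    and zero_mem: "0 \<in> Nb"
    and half_mem: "\<And>v. v \<in> Nb \<Longrightarrow> (1/2) *\<^sub>R v \<in> Nb"
    and l_zero: "\<And>x. l 0 x = 0"
    and l_bounded: "\<And>v. v \<in> Nb \<Longrightarrow> AE x in P. \<bar>l v x\<bar> \<le> \<Lambda>"
    and l_density: "\<And>v. v \<in> Nb \<Longrightarrow> (\<integral>x. exp (- l v x) \<partial>P) = 1"
    and linear_D: "\<And>a x. a \<in> Nb \<Longrightarrow> x \<in> space P \<Longrightarrow> linear (\<lambda>w. D a w x)"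
    and D_square_integrable: "\<And>a w. a \<in> Nb \<Longrightarrow> integrable P (\<lambda>x. (D a w x)\<^sup>2)"
    and D_centred: "\<And>a w. a \<in> Nb \<Longrightarrow> (\<integral>x. D a w x \<partial>P) = 0"
    and D_upper: "\<And>a w. a \<in> Nb \<Longrightarrow> (\<integral>x. (D a w x)\<^sup>2 \<partial>P) \<le> C * B w w"
    and tangent: "\<And>a b. a \<in> Nb \<Longrightarrow> b \<in> Nb \<Longrightarrow>
      AE x in P. (\<integral>y. D a (b - a) y * exp (- l a y) \<partial>P) - D a (b - a) x \<le> l b x - l a x"
    and curvature: "\<And>a w. a \<in> Nb \<Longrightarrow>
      c * B w w \<le> (\<integral>x. ((\<integral>y. D a w y * exp (- l a y) \<partial>P) - D a w x)\<^sup>2 * exp (- l a x) \<partial>P)"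
    and bilinear_B: "bilinear B"
    and sym_B: "\<And>x y. B x y = B y x"
    and pos_B: "\<And>x. 0 \<le> B x x"
    and \<Lambda>1: "1 \<le> \<Lambda>" and C0: "0 < C" and c0: "0 < c"
begin

section \<open>Drift of the score and Hellinger distance\<close>

definition drift :: "'q \<Rightarrow> 'q \<Rightarrow> real" where
  "drift a w = (\<integral>y. D a w y * exp (- l a y) \<partial>P)"

text \<open>The squared Hellinger distance from the true law, as \<open>exp (- l v x / 2)\<close> is
  the square root of the density ratio.\<close>

definition hell :: "'q \<Rightarrow> real" where
  "hell v = (\<integral>x. (1 - exp (- l v x / 2))\<^sup>2 \<partial>P)"

lemma integrable_bounded:
  assumes "f \<in> borel_measurable P" "AE x in P. \<bar>f x\<bar> \<le> (K::real)"
  shows "integrable P f"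
  using assms by (intro integrable_const_bound[of _ K]) simp_all

lemma D_integrable: "a \<in> Nb \<Longrightarrow> integrable P (D a w)"
  by (rule square_integrable_imp_integrable[OF measurable_D D_square_integrable])

lemma exp_l_bounds:
  assumes "v \<in> Nb"
  shows "AE x in P. exp (- \<Lambda>) \<le> exp (- l v x) \<and> exp (- l v x) \<le> exp \<Lambda>"
  using l_bounded[OF assms]
proof eventually_elim
  case (elim x)
  then have "- \<Lambda> \<le> - l v x" "- l v x \<le> \<Lambda>" by linarith+
  then show ?case by simp
qed

lemma exp_l_integrable:
  assumes "v \<in> Nb" "\<bar>t\<bar> \<le> 1"
  shows "integrable P (\<lambda>x. exp (t * l v x))"
proof (rule integrable_bounded[of _ "exp \<Lambda>"])
  show "AE x in P. \<bar>exp (t * l v x)\<bar> \<le> exp \<Lambda>"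
    using l_bounded[OF assms(1)]
  proof eventually_elim
    case (elim x)
    have "t * l v x \<le> \<bar>t\<bar> * \<bar>l v x\<bar>" by (metis abs_ge_self abs_mult)
    also have "\<dots> \<le> 1 * \<Lambda>" using elim assms(2) by (intro mult_mono) auto
    finally show ?case by simp
  qed
qed (use assms in measurable)

lemma integrable_mult_exp_l:
  assumes "integrable P f" "v \<in> Nb"
  shows "integrable P (\<lambda>x. f x * exp (- l v x))"
proof (rule Bochner_Integration.integrable_bound[of _ "\<lambda>x. exp \<Lambda> * \<bar>f x\<bar>"])
  show "AE x in P. norm (f x * exp (- l v x)) \<le> norm (exp \<Lambda> * \<bar>f x\<bar>)"
    using exp_l_bounds[OF assms(2)]
  proof eventually_elim
    case (elim x)
    have "\<bar>f x\<bar> * exp (- l v x) \<le> \<bar>f x\<bar> * exp \<Lambda>" using elim by (intro mult_left_mono) auto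
    then show ?case by (simp add: abs_mult mult.commute)
  qed
qed (use assms in \<open>auto intro!: borel_measurable_times measurable_compose[OF measurable_l]\<close>)

lemma hell_nonneg: "0 \<le> hell v"
  unfolding hell_def by (rule integral_nonneg_AE) simp

lemma hell_integrable:
  assumes "v \<in> Nb" shows "integrable P (\<lambda>x. (1 - exp (- l v x / 2))\<^sup>2)"
proof -
  have *: "(1 - exp (- l v x / 2))\<^sup>2 = 1 - 2 * exp (- (1 / 2) * l v x) + exp (- 1 * l v x)" for x
    by (simp add: power2_eq_square algebra_simps exp_add[symmetric])
  show ?thesis unfolding * using exp_l_integrable[OF assms, of "-1/2"] exp_l_integrable[OF assms, of "-1"]
    by (intro Bochner_Integration.integrable_add Bochner_Integration.integrable_diff) auto
qed

lemma hell_eq: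
  assumes "v \<in> Nb" shows "hell v = 2 - 2 * (\<integral>x. exp (- l v x / 2) \<partial>P)"
proof -
  have *: "(1 - exp (- l v x / 2))\<^sup>2 = 1 - 2 * exp (- l v x / 2) + exp (- l v x)" for x
    by (simp add: power2_eq_square algebra_simps exp_add[symmetric])
  have "integrable P (\<lambda>x. exp (- l v x / 2))" "integrable P (\<lambda>x. exp (- l v x))"
    using exp_l_integrable[OF assms, of "-1/2"] exp_l_integrable[OF assms, of "-1"] by auto
  then show ?thesis
    unfolding hell_def * by (simp add: l_density[OF assms] prob_space)
qed

text \<open>Averaging the tangent inequality under \<open>P\<close> removes the centred score, which
  may be unbounded, and leaves the drift, which inherits the bound of the losses. This is what
  permits truncation at a fixed level.\<close>

lemma drift_le:
  assumes "a \<in> Nb" "b \<in> Nb"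
  shows "drift a (b - a) \<le> 2 * \<Lambda>"
proof -
  have "AE x in P. drift a (b - a) - D a (b - a) x \<le> 2 * \<Lambda>"
    using tangent[OF assms] l_bounded[OF assms(1)] l_bounded[OF assms(2)]
    unfolding drift_def by eventually_elim linarith
  then have "(\<integral>x. drift a (b - a) - D a (b - a) x \<partial>P) \<le> (\<integral>x. 2 * \<Lambda> \<partial>P)"
    using D_integrable[OF assms(1)] by (intro integral_mono_AE) auto
  then show ?thesis
    using D_integrable[OF assms(1)] by (simp add: D_centred[OF assms(1)] prob_space)
qed

text \<open>The drift is the covariance of the score with the density ratio minus one, which factors
  as \<open>(h - 1) * (h + 1)\<close> for the root \<open>h\<close> of the ratio. Completing a
  square trades a quarter of the Hellinger distance for the second moment of the score; the other
  three quarters remain available as gain.\<close>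

lemma drift_ge:
  assumes "a \<in> Nb"
  shows "drift a w \<ge> - hell a / 4 - 4 * exp (2 * \<Lambda>) * C * B w w"
proof -
  define H where "H x = (1 - exp (- l a x / 2))\<^sup>2" for x
  have "AE x in P. - H x / 4 - 4 * exp (2 * \<Lambda>) * (D a w x)\<^sup>2 \<le> D a w x * exp (- l a x) - D a w x"
    using l_bounded[OF assms]
  proof eventually_elim
    case (elim x)
    define h where "h = exp (- l a x / 2)"
    define d where "d = D a w x"
    define G where "G = exp \<Lambda>"
    have h: "0 < h" "h \<le> G" "1 \<le> G" unfolding h_def G_def using elim \<Lambda>1 by auto
    have e: "exp (- l a x) = h\<^sup>2" unfolding h_def by (simp add: power2_eq_square exp_add[symmetric])
    have G: "exp (2 * \<Lambda>) = G\<^sup>2" unfolding G_def by (simp add: power2_eq_square exp_add[symmetric])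
    have "(1 + h)\<^sup>2 \<le> (2 * G)\<^sup>2" using h by (intro power_mono) auto
    then have *: "d\<^sup>2 * (1 + h)\<^sup>2 \<le> d\<^sup>2 * (2 * G)\<^sup>2" by (intro mult_left_mono) auto
    have "0 \<le> ((1 - h) / 2 - d * (1 + h))\<^sup>2" by simp
    also have "\<dots> = (1 - h)\<^sup>2 / 4 - d * (1 - h\<^sup>2) + d\<^sup>2 * (1 + h)\<^sup>2"
      by (simp add: power2_eq_square field_simps)
    finally have "0 \<le> (1 - h)\<^sup>2 / 4 - d * (1 - h\<^sup>2) + d\<^sup>2 * (2 * G)\<^sup>2" using * by linarith
    then show ?case unfolding H_def h_def[symmetric] d_def[symmetric] e G
      by (simp add: algebra_simps power_mult_distrib)
  qed
  then have "(\<integral>x. - H x / 4 - 4 * exp (2 * \<Lambda>) * (D a w x)\<^sup>2 \<partial>P)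
      \<le> (\<integral>x. D a w x * exp (- l a x) - D a w x \<partial>P)"
    using hell_integrable[OF assms] D_square_integrable[OF assms] D_integrable[OF assms]
      integrable_mult_exp_l[OF D_integrable[OF assms] assms]
    unfolding H_def by (intro integral_mono_AE) auto
  also have "\<dots> = drift a w"
    using D_integrable[OF assms] integrable_mult_exp_l[OF D_integrable[OF assms] assms]
    by (simp add: drift_def D_centred[OF assms])
  also have "(\<integral>x. - H x / 4 - 4 * exp (2 * \<Lambda>) * (D a w x)\<^sup>2 \<partial>P)
     = - hell a / 4 - 4 * exp (2 * \<Lambda>) * (\<integral>x. (D a w x)\<^sup>2 \<partial>P)"
    using hell_integrable[OF assms] D_square_integrable[OF assms] unfolding H_def hell_def by simp
  finally have "- hell a / 4 - 4 * exp (2 * \<Lambda>) * (\<integral>x. (D a w x)\<^sup>2 \<partial>P) \<le> drift a w" .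
  moreover have "4 * exp (2 * \<Lambda>) * (\<integral>x. (D a w x)\<^sup>2 \<partial>P) \<le> 4 * exp (2 * \<Lambda>) * (C * B w w)"
    using D_upper[OF assms] by (intro mult_left_mono) auto
  ultimately show ?thesis unfolding mult.assoc by linarith
qed

lemma drift_scaleR: assumes "a \<in> Nb" shows "drift a (r *\<^sub>R w) = r * drift a w"
proof -
  have "drift a (r *\<^sub>R w) = (\<integral>y. r * (D a w y * exp (- l a y)) \<partial>P)"
    unfolding drift_def by (intro Bochner_Integration.integral_cong) (auto simp: linear_cmul[OF linear_D[OF assms]])
  then show ?thesis by (simp add: drift_def)
qed

text \<open>With \<open>b = v/2\<close>, half of the Hellinger distance is \<open>E [exp (- l b) - exp (- l v / 2)]\<close>.
  It thus measures the convexity gap \<open>l v / 2 - l b\<close>, which dominates the distance between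
  \<open>l v / 2\<close> and the score at \<open>b\<close>.\<close>

lemma hell_ge:
  assumes v: "v \<in> Nb"
  shows "c / (16 * exp (3 * \<Lambda>)) * B v v \<le> hell v"
proof -
  define b where "b = (1/2) *\<^sub>R v"
  have b: "b \<in> Nb" unfolding b_def by (rule half_mem[OF v])
  \<comment> \<open>The gradient of the loss at the midpoint \<open>b\<close> in the direction
    \<open>v / 2\<close>.\<close>
  define g where "g x = (drift b v - D b v x) / 2" for x
  define G where "G = exp \<Lambda>"
  have G: "1 \<le> G" "\<Lambda> \<le> G" "0 < G"
    unfolding G_def using \<Lambda>1 exp_ge_add_one_self[of \<Lambda>] by (auto intro: order_trans[OF _ exp_ge_add_one_self])
  have [measurable]: "l v \<in> borel_measurable P" "l b \<in> borel_measurable P" "D b v \<in> borel_measurable P"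
    using v b by auto
  have vb: "v - b = (1/2) *\<^sub>R v" "0 - b = (-1/2) *\<^sub>R v"
  proof -
    have "v - b = 1 *\<^sub>R v - (1/2) *\<^sub>R v" by (simp add: b_def)
    also have "\<dots> = (1/2) *\<^sub>R v" by (subst scaleR_left_diff_distrib[symmetric]) simp
    finally show "v - b = (1/2) *\<^sub>R v" .
  qed (simp add: b_def)
  have Ds: "D b (r *\<^sub>R v) x = r * D b v x" if "x \<in> space P" for r x
    using linear_cmul[OF linear_D[OF b that]] by simp
  have "AE x in P. drift b (v - b) - D b (v - b) x \<le> l v x - l b x"
    using tangent[OF b v] unfolding drift_def .
  then have t1: "AE x in P. g x \<le> l v x - l b x"
    using AE_space unfolding vb drift_scaleR[OF b]
  proof eventually_elim
    case (elim x)
    then show ?case using Ds[of x "1/2"] by (simp add: g_def diff_divide_distrib)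
  qed
  have "AE x in P. drift b (0 - b) - D b (0 - b) x \<le> l 0 x - l b x"
    using tangent[OF b zero_mem] unfolding drift_def .
  then have t2: "AE x in P. l b x \<le> g x"
    using AE_space unfolding vb drift_scaleR[OF b]
  proof eventually_elim
    case (elim x)
    have "D b ((- 1 / 2) *\<^sub>R v) x = - (D b v x / 2)" using Ds[OF elim(2), of "-1/2"] by simp
    with elim(1) show ?case by (simp add: g_def l_zero diff_divide_distrib)
  qed
  have g_sq_int: "integrable P (\<lambda>x. (g x)\<^sup>2)"
  proof -
    have "(g x)\<^sup>2 = (drift b v)\<^sup>2 / 4 - drift b v / 2 * D b v x + (D b v x)\<^sup>2 / 4" for x
    proof -
      have "((p - d) / 2)\<^sup>2 = p\<^sup>2 / 4 - p / 2 * d + d\<^sup>2 / 4" for p d :: real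
        by (simp add: power_divide power2_diff add_divide_distrib diff_divide_distrib)
      then show ?thesis unfolding g_def .
    qed
    then show ?thesis using D_integrable[OF b] D_square_integrable[OF b] by simp
  qed
  have int1: "integrable P (\<lambda>x. exp (- l b x))" "integrable P (\<lambda>x. exp (- l v x / 2))"
    using exp_l_integrable[OF b, of "-1"] exp_l_integrable[OF v, of "-1/2"] by auto
  have pt: "AE x in P. (g x)\<^sup>2 \<le> 3 * G\<^sup>2 * (exp (- l b x) - exp (- l v x / 2)) + 2 * G\<^sup>2 * (1 - exp (- l v x / 2))\<^sup>2"
    using t1 t2 l_bounded[OF v] l_bounded[OF b]
  proof eventually_elim
    case (elim x)
    define d where "d = l v x / 2"
    define u where "u = d - l b x"
    \<comment> \<open>The tangents at \<open>b\<close> towards \<open>v\<close> and towards 0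
      enclose \<open>g x\<close> between \<open>l b x\<close> and \<open>l v x - l b x\<close>, an
      interval with centre \<open>d\<close> and radius \<open>u\<close>.\<close>
    have u: "\<bar>g x - d\<bar> \<le> u" "0 \<le> u" "u \<le> 3 / 2 * G" using elim G by (auto simp: u_def d_def)
    have "inverse G * u \<le> exp (- d) * u"
      using u elim by (intro mult_right_mono) (auto simp: G_def d_def simp flip: exp_minus)
    also have "\<dots> \<le> exp (- l b x) - exp (- d)"
      using exp_tangent[of "- d" "- l b x"] by (simp add: u_def)
    finally have "u \<le> G * (exp (- l b x) - exp (- d))"
      using G by (simp add: field_simps)
    have "(g x - d)\<^sup>2 \<le> u\<^sup>2" using u by (metis abs_le_square_iff abs_of_nonneg)
    also have "\<dots> \<le> (3 / 2 * G) * (G * (exp (- l b x) - exp (- d)))"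
      unfolding power2_eq_square using u \<open>u \<le> G * _\<close> G by (intro mult_mono) auto
    finally have 1: "(g x - d)\<^sup>2 \<le> 3 / 2 * G\<^sup>2 * (exp (- l b x) - exp (- d))" by (simp add: power2_eq_square)
    have "inverse G * \<bar>d\<bar> \<le> \<bar>1 - exp (- d)\<bar>"
      using abs_one_minus_exp_ge[of d \<Lambda>] elim by (auto simp: G_def d_def exp_minus)
    then have "\<bar>d\<bar> \<le> G * \<bar>1 - exp (- d)\<bar>" using G by (simp add: field_simps)
    then have "\<bar>d\<bar>\<^sup>2 \<le> (G * \<bar>1 - exp (- d)\<bar>)\<^sup>2" by (intro power_mono) auto
    then have 2: "d\<^sup>2 \<le> G\<^sup>2 * (1 - exp (- d))\<^sup>2" by (simp add: power_mult_distrib)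
    have "(g x)\<^sup>2 \<le> 2 * (g x - d)\<^sup>2 + 2 * d\<^sup>2"
      using zero_le_power2[of "g x - 2 * d"] by (simp add: power2_eq_square algebra_simps)
    then show ?case using 1 2 unfolding d_def by simp
  qed
  have "(\<integral>x. (g x)\<^sup>2 \<partial>P) \<le> (\<integral>x. 3 * G\<^sup>2 * (exp (- l b x) - exp (- l v x / 2)) + 2 * G\<^sup>2 * (1 - exp (- l v x / 2))\<^sup>2 \<partial>P)"
    using pt g_sq_int int1 hell_integrable[OF v] by (intro integral_mono_AE) auto
  also have "\<dots> = 3 * G\<^sup>2 * (1 - (\<integral>x. exp (- l v x / 2) \<partial>P)) + 2 * G\<^sup>2 * hell v"
    using int1 hell_integrable[OF v] by (simp add: hell_def l_density[OF b])
  also have "\<dots> = 7 / 2 * G\<^sup>2 * hell v"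
  proof -
    have "1 - (\<integral>x. exp (- l v x / 2) \<partial>P) = hell v / 2" using hell_eq[OF v] by simp
    then show ?thesis by simp
  qed
  finally have 3: "(\<integral>x. (g x)\<^sup>2 \<partial>P) \<le> 7 / 2 * G\<^sup>2 * hell v" .
  have "c * B v v \<le> (\<integral>x. (drift b v - D b v x)\<^sup>2 * exp (- l b x) \<partial>P)"
    using curvature[OF b] unfolding drift_def .
  also have "\<dots> = (\<integral>x. 4 * ((g x)\<^sup>2 * exp (- l b x)) \<partial>P)"
  proof -
    have "(drift b v - D b v x)\<^sup>2 = 4 * (g x)\<^sup>2" for x by (simp add: g_def power_divide)
    then show ?thesis by (simp add: mult.assoc)
  qed
  also have "\<dots> \<le> (\<integral>x. 4 * (G * (g x)\<^sup>2) \<partial>P)"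
  proof (rule integral_mono_AE)
    show "AE x in P. 4 * ((g x)\<^sup>2 * exp (- l b x)) \<le> 4 * (G * (g x)\<^sup>2)"
      using exp_l_bounds[OF b] by eventually_elim (auto simp: G_def mult.commute mult_right_mono)
  qed (use g_sq_int integrable_mult_exp_l[OF g_sq_int b] in auto)
  also have "\<dots> = 4 * G * (\<integral>x. (g x)\<^sup>2 \<partial>P)" using g_sq_int by simp
  also have "\<dots> \<le> 4 * G * (7 / 2 * G\<^sup>2 * hell v)" using 3 G by (intro mult_left_mono) auto
  also have "\<dots> \<le> 16 * G ^ 3 * hell v"
    using hell_nonneg[of v] G by (simp add: power2_eq_square power3_eq_cube)
  also have "G ^ 3 = exp (3 * \<Lambda>)" by (simp add: G_def exp_of_nat_mult[symmetric])
  finally show ?thesis by (simp add: field_simps)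
qed

end

section \<open>Exponential inequalities for independent samples\<close>

text \<open>The compensator with factor \<open>K\<close> is subtracted inside the exponential so
  that \<open>W\<close> can have expectation at most 1. It is paid back under the tilted signs,
  where the form averages to at most its value at \<open>tilt_mean L\<close> plus its sum over the
  directions.\<close>

lemma exp_tilt_sum:
  fixes f :: "nat \<Rightarrow> 'q::real_vector \<Rightarrow> real"
  assumes lin: "\<And>i. i \<in> I \<Longrightarrow> linear (f i)" and L: "tiltable L"
    and bil: "bilinear B" and sym: "\<And>x y. B x y = B y x" and pos: "\<And>x. 0 \<le> B x x" and K: "0 \<le> K"
    and W: "W = tilt (flat L) (\<lambda>u. exp ((\<Sum>i\<in>I. catoni (f i u) + min ((\<Sum>(b, e)\<leftarrow>L. (f i e)\<^sup>2) / 6) 2)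
              - K * (B u u + (\<Sum>(b, e)\<leftarrow>L. B e e)))) 0"
  shows "(\<Sum>i\<in>I. min (f i (tilt_mean L)) 1)
    \<le> ln W + K * (B (tilt_mean L) (tilt_mean L) + 2 * (\<Sum>(b, e)\<leftarrow>L. B e e)) + (\<Sum>(b, e)\<leftarrow>L. b\<^sup>2)"
proof -
  define q where "q i = min ((\<Sum>(b, e)\<leftarrow>L. (f i e)\<^sup>2) / 6) 2" for i
  define T where "T = (\<Sum>(b, e)\<leftarrow>L. B e e)"
  define G where "G u = (\<Sum>i\<in>I. catoni (f i u) + q i) - K * (B u u + T)" for u
  have B0: "B 0 0 = 0" using bilinear_lzero[OF bil] by simp
  have "(\<Sum>i\<in>I. min (f i (tilt_mean L)) 1) \<le> (\<Sum>i\<in>I. tilt L (\<lambda>v. catoni (f i v)) 0 + q i)"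
    unfolding q_def by (intro sum_mono min_le_tilt_catoni lin L)
  also have "\<dots> = tilt L (\<lambda>u. \<Sum>i\<in>I. catoni (f i u) + q i) 0"
    unfolding tilt_sum tilt_add by simp
  also have "\<dots> = tilt L (\<lambda>u. G u + K * (B u u + T)) 0"
    by (simp add: G_def)
  also have "\<dots> = tilt L G 0 + K * (tilt L (\<lambda>u. B u u) 0 + T)"
    unfolding tilt_add tilt_cmult by simp
  also have "tilt L G 0 \<le> ln W + (\<Sum>(b, e)\<leftarrow>L. b\<^sup>2)"
    using tilt_le_ln_flat[OF L, of G 0] unfolding W G_def q_def T_def .
  also have "K * (tilt L (\<lambda>u. B u u) 0 + T) \<le> K * (B (tilt_mean L) (tilt_mean L) + T + T)"
  proof (intro mult_left_mono add_right_mono K)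
    have "(\<Sum>(b, e)\<leftarrow>L. (1 - b\<^sup>2) * B e e) \<le> T"
      unfolding T_def using pos by (intro sum_list_mono) (auto simp: mult_left_le_one_le algebra_simps)
    then show "tilt L (\<lambda>u. B u u) 0 \<le> B (tilt_mean L) (tilt_mean L) + T"
      unfolding tilt_quadratic[OF bil sym] by simp
  qed
  finally show ?thesis unfolding T_def by (simp add: algebra_simps)
qed

lemma sum_list_flat: "(\<Sum>(b, e)\<leftarrow>flat L. g e) = (\<Sum>(b, e)\<leftarrow>L. g e)"
  by (induction L) auto

locale iid_likelihood = convex_likelihood P l D Nb B \<Lambda> C c
  for P :: "'x measure" and l :: "'q::real_vector \<Rightarrow> 'x \<Rightarrow> real" and D Nb B \<Lambda> C c +
  fixes S :: "'w measure" and X :: "nat \<Rightarrow> 'w \<Rightarrow> 'x"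
  assumes S_prob: "prob_space S"
    and X_indep: "prob_space.indep_vars S (\<lambda>_. P) X {1..}"
    and X_distr: "\<And>i. 1 \<le> i \<Longrightarrow> distr S P (X i) = P"
begin

sublocale S: prob_space S by (rule S_prob)

lemma X_measurable: "1 \<le> i \<Longrightarrow> X i \<in> measurable S P"
  using X_indep unfolding S.indep_vars_def by auto

lemma X_integrable: "1 \<le> i \<Longrightarrow> integrable P f \<Longrightarrow> integrable S (\<lambda>\<omega>. (f (X i \<omega>) :: real))"
  using integrable_distr[OF X_measurable, of i f] X_distr[of i] by simp

lemma X_integral:
  assumes "1 \<le> i" "f \<in> borel_measurable P"
  shows "(\<integral>\<omega>. (f (X i \<omega>) :: real) \<partial>S) = (\<integral>x. f x \<partial>P)"
  using integral_distr[OF X_measurable[OF assms(1)] assms(2)] X_distr[OF assms(1)] by simp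

lemma X_AE:
  assumes "AE x in P. Q x"
  shows "AE \<omega> in S. \<forall>i\<ge>1. Q (X i \<omega>)"
proof -
  have "AE \<omega> in S. Q (X i \<omega>)" if "1 \<le> i" for i
    using assms AE_distrD[OF X_measurable[OF that], of Q] unfolding X_distr[OF that] by blast
  then show ?thesis by (subst AE_all_countable) auto
qed

lemma X_prod:
  assumes "integrable P f"
  shows "integrable S (\<lambda>\<omega>. \<Prod>i=1..n. (f (X i \<omega>) :: real))"
    and "(\<integral>\<omega>. (\<Prod>i=1..n. f (X i \<omega>)) \<partial>S) = (\<integral>x. f x \<partial>P) ^ n"
proof -
  have f: "f \<in> borel_measurable P" using assms by auto
  have "S.indep_vars (\<lambda>_. borel) (\<lambda>i \<omega>. f (X i \<omega>)) {1..}"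
    by (rule S.indep_vars_compose2[OF X_indep f])
  then have ind: "S.indep_vars (\<lambda>_. borel) (\<lambda>i \<omega>. f (X i \<omega>)) {1..n}"
    by (rule S.indep_vars_subset) auto
  have int: "integrable S (\<lambda>\<omega>. f (X i \<omega>))" if "i \<in> {1..n}" for i
    using that by (intro X_integrable assms) auto
  show "integrable S (\<lambda>\<omega>. \<Prod>i=1..n. f (X i \<omega>))"
    by (rule S.indep_vars_integrable[OF _ ind int]) auto
  have "(\<integral>\<omega>. (\<Prod>i=1..n. f (X i \<omega>)) \<partial>S) = (\<Prod>i=1..n. \<integral>\<omega>. f (X i \<omega>) \<partial>S)"
    by (rule S.indep_vars_lebesgue_integral[OF _ ind int]) auto
  also have "\<dots> = (\<Prod>i=1..n. \<integral>x. f x \<partial>P)"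
    by (intro prod.cong refl X_integral f) auto
  finally show "(\<integral>\<omega>. (\<Prod>i=1..n. f (X i \<omega>)) \<partial>S) = (\<integral>x. f x \<partial>P) ^ n" by simp
qed

text \<open>Normalized to have expectation at most 1, since \<open>1 - hell a / 2\<close> is the
  Hellinger affinity. A bound \<open>U\<close> on it says that the total loss at \<open>a\<close> is
  at least \<open>real n * hell a - 2 * ln U\<close>.\<close>

definition lik_stat :: "nat \<Rightarrow> 'q \<Rightarrow> 'w \<Rightarrow> real" where
  "lik_stat n a \<omega> = exp (- (\<Sum>i=1..n. l a (X i \<omega>)) / 2 + real n * hell a / 2)"

lemma lik_stat:
  assumes "a \<in> Nb"
  shows "integrable S (lik_stat n a)" "(\<integral>\<omega>. lik_stat n a \<omega> \<partial>S) \<le> 1"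
proof -
  define f where "f x = exp (- l a x / 2)" for x
  have f: "integrable P f" unfolding f_def using exp_l_integrable[OF assms, of "-1/2"] by simp
  have eq: "lik_stat n a = (\<lambda>\<omega>. exp (real n * hell a / 2) * (\<Prod>i=1..n. f (X i \<omega>)))"
    unfolding lik_stat_def f_def
    by (simp add: exp_sum[symmetric] exp_add[symmetric] sum_negf sum_divide_distrib[symmetric] add.commute)
  show "integrable S (lik_stat n a)" unfolding eq using X_prod(1)[OF f] by simp
  have E: "(\<integral>x. f x \<partial>P) = 1 - hell a / 2"
    using hell_eq[OF assms] unfolding f_def by linarith
  have "0 \<le> (\<integral>x. f x \<partial>P)" unfolding f_def by (rule integral_nonneg_AE) simp
  then have "(\<integral>x. f x \<partial>P) ^ n \<le> exp (- (hell a / 2)) ^ n"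
    using exp_ge_add_one_self[of "- (hell a / 2)"] unfolding E by (intro power_mono) auto
  then have "exp (real n * hell a / 2) * (\<integral>x. f x \<partial>P) ^ n \<le> exp (real n * hell a / 2) * exp (- (hell a / 2)) ^ n"
    by (intro mult_left_mono) auto
  also have "\<dots> = 1" by (simp add: exp_of_nat_mult[symmetric] exp_add[symmetric])
  finally show "(\<integral>\<omega>. lik_stat n a \<omega> \<partial>S) \<le> 1" unfolding eq using X_prod[OF f] by simp
qed

text \<open>Only the flattened list enters, so that a single statistic controls the increments in all
  directions \<open>tilt_mean L\<close> at once.\<close>

definition score_stat :: "nat \<Rightarrow> real \<Rightarrow> (real \<times> 'q) list \<Rightarrow> 'q \<Rightarrow> 'w \<Rightarrow> real" where
  "score_stat n \<theta> L a \<omega> = tilt (flat L) (\<lambda>u. exp ((\<Sum>i=1..n. catoni (\<theta> * D a u (X i \<omega>))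
       + min ((\<Sum>(b, e)\<leftarrow>L. (\<theta> * D a e (X i \<omega>))\<^sup>2) / 6) 2)
     - 9 * real n * \<theta>\<^sup>2 * C * (B u u + (\<Sum>(b, e)\<leftarrow>L. B e e)))) 0"

lemma sum_list_sq_integrable:
  assumes "a \<in> Nb"
  shows "integrable P (\<lambda>x. \<Sum>(b, e)\<leftarrow>L. (\<theta> * D a e x)\<^sup>2)"
    "(\<integral>x. (\<Sum>(b, e)\<leftarrow>L. (\<theta> * D a e x)\<^sup>2) \<partial>P) \<le> \<theta>\<^sup>2 * C * (\<Sum>(b, e)\<leftarrow>L. B e e)"
proof -
  have "integrable P (\<lambda>x. \<Sum>(b, e)\<leftarrow>L. (\<theta> * D a e x)\<^sup>2) \<and>
    (\<integral>x. (\<Sum>(b, e)\<leftarrow>L. (\<theta> * D a e x)\<^sup>2) \<partial>P) \<le> \<theta>\<^sup>2 * C * (\<Sum>(b, e)\<leftarrow>L. B e e)"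
  proof (induction L)
    case (Cons p L)
    obtain b e where p: "p = (b, e)" by force
    have "integrable P (\<lambda>x. (\<theta> * D a e x)\<^sup>2)"
      unfolding power_mult_distrib using D_square_integrable[OF assms] by simp
    moreover have "(\<integral>x. (\<theta> * D a e x)\<^sup>2 \<partial>P) \<le> \<theta>\<^sup>2 * (C * B e e)"
      unfolding power_mult_distrib using D_upper[OF assms] by (simp add: mult_left_mono)
    ultimately show ?case unfolding p using Cons by (simp add: algebra_simps)
  qed simp
  then show "integrable P (\<lambda>x. \<Sum>(b, e)\<leftarrow>L. (\<theta> * D a e x)\<^sup>2)"
    "(\<integral>x. (\<Sum>(b, e)\<leftarrow>L. (\<theta> * D a e x)\<^sup>2) \<partial>P) \<le> \<theta>\<^sup>2 * C * (\<Sum>(b, e)\<leftarrow>L. B e e)" by auto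
qed

text \<open>For fixed signs the exponential is a product over the sample, and
  \<open>exp_catoni_bound\<close> makes each factor quadratic in the score: the linear term vanishes
  by centring and \<open>D_upper\<close> bounds the rest. A \<open>tilt\<close> is a finite average
  and so commutes with the expectation.\<close>

lemma score_stat:
  assumes a: "a \<in> Nb"
  shows "integrable S (score_stat n \<theta> L a)" "(\<integral>\<omega>. score_stat n \<theta> L a \<omega> \<partial>S) \<le> 1"
    "score_stat n \<theta> L a \<omega> > 0"
proof -
  define T where "T = (\<Sum>(b, e)\<leftarrow>L. B e e)"
  define q where "q x = (\<Sum>(b, e)\<leftarrow>L. (\<theta> * D a e x)\<^sup>2)" for x
  define f where "f u x = exp (catoni (\<theta> * D a u x) + min (q x / 6) 2)" for u x
  define k where "k u = 9 * real n * \<theta>\<^sup>2 * C * (B u u + T)" for u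
  have [measurable]: "D a u \<in> borel_measurable P" for u using a by simp
  have q: "integrable P q" "(\<integral>x. q x \<partial>P) \<le> \<theta>\<^sup>2 * C * T"
    using sum_list_sq_integrable[OF a, where L = L and \<theta> = \<theta>] unfolding q_def T_def by auto
  have [measurable]: "q \<in> borel_measurable P" using q by auto
  have q0: "0 \<le> q x" for x unfolding q_def by (intro sum_list_nonneg) auto
  have sq: "integrable P (\<lambda>x. (D a u x)\<^sup>2)" "integrable P (D a u)" for u
    using D_square_integrable[OF a] D_integrable[OF a] by auto
  define g where "g u x = 1 + \<theta> * D a u x + 9 * \<theta>\<^sup>2 * (D a u x)\<^sup>2 + 3 * q x" for u x
  have gi: "integrable P (g u)" for u unfolding g_def using sq q by simp
  have fg: "f u x \<le> g u x" for u x
    using exp_catoni_bound[OF q0[of x], of "\<theta> * D a u x"] unfolding f_def g_def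
    by (simp add: power_mult_distrib mult.assoc)
  have fi: "integrable P (f u)" for u
  proof (rule Bochner_Integration.integrable_bound[OF gi])
    show "f u \<in> borel_measurable P" unfolding f_def catoni_def by measurable
    show "AE x in P. norm (f u x) \<le> norm (g u x)"
    proof (rule AE_I2)
      fix x have "0 \<le> f u x" by (simp add: f_def)
      then show "norm (f u x) \<le> norm (g u x)" using fg[of u x] by simp
    qed
  qed
  have "(\<integral>x. f u x \<partial>P) \<le> exp (9 * \<theta>\<^sup>2 * C * (B u u + T))" for u
  proof -
    have "(\<integral>x. f u x \<partial>P) \<le> (\<integral>x. g u x \<partial>P)"
      by (rule integral_mono[OF fi gi]) (rule fg)
    also have "\<dots> = 1 + 9 * \<theta>\<^sup>2 * (\<integral>x. (D a u x)\<^sup>2 \<partial>P) + 3 * (\<integral>x. q x \<partial>P)"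
      unfolding g_def using sq q by (simp add: D_centred[OF a] prob_space)
    \<comment> \<open>The coefficient 3 of \<open>q\<close> is enlarged to 9, so that both terms
      share one compensator.\<close>
    also have "\<dots> \<le> 1 + 9 * \<theta>\<^sup>2 * (C * B u u) + 9 * (\<theta>\<^sup>2 * C * T)"
    proof -
      have "9 * \<theta>\<^sup>2 * (\<integral>x. (D a u x)\<^sup>2 \<partial>P) \<le> 9 * \<theta>\<^sup>2 * (C * B u u)"
        using D_upper[OF a] by (intro mult_left_mono) auto
      moreover have "0 \<le> (\<integral>x. q x \<partial>P)" using q0 by simp
      ultimately show ?thesis using q(2) by linarith
    qed
    also have "\<dots> = 1 + 9 * \<theta>\<^sup>2 * C * (B u u + T)" by (simp add: algebra_simps)
    also have "\<dots> \<le> exp (9 * \<theta>\<^sup>2 * C * (B u u + T))" by (rule exp_ge_add_one_self)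
    finally show ?thesis .
  qed
  moreover have "0 \<le> (\<integral>x. f u x \<partial>P)" for u unfolding f_def by (rule integral_nonneg_AE) simp
  ultimately have fn: "(\<integral>x. f u x \<partial>P) ^ n \<le> exp (k u)" for u
    using power_mono[of "\<integral>x. f u x \<partial>P" "exp (9 * \<theta>\<^sup>2 * C * (B u u + T))" n]
    by (simp add: k_def exp_of_nat_mult[symmetric] algebra_simps)
  define G where "G \<omega> u = exp (- k u) * (\<Prod>i=1..n. f u (X i \<omega>))" for \<omega> u
  have eq: "score_stat n \<theta> L a = (\<lambda>\<omega>. tilt (flat L) (G \<omega>) 0)"
    unfolding score_stat_def G_def f_def q_def[symmetric] T_def[symmetric] k_def[symmetric]
    by (simp add: exp_diff exp_sum exp_minus field_simps)
  have Gi: "integrable S (\<lambda>\<omega>. G \<omega> u)" for u unfolding G_def using X_prod(1)[OF fi] by simp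
  show "integrable S (score_stat n \<theta> L a)" unfolding eq by (rule tilt_integral(1)[OF Gi])
  have "(\<integral>\<omega>. score_stat n \<theta> L a \<omega> \<partial>S) = tilt (flat L) (\<lambda>u. \<integral>\<omega>. G \<omega> u \<partial>S) 0"
    unfolding eq by (rule tilt_integral(2)[OF Gi])
  also have "\<dots> \<le> tilt (flat L) (\<lambda>_. 1) 0"
  proof (rule tilt_mono)
    fix u
    have "(\<integral>\<omega>. G \<omega> u \<partial>S) = exp (- k u) * (\<integral>x. f u x \<partial>P) ^ n"
      unfolding G_def using X_prod[OF fi] by simp
    also have "\<dots> \<le> exp (- k u) * exp (k u)" using fn by (intro mult_left_mono) auto
    finally show "(\<integral>\<omega>. G \<omega> u \<partial>S) \<le> 1" by (simp add: exp_add[symmetric])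
  qed simp
  finally show "(\<integral>\<omega>. score_stat n \<theta> L a \<omega> \<partial>S) \<le> 1" by simp
  show "score_stat n \<theta> L a \<omega> > 0" unfolding score_stat_def by (rule tilt_pos) auto
qed

text \<open>By the tangent inequality the score dominates the drift minus the increment of the loss.
  That deficit is at most \<open>4 * \<Lambda>\<close>, as the drift is at most
  \<open>2 * \<Lambda>\<close> and each loss at most \<open>\<Lambda>\<close> in absolute value.
  Scaled by \<open>\<theta> = 1 / (4 * \<Lambda>)\<close> it stays below 1, so the truncation in
  \<open>exp_tilt_sum\<close> costs nothing.\<close>

lemma increment_ge:
  assumes a: "a \<in> Nb" and v: "v \<in> Nb" and L: "tiltable L" "tilt_mean L = v - a"
    and \<omega>: "\<And>i. 1 \<le> i \<Longrightarrow> X i \<omega> \<in> space P"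
    and tan: "\<And>i. 1 \<le> i \<Longrightarrow> drift a (v - a) - D a (v - a) (X i \<omega>) \<le> l v (X i \<omega>) - l a (X i \<omega>)"
    and bd: "\<And>i. 1 \<le> i \<Longrightarrow> \<bar>l v (X i \<omega>)\<bar> \<le> \<Lambda> \<and> \<bar>l a (X i \<omega>)\<bar> \<le> \<Lambda>"
    and n: "1 \<le> n"
  shows "(\<Sum>i=1..n. l v (X i \<omega>)) \<ge> (\<Sum>i=1..n. l a (X i \<omega>)) + real n * drift a (v - a)
     - 4 * \<Lambda> * (ln (score_stat n (1 / (4 * \<Lambda>)) L a \<omega>) + (\<Sum>(b, e)\<leftarrow>L. b\<^sup>2))
     - 9 * real n * C * (B (v - a) (v - a) + 2 * (\<Sum>(b, e)\<leftarrow>L. B e e))"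
proof -
  define \<theta> where "\<theta> = 1 / (4 * \<Lambda>)"
  define w where "w = v - a"
  define R where "R = B w w + 2 * (\<Sum>(b, e)\<leftarrow>L. B e e)"
  have \<theta>: "0 < \<theta>" "4 * \<Lambda> * \<theta> = 1" "\<theta> \<le> 1 / 4" using \<Lambda>1 by (auto simp: \<theta>_def divide_simps)
  have R: "0 \<le> R" unfolding R_def using pos_B by (intro add_nonneg_nonneg mult_nonneg_nonneg sum_list_nonneg) auto
  have lin: "linear (\<lambda>u. \<theta> * D a u (X i \<omega>))" if "i \<in> {1..n}" for i
  proof -
    have l: "linear (\<lambda>u. D a u (X i \<omega>))" using linear_D[OF a \<omega>[of i]] that by auto
    show ?thesis by (intro linearI) (simp_all add: linear_add[OF l] linear_cmul[OF l] distrib_left)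
  qed
  have "(\<Sum>i=1..n. \<theta> * (drift a w - (l v (X i \<omega>) - l a (X i \<omega>)))) \<le> (\<Sum>i=1..n. min (\<theta> * D a (tilt_mean L) (X i \<omega>)) 1)"
  proof (rule sum_mono)
    fix i assume "i \<in> {1..n}"
    then have i: "1 \<le> i" by simp
    have **: "\<theta> * (drift a w - (l v (X i \<omega>) - l a (X i \<omega>))) \<le> \<theta> * D a w (X i \<omega>)"
      using tan[OF i] \<theta> unfolding w_def by (intro mult_left_mono) auto
    have *: "\<theta> * (drift a w - (l v (X i \<omega>) - l a (X i \<omega>))) \<le> \<theta> * (4 * \<Lambda>)"
      using drift_le[OF a v] bd[OF i] \<theta> unfolding w_def by (intro mult_left_mono) linarith+
    show "\<theta> * (drift a w - (l v (X i \<omega>) - l a (X i \<omega>))) \<le> min (\<theta> * D a (tilt_mean L) (X i \<omega>)) 1"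
    proof -
      have "\<theta> * (4 * \<Lambda>) = 1" using \<theta>(2) by (simp add: mult.commute)
      then show ?thesis using * ** unfolding L(2) w_def[symmetric] by simp
    qed
  qed
  also have "\<dots> \<le> ln (score_stat n \<theta> L a \<omega>) + 9 * real n * \<theta>\<^sup>2 * C * R + (\<Sum>(b, e)\<leftarrow>L. b\<^sup>2)"
    using C0 unfolding R_def w_def L(2)[symmetric]
    by (intro exp_tilt_sum[OF lin L(1) bilinear_B sym_B pos_B _ score_stat_def]) auto
  finally have "\<theta> * (real n * drift a w - ((\<Sum>i=1..n. l v (X i \<omega>)) - (\<Sum>i=1..n. l a (X i \<omega>))))
     \<le> ln (score_stat n \<theta> L a \<omega>) + 9 * real n * \<theta>\<^sup>2 * C * R + (\<Sum>(b, e)\<leftarrow>L. b\<^sup>2)"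
    by (simp add: sum_distrib_left[symmetric] sum_subtractf)
  then have "4 * \<Lambda> * (\<theta> * (real n * drift a w - ((\<Sum>i=1..n. l v (X i \<omega>)) - (\<Sum>i=1..n. l a (X i \<omega>)))))
     \<le> 4 * \<Lambda> * (ln (score_stat n \<theta> L a \<omega>) + 9 * real n * \<theta>\<^sup>2 * C * R + (\<Sum>(b, e)\<leftarrow>L. b\<^sup>2))"
    using \<Lambda>1 by (intro mult_left_mono) auto
  also have "\<dots> = 4 * \<Lambda> * (ln (score_stat n \<theta> L a \<omega>) + (\<Sum>(b, e)\<leftarrow>L. b\<^sup>2)) + (4 * \<Lambda> * \<theta>) * (\<theta> * (9 * real n * C * R))"
    by (simp add: algebra_simps power2_eq_square)
  also have "\<dots> \<le> 4 * \<Lambda> * (ln (score_stat n \<theta> L a \<omega>) + (\<Sum>(b, e)\<leftarrow>L. b\<^sup>2)) + 9 * real n * C * R"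
  proof -
    have "\<theta> * (9 * real n * C * R) \<le> 1 * (9 * real n * C * R)"
      using \<theta> R C0 by (intro mult_right_mono) auto
    then show ?thesis unfolding \<theta>(2) by simp
  qed
  finally have "(4 * \<Lambda> * \<theta>) * (real n * drift a w - ((\<Sum>i=1..n. l v (X i \<omega>)) - (\<Sum>i=1..n. l a (X i \<omega>))))
    \<le> 4 * \<Lambda> * (ln (score_stat n \<theta> L a \<omega>) + (\<Sum>(b, e)\<leftarrow>L. b\<^sup>2)) + 9 * real n * C * R"
    by (simp add: mult.assoc)
  moreover have "z + x - u - y' \<le> y" if "1 * (x - (y - z)) \<le> u + y'" for x y z u y' :: real
    using that by simp
  ultimately show ?thesis unfolding \<theta>(2) unfolding R_def w_def \<theta>_def by blast
qed

end

section \<open>Nets and coordinates\<close>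

lemma sum_int_half_powers:
  "(\<Sum>j\<in>{- int N..int N}. (1 / 2 :: real) ^ nat \<bar>j\<bar>) = 3 - 2 * (1 / 2) ^ N"
proof (induction N)
  case (Suc N)
  have "{- int (Suc N)..int (Suc N)} = insert (int (Suc N)) (insert (- int (Suc N)) {- int N..int N})"
    by auto
  then have "(\<Sum>j\<in>{- int (Suc N)..int (Suc N)}. (1 / 2 :: real) ^ nat \<bar>j\<bar>)
     = (1 / 2) ^ Suc N + ((1 / 2) ^ Suc N + (\<Sum>j\<in>{- int N..int N}. (1 / 2 :: real) ^ nat \<bar>j\<bar>))"
  proof -
    have "nat \<bar>int (Suc N)\<bar> = Suc N" "nat \<bar>- int (Suc N)\<bar> = Suc N" by auto
    then show ?thesis unfolding \<open>{- int (Suc N)..int (Suc N)} = _\<close>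
      by (simp del: power_Suc of_nat_Suc)
  qed
  then show ?case unfolding Suc by simp
qed simp

lemma exp_minus_sq_le_half_power: "exp (- (real_of_int j)\<^sup>2) \<le> (1 / 2) ^ nat \<bar>j\<bar>"
proof -
  have "exp (- (1::real)) \<le> 1 / 2"
    using exp_ge_add_one_self[of "1::real"] by (simp add: exp_minus field_simps)
  then have "exp (- (1::real)) ^ nat \<bar>j\<bar> \<le> (1 / 2) ^ nat \<bar>j\<bar>" by (intro power_mono) auto
  moreover have "exp (- (real_of_int j)\<^sup>2) \<le> exp (- \<bar>real_of_int j\<bar>)"
  proof -
    have "\<bar>j\<bar> * 1 \<le> \<bar>j\<bar> * \<bar>j\<bar>"
    proof (cases "j = 0")
      case False
      then show ?thesis by (intro mult_left_mono) auto
    qed simp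
    then have "\<bar>j\<bar> \<le> j\<^sup>2" by (simp add: power2_eq_square)
    then have "real_of_int \<bar>j\<bar> \<le> real_of_int (j\<^sup>2)" by (subst of_int_le_iff)
    then show ?thesis by simp
  qed
  moreover have "exp (- (1::real)) ^ nat \<bar>j\<bar> = exp (- \<bar>real_of_int j\<bar>)"
    by (simp add: exp_of_nat_mult[symmetric])
  ultimately show ?thesis by linarith
qed

text \<open>A Chernoff count: weighting \<open>z\<close> by \<open>exp\<close> of \<open>A\<close>
  minus its squared length gives every element of \<open>Z\<close> weight at least 1, and over a box
  the weights sum to \<open>exp A\<close> times a product of one-dimensional sums, each at most
  3.\<close>

lemma card_int_vectors_le:
  assumes I: "finite I" and Z: "finite Z" "Z \<subseteq> extensional I"
    and A: "\<And>z. z \<in> Z \<Longrightarrow> (\<Sum>i\<in>I. (real_of_int (z i))\<^sup>2) \<le> A"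
  shows "real (card Z) \<le> exp A * 3 ^ card I"
proof -
  \<comment> \<open>Any bound on the coordinates can serve as the side of the box, since the
    one-dimensional sums are at most 3 for every \<open>N\<close>.\<close>
  define N where "N = (\<Sum>z\<in>Z. \<Sum>i\<in>I. nat \<bar>z i\<bar>)"
  have "nat \<bar>z i\<bar> \<le> N" if "z \<in> Z" "i \<in> I" for z i
  proof -
    have "nat \<bar>z i\<bar> \<le> (\<Sum>i\<in>I. nat \<bar>z i\<bar>)" using that I by (intro member_le_sum) auto
    also have "\<dots> \<le> N" unfolding N_def using that Z
      by (intro member_le_sum[of z Z "\<lambda>z. \<Sum>i\<in>I. nat \<bar>z i\<bar>"]) auto
    finally show ?thesis .
  qed
  then have sub: "Z \<subseteq> PiE I (\<lambda>_. {- int N..int N})"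
    using Z(2) by (force simp: PiE_iff)
  have fin: "finite (PiE I (\<lambda>_. {- int N..int N}))" using I by (intro finite_PiE) auto
  have "real (card Z) = (\<Sum>z\<in>Z. 1)" by simp
  also have "\<dots> \<le> (\<Sum>z\<in>Z. exp (A - (\<Sum>i\<in>I. (real_of_int (z i))\<^sup>2)))"
    using A by (intro sum_mono) (simp add: algebra_simps)
  also have "\<dots> \<le> (\<Sum>z\<in>PiE I (\<lambda>_. {- int N..int N}). exp (A - (\<Sum>i\<in>I. (real_of_int (z i))\<^sup>2)))"
    using sub fin by (intro sum_mono2) auto
  also have "\<dots> = exp A * (\<Sum>z\<in>PiE I (\<lambda>_. {- int N..int N}). \<Prod>i\<in>I. exp (- (real_of_int (z i))\<^sup>2))"
    using I by (simp add: sum_distrib_left exp_diff exp_sum exp_minus sum_negf[symmetric] divide_inverse prod_inversef[symmetric] o_def)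
  also have "(\<Sum>z\<in>PiE I (\<lambda>_. {- int N..int N}). \<Prod>i\<in>I. exp (- (real_of_int (z i))\<^sup>2))
     = (\<Prod>i\<in>I. \<Sum>j\<in>{- int N..int N}. exp (- (real_of_int j)\<^sup>2))"
    using I by (intro prod_sum_PiE[symmetric]) auto
  also have "\<dots> \<le> (\<Prod>i\<in>I. 3)"
  proof (intro prod_mono conjI)
    have "(\<Sum>j\<in>{- int N..int N}. exp (- (real_of_int j)\<^sup>2)) \<le> (\<Sum>j\<in>{- int N..int N}. (1 / 2) ^ nat \<bar>j\<bar>)"
      by (intro sum_mono exp_minus_sq_le_half_power)
    then show "(\<Sum>j\<in>{- int N..int N}. exp (- (real_of_int j)\<^sup>2)) \<le> 3"
      unfolding sum_int_half_powers using zero_le_power[of "1/2::real" N] by linarith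
  qed (auto intro!: sum_nonneg)
  also have "\<dots> = 3 ^ card I" by simp
  finally show ?thesis by (simp add: mult_left_mono)
qed

section \<open>Repeated signs along coordinate directions\<close>

text \<open>Splitting direction \<open>i\<close> into \<open>M\<close> equal signs keeps the
  variance of the fair sum at \<open>(\<sigma> i)\<^sup>2\<close>, while the attainable means grow
  like \<open>sqrt (real M) * \<sigma> i\<close>. For large \<open>M\<close> the signs thus act like
  a Gaussian that can be shifted anywhere with biases of size at most 1, at a cost that depends on
  the shift and not on \<open>M\<close>.\<close>

definition dirs :: "nat \<Rightarrow> nat \<Rightarrow> (nat \<Rightarrow> real) \<Rightarrow> (nat \<Rightarrow> 'q::real_vector) \<Rightarrow> (nat \<Rightarrow> real) \<Rightarrow> (real \<times> 'q) list" where
  "dirs K M \<sigma> \<psi> \<beta> = concat (map (\<lambda>i. replicate M (\<beta> i, (\<sigma> i / sqrt (real M)) *\<^sub>R \<psi> i)) [0..<K])"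

lemma flat_dirs: "flat (dirs K M \<sigma> \<psi> \<beta>) = dirs K M \<sigma> \<psi> (\<lambda>_. 0)"
  by (simp add: dirs_def flat_def map_concat o_def)

lemma tiltable_dirs:
  assumes "\<And>i. i < K \<Longrightarrow> \<bar>\<beta> i\<bar> \<le> 1"
  shows "tiltable (dirs K M \<sigma> \<psi> \<beta>)"
  using assms by (auto simp: tiltable_def dirs_def)

lemma sum_list_replicate_scaleR: "sum_list (replicate M (x :: 'q::real_vector)) = real M *\<^sub>R x"
  by (induction M) (auto simp: algebra_simps)

lemma sum_list_concat_replicate:
  "(\<Sum>p\<leftarrow>concat (map (\<lambda>i. replicate M (g i)) [0..<K]). f p) = (\<Sum>i<K. real M *\<^sub>R (f (g i) :: 'q::real_vector))"
proof (induction K)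
  case (Suc K)
  have "map f (replicate M (g K)) = replicate M (f (g K))" by simp
  then show ?case using Suc by (simp only: upt_Suc_append map_append concat_append sum_list_append
     zero_le list.map concat.simps append_Nil2 sum_list_replicate_scaleR sum.lessThan_Suc)
qed simp

lemma tilt_mean_dirs:
  "tilt_mean (dirs K M \<sigma> \<psi> \<beta>) = (\<Sum>i<K. (sqrt (real M) * \<beta> i * \<sigma> i) *\<^sub>R \<psi> i)"
proof -
  have "real M * (\<beta> i * (\<sigma> i / sqrt (real M))) = sqrt (real M) * \<beta> i * \<sigma> i" for i
    by (cases "M = 0") (simp_all add: real_div_sqrt field_simps)
  then show ?thesis
    unfolding tilt_mean_def dirs_def sum_list_concat_replicate by simp
qed

lemma sum_sq_dirs: "(\<Sum>(b, e)\<leftarrow>dirs K M \<sigma> \<psi> \<beta>. b\<^sup>2) = (\<Sum>i<K. real M * (\<beta> i)\<^sup>2)"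
  unfolding dirs_def sum_list_concat_replicate by simp

lemma sum_form_dirs:
  assumes "bilinear B" "0 < M"
  shows "(\<Sum>(b, e)\<leftarrow>dirs K M \<sigma> \<psi> \<beta>. B e e) = (\<Sum>i<K. (\<sigma> i)\<^sup>2 * (B (\<psi> i) (\<psi> i) :: real))"
proof -
  have "real M * (\<sigma> i / sqrt (real M) * (\<sigma> i / sqrt (real M) * B (\<psi> i) (\<psi> i))) = (\<sigma> i)\<^sup>2 * B (\<psi> i) (\<psi> i)" for i
    using assms(2) by (simp add: power2_eq_square)
  then show ?thesis
    unfolding dirs_def sum_list_concat_replicate
    by (simp add: bilinear_lmul[OF assms(1)] bilinear_rmul[OF assms(1)])
qed

lemma orthonormal_expansion:
  fixes B :: "'q::real_vector \<Rightarrow> 'q \<Rightarrow> real" and \<psi> :: "nat \<Rightarrow> 'q"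
  assumes bil: "bilinear B"
    and orth: "\<And>i j. i < K \<Longrightarrow> j < K \<Longrightarrow> B (\<psi> i) (\<psi> j) = (if i = j then 1 else 0)"
    and v: "v \<in> span (\<psi> ` {..<K})"
  shows "v = (\<Sum>i<K. B v (\<psi> i) *\<^sub>R \<psi> i)"
  using v
proof (induction rule: span_induct_alt)
  case base
  then show ?case by (simp add: bilinear_lzero[OF bil])
next
  case (step c x y)
  then obtain j where j: "j < K" "x = \<psi> j" by auto
  have "(\<Sum>i<K. B (c *\<^sub>R x + y) (\<psi> i) *\<^sub>R \<psi> i) = (\<Sum>i<K. (if i = j then c *\<^sub>R \<psi> j else 0) + B y (\<psi> i) *\<^sub>R \<psi> i)"
    using j orth by (intro sum.cong) (auto simp: bilinear_ladd[OF bil] bilinear_lmul[OF bil] algebra_simps)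
  also have "\<dots> = (\<Sum>i<K. if i = j then c *\<^sub>R \<psi> j else 0) + (\<Sum>i<K. B y (\<psi> i) *\<^sub>R \<psi> i)"
    by (rule sum.distrib)
  also have "(\<Sum>i<K. if i = j then c *\<^sub>R \<psi> j else 0) = c *\<^sub>R x"
    using j by (subst sum.delta) auto
  also have "(\<Sum>i<K. B y (\<psi> i) *\<^sub>R \<psi> i) = y" using step by simp
  finally show ?case by simp
qed

lemma orthonormal_parseval:
  fixes B :: "'q::real_vector \<Rightarrow> 'q \<Rightarrow> real" and \<psi> :: "nat \<Rightarrow> 'q"
  assumes bil: "bilinear B"
    and orth: "\<And>i j. i < K \<Longrightarrow> j < K \<Longrightarrow> B (\<psi> i) (\<psi> j) = (if i = j then 1 else 0)"
    and v: "v \<in> span (\<psi> ` {..<K})"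
  shows "B v v = (\<Sum>i<K. (B v (\<psi> i))\<^sup>2)"
proof -
  have lin: "linear (\<lambda>x. B v x)" using bil unfolding bilinear_def by auto
  have "B v v = B v (\<Sum>i<K. B v (\<psi> i) *\<^sub>R \<psi> i)"
    using orthonormal_expansion[OF assms] by simp
  also have "\<dots> = (\<Sum>i<K. (B v (\<psi> i))\<^sup>2)"
    by (simp add: linear_sum[OF lin] linear_cmul[OF lin] power2_eq_square)
  finally show ?thesis .
qed

context iid_likelihood
begin

lemma score_stat_flat_cong:
  assumes "flat L = flat L'"
  shows "score_stat n \<theta> L a \<omega> = score_stat n \<theta> L' a \<omega>"
proof -
  have "(\<Sum>(b, e)\<leftarrow>L. g e) = (\<Sum>(b, e)\<leftarrow>L'. g e)" for g :: "'q \<Rightarrow> real"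
    using sum_list_flat[of g L] sum_list_flat[of g L'] assms by simp
  from this[of "\<lambda>e. (\<theta> * D a e (X _ \<omega>))\<^sup>2"] this[of "\<lambda>e. B e e"] show ?thesis
    unfolding score_stat_def assms by simp
qed

definition c_hell :: real where "c_hell = c / (16 * exp (3 * \<Lambda>))"

text \<open>Collects the coefficients with which the squared distance to the net point enters:
  passing from the Hellinger distance at \<open>a\<close> to the norm of \<open>v\<close>, the
  drift, the compensator and the entropy of the signs.\<close>

definition c_loss :: real where "c_loss = c_hell + 4 * exp (2 * \<Lambda>) * C + 9 * C + 4 * \<Lambda>"

lemma c_hell_pos: "0 < c_hell" unfolding c_hell_def using c0 by simp

lemma c_loss_pos: "0 < c_loss"
  unfolding c_loss_def using c_hell_pos C0 \<Lambda>1 by (intro add_pos_pos) auto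

lemma B_half_le: "B v v / 2 - B (v - a) (v - a) \<le> B a a"
proof -
  have "0 \<le> B (v - 2 *\<^sub>R a) (v - 2 *\<^sub>R a)" by (rule pos_B)
  then show ?thesis
    using sym_B[of a v]
    by (simp add: bilinear_lsub[OF bilinear_B] bilinear_rsub[OF bilinear_B] bilinear_lmul[OF bilinear_B]
        bilinear_rmul[OF bilinear_B])
qed

text \<open>With sign variances \<open>1 / (real n * (1 + \<tau> i))\<close> the total variance is
  at most \<open>T / real n\<close>, the noise level, and the entropy of shifting the mean to
  \<open>v - a\<close> is \<open>real n\<close> times the weighted squared length of
  \<open>v - a\<close>. A fine net makes the latter small compared with the Hellinger gain.\<close>

lemma lower_bound_near:
  fixes \<psi> :: "nat \<Rightarrow> 'q"
  assumes orth: "\<And>i j. i < K \<Longrightarrow> j < K \<Longrightarrow> B (\<psi> i) (\<psi> j) = (if i = j then 1 else 0)"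
    and a: "a \<in> Nb" "a \<in> span (\<psi> ` {..<K})" and v: "v \<in> Nb" "v \<in> span (\<psi> ` {..<K})"
    and \<tau>: "\<And>i. 0 \<le> \<tau> i" "(\<Sum>i<K. 1 / (1 + \<tau> i)) \<le> T"
    and n: "1 \<le> n"
    and M: "0 < M" "\<And>i. i < K \<Longrightarrow> real n * (1 + \<tau> i) * (B (v - a) (\<psi> i))\<^sup>2 \<le> real M"
    and \<omega>: "\<And>i. 1 \<le> i \<Longrightarrow> X i \<omega> \<in> space P"
    and tan: "\<And>i. 1 \<le> i \<Longrightarrow> drift a (v - a) - D a (v - a) (X i \<omega>) \<le> l v (X i \<omega>) - l a (X i \<omega>)"
    and bd: "\<And>i. 1 \<le> i \<Longrightarrow> \<bar>l v (X i \<omega>)\<bar> \<le> \<Lambda> \<and> \<bar>l a (X i \<omega>)\<bar> \<le> \<Lambda>"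
    and U: "0 < U" "lik_stat n a \<omega> \<le> U"
      "score_stat n (1 / (4 * \<Lambda>)) (dirs K M (\<lambda>i. 1 / sqrt (real n * (1 + \<tau> i))) \<psi> (\<lambda>_. 0)) a \<omega> \<le> U"
    and lnU: "0 \<le> ln U"
  shows "(\<Sum>i=1..n. l v (X i \<omega>)) \<ge> real n * (3 / 8 * c_hell * B v v
     - c_loss * (\<Sum>i<K. (1 + \<tau> i) * (B (v - a) (\<psi> i))\<^sup>2)) - 6 * \<Lambda> * ln U - 18 * C * T"
proof -
  define w where "w = v - a"
  define x where "x i = B w (\<psi> i)" for i
  define \<sigma> where "\<sigma> i = 1 / sqrt (real n * (1 + \<tau> i))" for i
  \<comment> \<open>The bias that puts the mean of the signs at \<open>v - a\<close>; the condition
    on \<open>M\<close> says exactly that it is at most 1 in absolute value.\<close>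
  define \<beta> where "\<beta> i = x i / (\<sigma> i * sqrt (real M))" for i
  define L where "L = dirs K M \<sigma> \<psi> \<beta>"
  define N where "N = (\<Sum>i<K. (1 + \<tau> i) * (x i)\<^sup>2)"
  have pos: "0 < real n * (1 + \<tau> i)" for i using n \<tau>(1)[of i] by (intro mult_pos_pos) auto
  have \<sigma>: "0 < \<sigma> i" "(\<sigma> i)\<^sup>2 = 1 / (real n * (1 + \<tau> i))" for i
    using pos[of i] unfolding \<sigma>_def by (auto simp: power_divide)
  have w_span: "w \<in> span (\<psi> ` {..<K})" unfolding w_def by (intro span_diff a v)
  have \<beta>2: "(\<beta> i)\<^sup>2 = real n * (1 + \<tau> i) * (x i)\<^sup>2 / real M" for i
    unfolding \<beta>_def power_divide power_mult_distrib \<sigma> using M by simp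
  have til: "tiltable L"
    unfolding L_def
  proof (rule tiltable_dirs)
    fix i assume "i < K"
    then have "(\<beta> i)\<^sup>2 \<le> 1" unfolding \<beta>2 x_def w_def using M by simp
    then show "\<bar>\<beta> i\<bar> \<le> 1" by (simp add: abs_square_le_1)
  qed
  have mean: "tilt_mean L = v - a"
  proof -
    have "sqrt (real M) * \<beta> i * \<sigma> i = x i" for i
      using \<sigma>(1)[of i] M unfolding \<beta>_def by simp
    then show ?thesis
      unfolding L_def tilt_mean_dirs x_def
      using orthonormal_expansion[OF bilinear_B orth w_span] unfolding w_def by simp
  qed
  have Bw: "B w w = (\<Sum>i<K. (x i)\<^sup>2)"
    unfolding x_def by (rule orthonormal_parseval[OF bilinear_B orth w_span])
  have Bw_N: "B w w \<le> N"
    unfolding Bw N_def using \<tau> by (intro sum_mono) (simp add: mult_right_le_one_le distrib_right)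
  have sumB: "(\<Sum>(b, e)\<leftarrow>L. B e e) \<le> T / real n"
  proof -
    have "(\<Sum>(b, e)\<leftarrow>L. B e e) = (\<Sum>i<K. (\<sigma> i)\<^sup>2 * B (\<psi> i) (\<psi> i))"
      unfolding L_def by (rule sum_form_dirs[OF bilinear_B M(1)])
    also have "\<dots> = (\<Sum>i<K. 1 / (1 + \<tau> i)) / real n"
      unfolding sum_divide_distrib \<sigma> by (intro sum.cong) (auto simp: orth field_simps)
    also have "\<dots> \<le> T / real n" using \<tau> by (intro divide_right_mono) auto
    finally show ?thesis .
  qed
  have sumb: "(\<Sum>(b, e)\<leftarrow>L. b\<^sup>2) = real n * N"
    unfolding L_def sum_sq_dirs \<beta>2 N_def using M by (simp add: sum_distrib_left mult.assoc)
  define W where "W = score_stat n (1 / (4 * \<Lambda>)) L a \<omega>"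
  have W: "W > 0" "W \<le> U"
  proof -
    show "W > 0" unfolding W_def by (rule score_stat(3)[OF a(1)])
    have "flat L = flat (dirs K M \<sigma> \<psi> (\<lambda>_. 0))" by (simp add: L_def flat_dirs)
    from score_stat_flat_cong[OF this, of n "1 / (4 * \<Lambda>)" a \<omega>] show "W \<le> U"
      using U(3) unfolding W_def \<sigma>_def[symmetric] by linarith
  qed
  have lW: "ln W \<le> ln U" using W U by simp
  have "ln (lik_stat n a \<omega>) \<le> ln U" using U by (intro ln_mono) (auto simp: lik_stat_def)
  then have la: "real n * hell a - 2 * ln U \<le> (\<Sum>i=1..n. l a (X i \<omega>))" by (simp add: lik_stat_def)
  have "(\<Sum>i=1..n. l v (X i \<omega>)) \<ge> (\<Sum>i=1..n. l a (X i \<omega>)) + real n * drift a w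
     - 4 * \<Lambda> * (ln W + (\<Sum>(b, e)\<leftarrow>L. b\<^sup>2))
     - 9 * real n * C * (B w w + 2 * (\<Sum>(b, e)\<leftarrow>L. B e e))"
    unfolding w_def W_def by (rule increment_ge[OF a(1) v(1) til mean \<omega> tan bd n])
  moreover have "4 * \<Lambda> * (ln W + (\<Sum>(b, e)\<leftarrow>L. b\<^sup>2)) \<le> 4 * \<Lambda> * (ln U + real n * N)"
    unfolding sumb using lW \<Lambda>1 by (intro mult_left_mono) auto
  moreover have "9 * real n * C * (B w w + 2 * (\<Sum>(b, e)\<leftarrow>L. B e e)) \<le> 9 * real n * C * (N + 2 * (T / real n))"
    using Bw_N sumB C0 by (intro mult_left_mono add_mono) auto
  moreover have "9 * real n * C * (N + 2 * (T / real n)) = 9 * real n * C * N + 18 * C * T"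
    using n by (simp add: field_simps)
  moreover have "real n * drift a w \<ge> real n * (- hell a / 4 - 4 * exp (2 * \<Lambda>) * C * N)"
  proof (intro mult_left_mono)
    have "4 * exp (2 * \<Lambda>) * C * B w w \<le> 4 * exp (2 * \<Lambda>) * C * N"
      using Bw_N C0 by (intro mult_left_mono) auto
    then show "- hell a / 4 - 4 * exp (2 * \<Lambda>) * C * N \<le> drift a w"
      using drift_ge[OF a(1), of w] by linarith
  qed auto
  moreover have "real n * hell a \<ge> real n * (c_hell * (B v v / 2 - N))"
  proof (intro mult_left_mono)
    have "c_hell * (B v v / 2 - N) \<le> c_hell * B a a"
      using B_half_le[of v a] Bw_N c_hell_pos unfolding w_def by (intro mult_left_mono) auto
    then show "c_hell * (B v v / 2 - N) \<le> hell a"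
      using hell_ge[OF a(1)] unfolding c_hell_def by linarith
  qed auto
  \<comment> \<open>Serves to round the coefficient \<open>3 / 4 * c_hell\<close> of
    \<open>N\<close> up to \<open>c_hell\<close>.\<close>
  moreover have "0 \<le> real n * (c_hell * N)"
    using c_hell_pos Bw_N pos_B[of w] by (intro mult_nonneg_nonneg) auto
  \<comment> \<open>The likelihood statistic costs \<open>2 * ln U\<close>; enlarged to
    \<open>2 * \<Lambda> * ln U\<close> it merges with the cost of the score statistic into
    \<open>6 * \<Lambda> * ln U\<close>.\<close>
  moreover have "0 \<le> 2 * \<Lambda> * ln U - 2 * ln U"
    using mult_right_mono[OF \<Lambda>1 lnU] by simp
  ultimately have "(\<Sum>i=1..n. l v (X i \<omega>)) \<ge> 3 / 4 * (real n * (c_hell * (B v v / 2 - N))) - 2 * \<Lambda> * ln U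
     + real n * (- 4 * exp (2 * \<Lambda>) * C * N) - 4 * \<Lambda> * (ln U + real n * N) - (9 * real n * C * N + 18 * C * T)
     - (1/4) * (real n * (c_hell * N))"
    using la by (simp only: right_diff_distrib)
  also have "3 / 4 * (real n * (c_hell * (B v v / 2 - N))) - 2 * \<Lambda> * ln U
     + real n * (- 4 * exp (2 * \<Lambda>) * C * N) - 4 * \<Lambda> * (ln U + real n * N) - (9 * real n * C * N + 18 * C * T)
     - (1/4) * (real n * (c_hell * N))
     = real n * (3 / 8 * c_hell * B v v - c_loss * N) - 6 * \<Lambda> * ln U - 18 * C * T"
    unfolding c_loss_def by (simp add: algebra_simps)
  finally show ?thesis unfolding N_def x_def w_def .
qed

end

lemma floor_sq_le: "(real_of_int \<lfloor>y\<rfloor>)\<^sup>2 \<le> 2 * y\<^sup>2 + 2"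
proof -
  have "\<bar>real_of_int \<lfloor>y\<rfloor>\<bar> \<le> \<bar>y\<bar> + 1" by linarith
  then have "\<bar>real_of_int \<lfloor>y\<rfloor>\<bar>\<^sup>2 \<le> (\<bar>y\<bar> + 1)\<^sup>2" by (intro power_mono) auto
  also have "\<dots> \<le> 2 * \<bar>y\<bar>\<^sup>2 + 2"
    using zero_le_power2[of "\<bar>y\<bar> - 1"] unfolding power2_sum power2_diff by simp
  finally show ?thesis by simp
qed

lemma floor_eq_abs_diff_le: "\<lfloor>x\<rfloor> = \<lfloor>y\<rfloor> \<Longrightarrow> \<bar>x - y\<bar> \<le> (1::real)"
  by linarith

lemma AE_null_setE:
  assumes "AE x in M. Q x"
  obtains E where "E \<in> null_sets M" "\<And>x. x \<in> space M - E \<Longrightarrow> Q x"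
proof -
  from assms obtain E where "{x \<in> space M. \<not> Q x} \<subseteq> E" "emeasure M E = 0" "E \<in> sets M"
    by (rule AE_E)
  then show ?thesis by (intro that[of E]) (auto simp: null_sets_def)
qed

context iid_likelihood
begin

text \<open>Points are grouped by the integer parts of their leading coordinates. The representative of a cell
  is chosen in \<open>F\<close>, since the grid points themselves may lie outside \<open>Nb\<close>; coordinates with
  \<open>\<tau> i > 1\<close> need no grid because the penalty controls them.\<close>

lemma uniform_lower_bound:
  fixes \<psi> :: "nat \<Rightarrow> 'q"
  assumes orth: "\<And>i j. i < K \<Longrightarrow> j < K \<Longrightarrow> B (\<psi> i) (\<psi> j) = (if i = j then 1 else 0)"
    and F: "finite F" "F \<subseteq> Nb" "F \<subseteq> span (\<psi> ` {..<K})"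
    and \<tau>: "\<And>i. 0 \<le> \<tau> i" "(\<Sum>i<K. 1 / (1 + \<tau> i)) \<le> T"
    and T: "1 \<le> T" and n: "1 \<le> n" and \<Gamma>: "0 < \<Gamma>" and s: "0 < s" "s \<le> 1" and \<epsilon>: "0 < \<epsilon>" "\<epsilon> \<le> 1"
    and FB: "\<And>v. v \<in> F \<Longrightarrow> B v v \<le> 2 * \<Gamma>"
    and FJ: "\<And>v. v \<in> F \<Longrightarrow> (\<Sum>i<K. \<tau> i * (B v (\<psi> i))\<^sup>2) \<le> \<kappa> * \<Gamma>"
  shows "\<exists>E\<in>sets S. measure S E \<le> \<epsilon> \<and> (\<forall>\<omega>\<in>space S - E. \<forall>v\<in>F.
    (\<Sum>i=1..n. l v (X i \<omega>)) \<ge> real n * (3 / 8 * c_hell * B v v - c_loss * ((2 * s\<^sup>2 + 8 * \<kappa>) * \<Gamma>))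
      - 6 * \<Lambda> * (ln (2 / \<epsilon>) + 12 * T / s\<^sup>2) - 18 * C * T)"
proof (cases "F = {}")
  case False
  define I where "I = {i. i < K \<and> \<tau> i \<le> 1}"
  \<comment> \<open>With this mesh the gridded coordinates, at most \<open>2 * T\<close> in number,
    add at most \<open>2 * s\<^sup>2 * \<Gamma>\<close> to a squared distance within a cell, while
    the points of \<open>F\<close> divided by \<open>\<delta>\<close> have squared length at most
    \<open>2 * T / s\<^sup>2\<close>.\<close>
  define \<delta> where "\<delta> = s * sqrt (\<Gamma> / T)"
  define key where "key v = restrict (\<lambda>i. \<lfloor>B v (\<psi> i) / \<delta>\<rfloor>) I" for v
  define Z where "Z = key ` F"
  define rep where "rep z = (SOME v. v \<in> F \<and> key v = z)" for z
  have \<delta>: "0 < \<delta>" "\<delta>\<^sup>2 = s\<^sup>2 * (\<Gamma> / T)"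
    unfolding \<delta>_def power_mult_distrib using s \<Gamma> T by auto
  have I: "finite I" "I \<subseteq> {..<K}" unfolding I_def by auto
  \<comment> \<open>Each coordinate with \<open>\<tau> i \<le> 1\<close> contributes at least
    \<open>1 / 2\<close> to the effective dimension.\<close>
  have card_I: "real (card I) \<le> 2 * T"
  proof -
    have "real (card I) / 2 = (\<Sum>i\<in>I. 1 / 2)" by simp
    also have "\<dots> \<le> (\<Sum>i\<in>I. 1 / (1 + \<tau> i))"
    proof (rule sum_mono)
      fix i assume "i \<in> I"
      then show "1 / 2 \<le> 1 / (1 + \<tau> i)" using \<tau>(1)[of i] unfolding I_def by (intro divide_left_mono) auto
    qed
    also have "\<dots> \<le> (\<Sum>i<K. 1 / (1 + \<tau> i))" using I \<tau>(1) by (intro sum_mono2) auto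
    finally show ?thesis using \<tau>(2) by linarith
  qed
  have Z: "finite Z" "Z \<noteq> {}" unfolding Z_def using F False by auto
  have rep: "rep (key v) \<in> F" "key (rep (key v)) = key v" if "v \<in> F" for v
    using someI[of "\<lambda>u. u \<in> F \<and> key u = key v" v] that unfolding rep_def by auto
  have repZ: "rep z \<in> F" if "z \<in> Z" for z using that rep unfolding Z_def by auto
  define Nk where "Nk = card Z"
  have Nk1: "1 \<le> Nk" unfolding Nk_def using Z by (simp add: Suc_le_eq card_gt_0_iff)
  have par: "B v v = (\<Sum>i<K. (B v (\<psi> i))\<^sup>2)" if "v \<in> F" for v
    by (rule orthonormal_parseval[OF bilinear_B orth]) (use F that in auto)
  have "real Nk \<le> exp (8 * T / s\<^sup>2) * 3 ^ card I"
    unfolding Nk_def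
  proof (rule card_int_vectors_le)
    show "Z \<subseteq> extensional I" unfolding Z_def key_def by auto
    fix z assume "z \<in> Z"
    then obtain v where v: "v \<in> F" "z = key v" unfolding Z_def by auto
    have "(\<Sum>i\<in>I. (real_of_int (z i))\<^sup>2) \<le> (\<Sum>i\<in>I. 2 * (B v (\<psi> i) / \<delta>)\<^sup>2 + 2)"
      unfolding v key_def by (intro sum_mono) (simp add: floor_sq_le)
    also have "\<dots> = 2 * (\<Sum>i\<in>I. (B v (\<psi> i))\<^sup>2) / \<delta>\<^sup>2 + 2 * real (card I)"
      by (simp add: sum.distrib power_divide sum_distrib_left sum_divide_distrib)
    also have "\<dots> \<le> 2 * (2 * \<Gamma>) / \<delta>\<^sup>2 + 2 * (2 * T)"
    proof (intro add_mono mult_left_mono divide_right_mono card_I)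
      have "(\<Sum>i\<in>I. (B v (\<psi> i))\<^sup>2) \<le> B v v"
        unfolding par[OF v(1)] using I by (intro sum_mono2) auto
      then show "(\<Sum>i\<in>I. (B v (\<psi> i))\<^sup>2) \<le> 2 * \<Gamma>" using FB[OF v(1)] by linarith
    qed auto
    also have "2 * (2 * \<Gamma>) / \<delta>\<^sup>2 = 4 * T / s\<^sup>2" unfolding \<delta> using \<Gamma> by simp
    also have "2 * (2 * T) \<le> 4 * T / s\<^sup>2"
    proof -
      have "4 * T * s\<^sup>2 \<le> 4 * T * 1" using s T by (intro mult_left_mono power_le_one) auto
      then show ?thesis using s by (simp add: pos_le_divide_eq)
    qed
    finally show "(\<Sum>i\<in>I. (real_of_int (z i))\<^sup>2) \<le> 8 * T / s\<^sup>2" by simp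
  qed (use I Z in auto)
  then have "ln (real Nk) \<le> ln (exp (8 * T / s\<^sup>2) * 3 ^ card I)" using Nk1 by (intro ln_mono) auto
  also have "\<dots> = 8 * T / s\<^sup>2 + real (card I) * ln 3" by (simp add: ln_mult ln_realpow)
  also have "\<dots> \<le> 8 * T / s\<^sup>2 + 4 * T / s\<^sup>2"
  proof -
    have "real (card I) * ln 3 \<le> (2 * T) * 2"
      using card_I ln_le_minus_one[of 3] T by (intro mult_mono) auto
    also have "\<dots> \<le> 4 * T / s\<^sup>2"
    proof -
      have "4 * T * s\<^sup>2 \<le> 4 * T * 1" using s T by (intro mult_left_mono power_le_one) auto
      then show ?thesis using s by (simp add: pos_le_divide_eq)
    qed
    finally show ?thesis by simp
  qed
  finally have lnNk: "ln (real Nk) \<le> 12 * T / s\<^sup>2" by simp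
  \<comment> \<open>Markov's level for the sum over all cells of two statistics, each of expectation
    at most 1.\<close>
  define U where "U = 2 * real Nk / \<epsilon>"
  have U: "0 < U" "1 \<le> U" unfolding U_def using \<epsilon> Nk1 by (auto simp: pos_le_divide_eq)
  have lnU: "ln U \<le> ln (2 / \<epsilon>) + 12 * T / s\<^sup>2"
    using lnNk ln_mult[of "2 / \<epsilon>" "real Nk"] \<epsilon> Nk1 unfolding U_def by simp
  have lnU0: "0 \<le> ln U" using U by simp
  \<comment> \<open>As \<open>F\<close> is finite, one \<open>M\<close> admits the shifts between
    all pairs of its points; its size enters no bound.\<close>
  define m where "m = (\<Sum>v\<in>F. \<Sum>a\<in>F. \<Sum>i<K. real n * (1 + \<tau> i) * (B (v - a) (\<psi> i))\<^sup>2)"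
  define M where "M = nat \<lceil>m\<rceil> + 1"
  have M: "real n * (1 + \<tau> i) * (B (v - a) (\<psi> i))\<^sup>2 \<le> real M" if "v \<in> F" "a \<in> F" "i < K" for v a i
  proof -
    let ?t = "\<lambda>v a i. real n * (1 + \<tau> i) * (B (v - a) (\<psi> i))\<^sup>2"
    have t0: "0 \<le> ?t v a i" for v a i using \<tau>(1)[of i] by simp
    have "?t v a i \<le> (\<Sum>i<K. ?t v a i)" using that t0 by (intro member_le_sum) auto
    also have "\<dots> \<le> (\<Sum>a\<in>F. \<Sum>i<K. ?t v a i)"
      using that t0 F by (intro member_le_sum[of a F "\<lambda>a. \<Sum>i<K. ?t v a i"]) (auto intro!: sum_nonneg)
    also have "\<dots> \<le> m"
      unfolding m_def using that t0 F
      by (intro member_le_sum[of v F "\<lambda>v. \<Sum>a\<in>F. \<Sum>i<K. ?t v a i"]) (auto intro!: sum_nonneg)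
    also have "m \<le> real M" unfolding M_def by linarith
    finally show ?thesis .
  qed
  define L0 where "L0 = dirs K M (\<lambda>i. 1 / sqrt (real n * (1 + \<tau> i))) \<psi> (\<lambda>_. 0)"
  define Y1 where "Y1 z \<omega> = lik_stat n (rep z) \<omega> + score_stat n (1 / (4 * \<Lambda>)) L0 (rep z) \<omega>" for z \<omega>
  define Y where "Y \<omega> = (\<Sum>z\<in>Z. Y1 z \<omega>)" for \<omega>
  have Nb: "rep z \<in> Nb" if "z \<in> Z" for z using repZ[OF that] F by auto
  have Y1i: "integrable S (Y1 z)" "(\<integral>\<omega>. Y1 z \<omega> \<partial>S) \<le> 2" if "z \<in> Z" for z
    unfolding Y1_def using lik_stat[OF Nb[OF that], of n] score_stat(1,2)[OF Nb[OF that], of n _ L0]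
    by (auto intro: order_trans[OF add_mono, of _ 1 _ 1])
  have Y10: "0 < Y1 z \<omega>" "lik_stat n (rep z) \<omega> \<le> Y1 z \<omega>"
    "score_stat n (1 / (4 * \<Lambda>)) L0 (rep z) \<omega> \<le> Y1 z \<omega>" if "z \<in> Z" for z \<omega>
  proof -
    have "0 < lik_stat n (rep z) \<omega>" by (simp add: lik_stat_def)
    then show "0 < Y1 z \<omega>" "lik_stat n (rep z) \<omega> \<le> Y1 z \<omega>"
      "score_stat n (1 / (4 * \<Lambda>)) L0 (rep z) \<omega> \<le> Y1 z \<omega>"
      using score_stat(3)[OF Nb[OF that], of n "1 / (4 * \<Lambda>)" L0 \<omega>] unfolding Y1_def by linarith+
  qed
  have Yi: "integrable S Y" unfolding Y_def using Y1i by auto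
  have EY: "(\<integral>\<omega>. Y \<omega> \<partial>S) \<le> 2 * real Nk"
  proof -
    have "(\<integral>\<omega>. Y \<omega> \<partial>S) = (\<Sum>z\<in>Z. \<integral>\<omega>. Y1 z \<omega> \<partial>S)"
      unfolding Y_def using Y1i by (intro Bochner_Integration.integral_sum) auto
    also have "\<dots> \<le> (\<Sum>z\<in>Z. 2)" by (intro sum_mono Y1i)
    finally show ?thesis by (simp add: Nk_def)
  qed
  define E1 where "E1 = {\<omega> \<in> space S. U \<le> Y \<omega>}"
  have E1: "E1 \<in> sets S" unfolding E1_def using Yi by measurable
  have Y0: "0 \<le> Y \<omega>" for \<omega> unfolding Y_def using Y10 by (intro sum_nonneg) (auto intro: less_imp_le)
  have ME: "measure S E1 \<le> \<epsilon>"
  proof -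
    have "measure S E1 \<le> (\<integral>\<omega>. Y \<omega> \<partial>S) / U"
      unfolding E1_def using Yi U Y0 by (intro integral_Markov_inequality_measure[where A = "{}"]) auto
    also have "\<dots> \<le> (2 * real Nk) / U" using EY U by (intro divide_right_mono) auto
    also have "\<dots> = \<epsilon>" unfolding U_def using Nk1 \<epsilon> by simp
    finally show ?thesis .
  qed
  have "AE \<omega> in S. \<forall>v\<in>F. \<forall>a\<in>F. \<forall>i\<ge>1. drift a (v - a) - D a (v - a) (X i \<omega>) \<le> l v (X i \<omega>) - l a (X i \<omega>)"
  proof (intro AE_finite_allI X_AE F(1))
    fix v a assume "v \<in> F" "a \<in> F"
    then have "v \<in> Nb" "a \<in> Nb" using F by auto
    from tangent[OF this(2) this(1)]
    show "AE x in P. drift a (v - a) - D a (v - a) x \<le> l v x - l a x" unfolding drift_def .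
  qed
  moreover have "AE \<omega> in S. \<forall>v\<in>F. \<forall>i\<ge>1. \<bar>l v (X i \<omega>)\<bar> \<le> \<Lambda>"
    using F l_bounded by (intro AE_finite_allI X_AE) auto
  ultimately have "AE \<omega> in S. (\<forall>v\<in>F. \<forall>a\<in>F. \<forall>i\<ge>1. drift a (v - a) - D a (v - a) (X i \<omega>) \<le> l v (X i \<omega>) - l a (X i \<omega>))
     \<and> (\<forall>v\<in>F. \<forall>i\<ge>1. \<bar>l v (X i \<omega>)\<bar> \<le> \<Lambda>)" by eventually_elim auto
  then obtain E2 where E2: "E2 \<in> null_sets S"
    "\<And>\<omega>. \<omega> \<in> space S - E2 \<Longrightarrow> (\<forall>v\<in>F. \<forall>a\<in>F. \<forall>i\<ge>1. drift a (v - a) - D a (v - a) (X i \<omega>) \<le> l v (X i \<omega>) - l a (X i \<omega>))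
     \<and> (\<forall>v\<in>F. \<forall>i\<ge>1. \<bar>l v (X i \<omega>)\<bar> \<le> \<Lambda>)"
    by (rule AE_null_setE) blast
  show ?thesis
  proof (intro bexI[of _ "E1 \<union> E2"] conjI ballI)
    have "measure S (E1 \<union> E2) \<le> measure S E1 + measure S E2"
      using E1 E2 by (intro measure_Un_le) auto
    also have "measure S E2 = 0" using E2(1) by (simp add: measure_eq_0_null_sets)
    finally show "measure S (E1 \<union> E2) \<le> \<epsilon>" using ME by simp
    show "E1 \<union> E2 \<in> sets S" using E1 E2 by auto
    fix \<omega> v assume \<omega>: "\<omega> \<in> space S - (E1 \<union> E2)" and v: "v \<in> F"
    define a where "a = rep (key v)"
    have a: "a \<in> F" "key a = key v" unfolding a_def using rep[OF v] by auto
    have kZ: "key v \<in> Z" unfolding Z_def using v by auto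
    have YU: "Y1 (key v) \<omega> \<le> U"
    proof -
      have "Y1 (key v) \<omega> \<le> Y \<omega>" unfolding Y_def using Z kZ Y10
        by (intro member_le_sum) (auto intro: less_imp_le)
      also have "Y \<omega> \<le> U" using \<omega> unfolding E1_def by auto
      finally show ?thesis .
    qed
    have good: "\<forall>v\<in>F. \<forall>a\<in>F. \<forall>i\<ge>1. drift a (v - a) - D a (v - a) (X i \<omega>) \<le> l v (X i \<omega>) - l a (X i \<omega>)"
      "\<forall>v\<in>F. \<forall>i\<ge>1. \<bar>l v (X i \<omega>)\<bar> \<le> \<Lambda>"
      using E2(2)[of \<omega>] \<omega> by auto
    define N where "N = (\<Sum>i<K. (1 + \<tau> i) * (B (v - a) (\<psi> i))\<^sup>2)"
    have low: "(\<Sum>i=1..n. l v (X i \<omega>)) \<ge> real n * (3 / 8 * c_hell * B v v - c_loss * N) - 6 * \<Lambda> * ln U - 18 * C * T"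
      unfolding N_def
    proof (rule lower_bound_near[OF orth])
      show "lik_stat n a \<omega> \<le> U" using Y10[OF kZ, of \<omega>] YU unfolding a_def by linarith
      show "score_stat n (1 / (4 * \<Lambda>)) (dirs K M (\<lambda>i. 1 / sqrt (real n * (1 + \<tau> i))) \<psi> (\<lambda>_. 0)) a \<omega> \<le> U"
        using Y10[OF kZ, of \<omega>] YU unfolding a_def L0_def by linarith
      show "X i \<omega> \<in> space P" if "1 \<le> i" for i
        using measurable_space[OF X_measurable[OF that]] \<omega> by auto
      show "0 < M" by (simp add: M_def)
    qed (use a v F \<tau> n M U lnU0 good in auto)
    have "N \<le> (2 * s\<^sup>2 + 8 * \<kappa>) * \<Gamma>"
    proof -
      define x where "x i = B (v - a) (\<psi> i)" for i
      have x_eq: "x i = B v (\<psi> i) - B a (\<psi> i)" for i unfolding x_def by (simp add: bilinear_lsub[OF bilinear_B])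
      have J: "(\<Sum>i<K. \<tau> i * (x i)\<^sup>2) \<le> 4 * \<kappa> * \<Gamma>"
      proof -
        have "(\<Sum>i<K. \<tau> i * (x i)\<^sup>2) \<le> (\<Sum>i<K. 2 * (\<tau> i * (B v (\<psi> i))\<^sup>2) + 2 * (\<tau> i * (B a (\<psi> i))\<^sup>2))"
        proof (rule sum_mono)
          fix i
          have "(x i)\<^sup>2 \<le> 2 * (B v (\<psi> i))\<^sup>2 + 2 * (B a (\<psi> i))\<^sup>2"
            unfolding x_eq using zero_le_power2[of "B v (\<psi> i) + B a (\<psi> i)"] unfolding power2_sum power2_diff by linarith
          from mult_left_mono[OF this \<tau>(1)[of i]]
          show "\<tau> i * (x i)\<^sup>2 \<le> 2 * (\<tau> i * (B v (\<psi> i))\<^sup>2) + 2 * (\<tau> i * (B a (\<psi> i))\<^sup>2)"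
            by (simp add: algebra_simps)
        qed
        also have "\<dots> \<le> 4 * \<kappa> * \<Gamma>"
          using FJ[OF v] FJ[OF a(1)] by (simp add: sum.distrib sum_distrib_left[symmetric])
        finally show ?thesis .
      qed
      have "(\<Sum>i<K. (x i)\<^sup>2) \<le> (\<Sum>i<K. (if i \<in> I then \<delta>\<^sup>2 else 0) + \<tau> i * (x i)\<^sup>2)"
      proof (rule sum_mono)
        fix i assume i: "i \<in> {..<K}"
        show "(x i)\<^sup>2 \<le> (if i \<in> I then \<delta>\<^sup>2 else 0) + \<tau> i * (x i)\<^sup>2"
        proof (cases "i \<in> I")
          case True
          have "\<lfloor>B v (\<psi> i) / \<delta>\<rfloor> = \<lfloor>B a (\<psi> i) / \<delta>\<rfloor>"
            using fun_cong[OF a(2), of i] True unfolding key_def by simp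
          from floor_eq_abs_diff_le[OF this] have "\<bar>x i / \<delta>\<bar> \<le> 1" unfolding x_eq by (simp add: diff_divide_distrib)
          then have "\<bar>x i\<bar> \<le> \<delta>" using \<delta> by simp
          then have "\<bar>x i\<bar>\<^sup>2 \<le> \<delta>\<^sup>2" by (intro power_mono) auto
          moreover have "0 \<le> \<tau> i * (x i)\<^sup>2" using \<tau>(1) by simp
          ultimately show ?thesis using True by simp
        next
          case False
          then have "1 \<le> \<tau> i" using i unfolding I_def by auto
          then have "1 * (x i)\<^sup>2 \<le> \<tau> i * (x i)\<^sup>2" by (intro mult_right_mono) auto
          then show ?thesis using False by simp
        qed
      qed
      also have "\<dots> = real (card I) * \<delta>\<^sup>2 + (\<Sum>i<K. \<tau> i * (x i)\<^sup>2)"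
      proof -
        have "(\<Sum>i<K. if i \<in> I then \<delta>\<^sup>2 else 0) = (\<Sum>i\<in>{..<K} \<inter> I. \<delta>\<^sup>2)" by (rule sum.inter_restrict[symmetric]) simp
        also have "{..<K} \<inter> I = I" using I by auto
        finally show ?thesis by (simp add: sum.distrib)
      qed
      also have "\<dots> \<le> 2 * T * \<delta>\<^sup>2 + 4 * \<kappa> * \<Gamma>" using card_I J by (intro add_mono mult_right_mono) auto
      also have "2 * T * \<delta>\<^sup>2 = 2 * s\<^sup>2 * \<Gamma>" unfolding \<delta> using T by simp
      finally have "(\<Sum>i<K. (x i)\<^sup>2) \<le> 2 * s\<^sup>2 * \<Gamma> + 4 * \<kappa> * \<Gamma>" .
      moreover have "N = (\<Sum>i<K. (x i)\<^sup>2) + (\<Sum>i<K. \<tau> i * (x i)\<^sup>2)"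
        unfolding N_def x_def by (simp add: distrib_right sum.distrib)
      ultimately show ?thesis using J by (simp add: algebra_simps)
    qed
    then have "real n * (3 / 8 * c_hell * B v v - c_loss * ((2 * s\<^sup>2 + 8 * \<kappa>) * \<Gamma>)) \<le> real n * (3 / 8 * c_hell * B v v - c_loss * N)"
      using c_loss_pos by (intro mult_left_mono diff_left_mono) auto
    moreover have "6 * \<Lambda> * ln U \<le> 6 * \<Lambda> * (ln (2 / \<epsilon>) + 12 * T / s\<^sup>2)"
      using lnU \<Lambda>1 by (intro mult_left_mono) auto
    ultimately show "(\<Sum>i=1..n. l v (X i \<omega>)) \<ge> real n * (3 / 8 * c_hell * B v v - c_loss * ((2 * s\<^sup>2 + 8 * \<kappa>) * \<Gamma>))
      - 6 * \<Lambda> * (ln (2 / \<epsilon>) + 12 * T / s\<^sup>2) - 18 * C * T"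
      using low by linarith
  qed
qed (use \<epsilon> in \<open>auto intro!: bexI[of _ "{}"]\<close>)

end

section \<open>From finite to countable sets\<close>

lemma span_range_bounded:
  fixes \<psi> :: "nat \<Rightarrow> 'q::real_vector"
  assumes "finite F" "F \<subseteq> span (range \<psi>)"
  shows "\<exists>K. F \<subseteq> span (\<psi> ` {..<K})"
  using assms
proof (induction F rule: finite_induct)
  case (insert x F)
  then obtain K where K: "F \<subseteq> span (\<psi> ` {..<K})" by auto
  have "x \<in> span (range \<psi>)" using insert by auto
  then obtain t where t: "finite t" "t \<subseteq> range \<psi>" "x \<in> span t"
    unfolding span_explicit by (smt (verit) mem_Collect_eq span_base span_scale span_sum subset_iff)
  obtain I where I: "finite I" "t = \<psi> ` I" using t finite_subset_image[of t \<psi> UNIV] by auto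
  have sub: "I \<subseteq> {..<Suc (Max I)}" using I by (auto simp: less_Suc_eq_le)
  have "x \<in> span (\<psi> ` {..<max K (Suc (Max I))})"
    using t(3) unfolding I by (rule span_mono[THEN subsetD, rotated]) (use sub in fastforce)
  moreover have "F \<subseteq> span (\<psi> ` {..<max K (Suc (Max I))})"
    using K by (rule order_trans[OF _ span_mono]) auto
  ultimately show ?case by blast
qed auto

context iid_likelihood
begin

lemma X_square_sum:
  assumes "f \<in> borel_measurable P" "integrable P (\<lambda>x. (f x)\<^sup>2)" "(\<integral>x. f x \<partial>P) = (0::real)"
  shows "integrable S (\<lambda>\<omega>. (\<Sum>i=1..n. f (X i \<omega>))\<^sup>2)"
    and "(\<integral>\<omega>. (\<Sum>i=1..n. f (X i \<omega>))\<^sup>2 \<partial>S) = real n * (\<integral>x. (f x)\<^sup>2 \<partial>P)"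
proof -
  have f: "integrable P f" by (rule square_integrable_imp_integrable[OF assms(1,2)])
  have ind: "S.indep_vars (\<lambda>_. borel) (\<lambda>i \<omega>. f (X i \<omega>)) {1..}"
    by (rule S.indep_vars_compose2[OF X_indep assms(1)])
  have pair: "integrable S (\<lambda>\<omega>. f (X i \<omega>) * f (X j \<omega>)) \<and>
     (\<integral>\<omega>. f (X i \<omega>) * f (X j \<omega>) \<partial>S) = (if i = j then (\<integral>x. (f x)\<^sup>2 \<partial>P) else 0)"
    if ij: "1 \<le> i" "1 \<le> j" for i j
  proof (cases "i = j")
    case True
    have "integrable S (\<lambda>\<omega>. (f (X j \<omega>))\<^sup>2)" "(\<integral>\<omega>. (f (X j \<omega>))\<^sup>2 \<partial>S) = (\<integral>x. (f x)\<^sup>2 \<partial>P)"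
      using X_integrable[OF ij(2) assms(2)] X_integral[OF ij(2), of "\<lambda>x. (f x)\<^sup>2"] assms by auto
    then show ?thesis using True by (simp add: power2_eq_square)
  next
    case False
    have ind': "S.indep_vars (\<lambda>_. borel) (\<lambda>i \<omega>. f (X i \<omega>)) {i, j}"
      by (rule S.indep_vars_subset[OF ind]) (use ij in auto)
    have int: "integrable S (\<lambda>\<omega>. f (X k \<omega>))" if "k \<in> {i, j}" for k
      using that ij by (intro X_integrable f) auto
    have "(\<integral>\<omega>. f (X k \<omega>) \<partial>S) = 0" if "k \<in> {i, j}" for k
      using X_integral[of k f] that ij assms by auto
    then show ?thesis
      using S.indep_vars_lebesgue_integral[OF _ ind' int] S.indep_vars_integrable[OF _ ind' int] False
      by simp
  qed
  have sq: "(\<Sum>i=1..n. f (X i \<omega>))\<^sup>2 = (\<Sum>i=1..n. \<Sum>j=1..n. f (X i \<omega>) * f (X j \<omega>))" for \<omega>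
    unfolding power2_eq_square by (rule sum_product)
  show "integrable S (\<lambda>\<omega>. (\<Sum>i=1..n. f (X i \<omega>))\<^sup>2)"
    unfolding sq using pair by (intro Bochner_Integration.integrable_sum) auto
  have "(\<integral>\<omega>. (\<Sum>i=1..n. f (X i \<omega>))\<^sup>2 \<partial>S) = (\<Sum>i=1..n. \<Sum>j=1..n. \<integral>\<omega>. f (X i \<omega>) * f (X j \<omega>) \<partial>S)"
    unfolding sq using pair
    by (subst Bochner_Integration.integral_sum, force intro!: Bochner_Integration.integrable_sum)+ simp
  also have "\<dots> = (\<Sum>i=1..n. \<Sum>j=1..n. if i = j then (\<integral>x. (f x)\<^sup>2 \<partial>P) else 0)"
    using pair by (intro sum.cong refl) auto
  also have "\<dots> = (\<Sum>i=1..n. \<integral>x. (f x)\<^sup>2 \<partial>P)" by (intro sum.cong refl) (simp add: sum.delta)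
  finally show "(\<integral>\<omega>. (\<Sum>i=1..n. f (X i \<omega>))\<^sup>2 \<partial>S) = real n * (\<integral>x. (f x)\<^sup>2 \<partial>P)" by simp
qed

text \<open>The Cauchy-Schwarz inequality with weights \<open>1 + \<tau> i\<close> separates the
  direction from a random quadratic sum that does not depend on \<open>v\<close>. Its expectation is
  at most \<open>n * C\<close> times the effective dimension, and it increases with
  \<open>K\<close>, so that a single event serves all \<open>K\<close>.\<close>

lemma score_bound:
  fixes \<psi> :: "nat \<Rightarrow> 'q"
  assumes orth: "\<And>i j. B (\<psi> i) (\<psi> j) = (if i = j then 1 else 0)"
    and \<tau>: "\<And>i. 0 \<le> \<tau> i" "\<And>K. (\<Sum>i<K. 1 / (1 + \<tau> i)) \<le> T"
    and T: "1 \<le> T" and n: "1 \<le> n" and \<epsilon>: "0 < \<epsilon>"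
  shows "\<exists>E\<in>sets S. measure S E \<le> \<epsilon> \<and> (\<forall>\<omega>\<in>space S - E. \<forall>K. \<forall>v\<in>span (\<psi> ` {..<K}).
    (\<Sum>j=1..n. D 0 v (X j \<omega>))\<^sup>2 \<le> real n * C * T / \<epsilon> * (\<Sum>i<K. (1 + \<tau> i) * (B v (\<psi> i))\<^sup>2))"
proof -
  define V where "V i \<omega> = (\<Sum>j=1..n. D 0 (\<psi> i) (X j \<omega>))\<^sup>2" for i \<omega>
  define U where "U = real n * C * T / \<epsilon>"
  have U: "0 < U" unfolding U_def using n C0 T \<epsilon> by (intro divide_pos_pos mult_pos_pos) auto
  have Vi: "integrable S (V i)" "(\<integral>\<omega>. V i \<omega> \<partial>S) \<le> real n * C" for i
  proof -
    note * = X_square_sum[OF measurable_D[OF zero_mem] D_square_integrable[OF zero_mem] D_centred[OF zero_mem], where n = n]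
    show "integrable S (V i)" unfolding V_def by (rule *(1))
    have "(\<integral>\<omega>. V i \<omega> \<partial>S) \<le> real n * (C * B (\<psi> i) (\<psi> i))"
      unfolding V_def *(2) by (intro mult_left_mono D_upper zero_mem) auto
    then show "(\<integral>\<omega>. V i \<omega> \<partial>S) \<le> real n * C" using orth[of i i] by simp
  qed
  define Y where "Y K \<omega> = (\<Sum>i<K. V i \<omega> / (1 + \<tau> i))" for K \<omega>
  have \<tau>1: "0 < 1 + \<tau> i" for i using \<tau>(1)[of i] by linarith
  have Yi: "integrable S (Y K)" for K unfolding Y_def using Vi by simp
  have Y0: "0 \<le> Y K \<omega>" for K \<omega>
    unfolding Y_def V_def using \<tau>1 by (intro sum_nonneg divide_nonneg_pos) auto
  have EY: "(\<integral>\<omega>. Y K \<omega> \<partial>S) \<le> real n * C * T" for K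
  proof -
    have "(\<integral>\<omega>. Y K \<omega> \<partial>S) = (\<Sum>i<K. (\<integral>\<omega>. V i \<omega> \<partial>S) / (1 + \<tau> i))"
      unfolding Y_def using Vi by (subst Bochner_Integration.integral_sum) auto
    also have "\<dots> \<le> (\<Sum>i<K. real n * C / (1 + \<tau> i))"
      using \<tau>1 Vi by (intro sum_mono divide_right_mono) (auto intro: less_imp_le)
    also have "\<dots> = real n * C * (\<Sum>i<K. 1 / (1 + \<tau> i))" by (simp add: sum_distrib_left)
    also have "\<dots> \<le> real n * C * T" using \<tau> C0 by (intro mult_left_mono) auto
    finally show ?thesis .
  qed
  define E where "E K = {\<omega> \<in> space S. U \<le> Y K \<omega>}" for K
  have E: "E K \<in> sets S" for K unfolding E_def using Yi[of K] by measurable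
  have ME: "measure S (E K) \<le> \<epsilon>" for K
  proof -
    have "measure S (E K) \<le> (\<integral>\<omega>. Y K \<omega> \<partial>S) / U"
      unfolding E_def using Yi U Y0 by (intro integral_Markov_inequality_measure[where A = "{}"]) auto
    also have "\<dots> \<le> (real n * C * T) / U" using EY U by (intro divide_right_mono) auto
    also have "\<dots> = \<epsilon>" using U \<epsilon> n unfolding U_def by auto
    finally show ?thesis .
  qed
  have inc: "incseq E"
  proof (rule incseq_SucI)
    fix K
    have "Y K \<omega> \<le> Y (Suc K) \<omega>" for \<omega>
      unfolding Y_def V_def using \<tau>1[of K] by (simp add: less_imp_le)
    then show "E K \<subseteq> E (Suc K)" unfolding E_def by (auto intro: order_trans)
  qed
  show ?thesis
  proof (intro bexI[of _ "\<Union>K. E K"] conjI ballI allI)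
    have "(\<lambda>K. measure S (E K)) \<longlonglongrightarrow> measure S (\<Union>K. E K)"
      using E inc by (intro S.finite_Lim_measure_incseq) auto
    then show "measure S (\<Union>K. E K) \<le> \<epsilon>" using ME by (intro LIMSEQ_le_const2) auto
    show "(\<Union>K. E K) \<in> sets S" using E by auto
    fix \<omega> K v assume \<omega>: "\<omega> \<in> space S - (\<Union>K. E K)" and v: "v \<in> span (\<psi> ` {..<K})"
    define x where "x i = B v (\<psi> i)" for i
    define z where "z i = (\<Sum>j=1..n. D 0 (\<psi> i) (X j \<omega>))" for i
    have YU: "Y K \<omega> \<le> U" using \<omega> unfolding E_def by (auto simp: not_le intro: less_imp_le)
    have "(\<Sum>j=1..n. D 0 v (X j \<omega>)) = (\<Sum>j=1..n. \<Sum>i<K. x i * D 0 (\<psi> i) (X j \<omega>))"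
    proof (rule sum.cong)
      fix j assume "j \<in> {1..n}"
      then have "X j \<omega> \<in> space P" using measurable_space[OF X_measurable[of j]] \<omega> by auto
      from linear_D[OF zero_mem this] have l: "linear (\<lambda>w. D 0 w (X j \<omega>))" .
      have "v = (\<Sum>i<K. x i *\<^sub>R \<psi> i)" unfolding x_def
        by (rule orthonormal_expansion[OF bilinear_B orth v])
      then have "D 0 v (X j \<omega>) = D 0 (\<Sum>i<K. x i *\<^sub>R \<psi> i) (X j \<omega>)" by simp
      also have "\<dots> = (\<Sum>i<K. x i * D 0 (\<psi> i) (X j \<omega>))"
        by (simp add: linear_sum[OF l] linear_cmul[OF l])
      finally show "D 0 v (X j \<omega>) = (\<Sum>i<K. x i * D 0 (\<psi> i) (X j \<omega>))" .
    qed simp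
    also have "\<dots> = (\<Sum>i<K. x i * z i)"
      unfolding z_def sum_distrib_left by (rule sum.swap)
    also have "\<dots> = (\<Sum>i<K. (sqrt (1 + \<tau> i) * x i) * (z i / sqrt (1 + \<tau> i)))"
    proof (intro sum.cong refl)
      fix i
      have "sqrt (1 + \<tau> i) \<noteq> 0" using \<tau>1[of i] by simp
      then show "x i * z i = (sqrt (1 + \<tau> i) * x i) * (z i / sqrt (1 + \<tau> i))" by simp
    qed
    finally have "(\<Sum>j=1..n. D 0 v (X j \<omega>))\<^sup>2 = (\<Sum>i<K. (sqrt (1 + \<tau> i) * x i) * (z i / sqrt (1 + \<tau> i)))\<^sup>2" by simp
    also have "\<dots> \<le> (\<Sum>i<K. (sqrt (1 + \<tau> i) * x i)\<^sup>2) * (\<Sum>i<K. (z i / sqrt (1 + \<tau> i))\<^sup>2)"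
      by (rule Cauchy_Schwarz_ineq_sum)
    also have "(\<Sum>i<K. (sqrt (1 + \<tau> i) * x i)\<^sup>2) = (\<Sum>i<K. (1 + \<tau> i) * (x i)\<^sup>2)"
      using \<tau>1 by (simp add: power_mult_distrib less_imp_le)
    also have "(\<Sum>i<K. (z i / sqrt (1 + \<tau> i))\<^sup>2) = Y K \<omega>"
      unfolding Y_def V_def z_def using \<tau>1 by (simp add: power_divide less_imp_le)
    also have "(\<Sum>i<K. (1 + \<tau> i) * (x i)\<^sup>2) * Y K \<omega> \<le> (\<Sum>i<K. (1 + \<tau> i) * (x i)\<^sup>2) * U"
      using YU \<tau>1 by (intro mult_left_mono sum_nonneg mult_nonneg_nonneg) (auto intro: less_imp_le)
    finally show "(\<Sum>j=1..n. D 0 v (X j \<omega>))\<^sup>2 \<le> real n * C * T / \<epsilon> * (\<Sum>i<K. (1 + \<tau> i) * (B v (\<psi> i))\<^sup>2)"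
      unfolding x_def U_def by (simp add: mult.commute)
  qed
qed

text \<open>The bound for finite sets does not depend on their size, so it survives an increasing union.\<close>

lemma countable_lower_bound:
  fixes \<psi> :: "nat \<Rightarrow> 'q"
  assumes orth: "\<And>i j. B (\<psi> i) (\<psi> j) = (if i = j then 1 else 0)"
    and F: "countable F" "F \<subseteq> Nb" "F \<subseteq> span (range \<psi>)"
    and \<tau>: "\<And>i. 0 \<le> \<tau> i" "\<And>K. (\<Sum>i<K. 1 / (1 + \<tau> i)) \<le> T"
    and T: "1 \<le> T" and n: "1 \<le> n" and \<Gamma>: "0 < \<Gamma>" and s: "0 < s" "s \<le> 1" and \<epsilon>: "0 < \<epsilon>" "\<epsilon> \<le> 1"
    and FB: "\<And>v. v \<in> F \<Longrightarrow> B v v \<le> 2 * \<Gamma>"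
    and FJ: "\<And>v K. v \<in> F \<Longrightarrow> (\<Sum>i<K. \<tau> i * (B v (\<psi> i))\<^sup>2) \<le> \<kappa> * \<Gamma>"
  shows "\<exists>E\<in>sets S. measure S E \<le> \<epsilon> \<and> (\<forall>\<omega>\<in>space S - E. \<forall>v\<in>F.
    (\<Sum>i=1..n. l v (X i \<omega>)) \<ge> real n * (3 / 8 * c_hell * B v v - c_loss * ((2 * s\<^sup>2 + 8 * \<kappa>) * \<Gamma>))
      - 6 * \<Lambda> * (ln (2 / \<epsilon>) + 12 * T / s\<^sup>2) - 18 * C * T)"
proof (cases "F = {}")
  case False
  define e where "e = from_nat_into F"
  have e: "F = range e" unfolding e_def using F(1) False by (simp add: range_from_nat_into)
  define Q where "Q \<omega> v \<longleftrightarrow> (\<Sum>i=1..n. l v (X i \<omega>)) \<ge> real n * (3 / 8 * c_hell * B v v - c_loss * ((2 * s\<^sup>2 + 8 * \<kappa>) * \<Gamma>))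
      - 6 * \<Lambda> * (ln (2 / \<epsilon>) + 12 * T / s\<^sup>2) - 18 * C * T" for \<omega> v
  have "\<exists>E\<in>sets S. measure S E \<le> \<epsilon> \<and> (\<forall>\<omega>\<in>space S - E. \<forall>v\<in>e ` {..m}. Q \<omega> v)" for m
  proof -
    have sub: "e ` {..m} \<subseteq> F" unfolding e by auto
    obtain K where K: "e ` {..m} \<subseteq> span (\<psi> ` {..<K})"
      using span_range_bounded[of "e ` {..m}" \<psi>] sub F(3) by auto
    show ?thesis unfolding Q_def
      by (rule uniform_lower_bound[OF orth _ _ K \<tau> T n \<Gamma> s \<epsilon>]) (use sub F FB FJ in auto)
  qed
  then obtain E where E: "\<And>m. E m \<in> sets S" "\<And>m. measure S (E m) \<le> \<epsilon>"
    "\<And>m \<omega> v. \<omega> \<in> space S - E m \<Longrightarrow> v \<in> e ` {..m} \<Longrightarrow> Q \<omega> v" by metis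
  \<comment> \<open>The events \<open>E m\<close> need not be nested. Outside the union of the sets
    \<open>G m\<close>, a point \<open>e m\<close> escapes \<open>E k\<close> for some
    \<open>k \<ge> m\<close>, and the bound of index \<open>k\<close> covers it.\<close>
  define G where "G m = (\<Inter>k\<in>{m..}. E k)" for m
  have G: "G m \<in> sets S" for m unfolding G_def using E by (intro sets.countable_INT') auto
  have MG: "measure S (G m) \<le> \<epsilon>" for m
    using S.finite_measure_mono[of "G m" "E m"] E(1,2)[of m] unfolding G_def by force
  have inc: "incseq G" unfolding G_def incseq_def by auto
  have "\<exists>E\<in>sets S. measure S E \<le> \<epsilon> \<and> (\<forall>\<omega>\<in>space S - E. \<forall>v\<in>F. Q \<omega> v)"
  proof (intro bexI[of _ "\<Union>m. G m"] conjI ballI)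
    have "(\<lambda>m. measure S (G m)) \<longlonglongrightarrow> measure S (\<Union>m. G m)"
      using G inc by (intro S.finite_Lim_measure_incseq) auto
    then show "measure S (\<Union>m. G m) \<le> \<epsilon>" using MG by (intro LIMSEQ_le_const2) auto
    show "(\<Union>m. G m) \<in> sets S" using G by auto
    fix \<omega> v assume \<omega>: "\<omega> \<in> space S - (\<Union>m. G m)" and "v \<in> F"
    then obtain m where m: "v = e m" unfolding e by auto
    have "\<omega> \<notin> G m" using \<omega> by auto
    then obtain k where "m \<le> k" "\<omega> \<notin> E k" unfolding G_def by auto
    then show "Q \<omega> v" using E(3)[of \<omega> k v] \<omega> m by auto
  qed
  then show ?thesis unfolding Q_def .
qed (use \<epsilon> in \<open>auto intro!: bexI[of _ "{}"]\<close>)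

end

section \<open>The density model\<close>

lemma L20_square_integrable: "f \<in> L20 P \<Longrightarrow> integrable P (\<lambda>x. (f x)\<^sup>2)"
  by (simp add: L20_def)

lemma L20_measurable: "f \<in> L20 P \<Longrightarrow> f \<in> borel_measurable P"
  by (simp add: L20_def)

lemma L20_integral: "f \<in> L20 P \<Longrightarrow> (\<integral>x. f x \<partial>P) = 0"
  by (simp add: L20_def)

lemma (in prob_space) L20_integrable: "f \<in> L20 M \<Longrightarrow> integrable M f"
  unfolding L20_def using square_integrable_imp_integrable by blast

lemma integrable_mult_of_squares:
  assumes [measurable]: "f \<in> borel_measurable P" "g \<in> borel_measurable P"
    and "integrable P (\<lambda>x. (f x)\<^sup>2)" "integrable P (\<lambda>x. (g x :: real)\<^sup>2)"
  shows "integrable P (\<lambda>x. f x * g x)"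
proof (rule Bochner_Integration.integrable_bound[of _ "\<lambda>x. (f x)\<^sup>2 + (g x)\<^sup>2"])
  show "AE x in P. norm (f x * g x) \<le> norm ((f x)\<^sup>2 + (g x)\<^sup>2)"
  proof (rule AE_I2)
    fix x
    have "\<bar>f x * g x\<bar> \<le> (f x)\<^sup>2 + (g x)\<^sup>2"
      using zero_le_power2[of "f x - g x"] zero_le_power2[of "f x + g x"]
        zero_le_power2[of "f x"] zero_le_power2[of "g x"]
      unfolding power2_sum power2_diff by linarith
    then show "norm (f x * g x) \<le> norm ((f x)\<^sup>2 + (g x)\<^sup>2)" by simp
  qed
qed (use assms in auto)

lemma (in prob_space) L20_lincomb:
  assumes f: "f \<in> L20 M" and g: "g \<in> L20 M"
  shows "(\<lambda>x. a * f x + b * g x) \<in> L20 M"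
proof -
  have [measurable]: "f \<in> borel_measurable M" "g \<in> borel_measurable M"
    using f g by (auto simp: L20_def)
  have "integrable M (\<lambda>x. f x * g x)"
    using f g by (intro integrable_mult_of_squares) (auto simp: L20_def)
  moreover have "(a * f x + b * g x)\<^sup>2 = a\<^sup>2 * (f x)\<^sup>2 + 2 * a * b * (f x * g x) + b\<^sup>2 * (g x)\<^sup>2" for x
    by (simp add: power2_eq_square algebra_simps)
  ultimately show ?thesis
    using f g L20_integrable[OF f] L20_integrable[OF g] unfolding L20_def by simp
qed

text \<open>The variance of an indicator only determines \<open>p * (1 - p)\<close>; continuity along a path excludes a
  jump of \<open>p\<close> from near 0 to near 1.\<close>

lemma continuous_path_comparison:
  fixes p :: "real \<Rightarrow> real"
  assumes cont: "continuous_on {0..1} p" and p01: "\<And>t. t \<in> {0..1} \<Longrightarrow> 0 \<le> p t \<and> p t \<le> 1"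
    and C: "1 \<le> C" and le: "\<And>t. t \<in> {0..1} \<Longrightarrow> p t * (1 - p t) \<le> C * (p 0 * (1 - p 0))"
  shows "p 1 \<le> 8 * C * p 0"
proof (cases "1 \<le> 8 * C * p 0")
  case True
  then show ?thesis using p01[of 1] by auto
next
  case False
  then have q: "C * p 0 < 1 / 8" by simp
  have p0: "0 \<le> p 0" "p 0 \<le> 1" using p01[of 0] by auto
  have "1 * p 0 \<le> C * p 0" using C p0 by (intro mult_right_mono) auto
  then have q0: "p 0 < 1 / 2" using q by simp
  have le': "p t * (1 - p t) \<le> C * p 0" if "t \<in> {0..1}" for t
  proof -
    have "C * (p 0 * (1 - p 0)) \<le> C * (p 0 * 1)"
      using C p0 by (intro mult_left_mono) auto
    then show ?thesis using le[OF that] by simp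
  qed
  have "p 1 < 1 / 2"
  proof (rule ccontr)
    assume "\<not> p 1 < 1 / 2"
    then obtain t where t: "0 \<le> t" "t \<le> 1" "p t = 1 / 2"
      using IVT'[of p 0 "1/2" 1] q0 cont by auto
    have "p t * (1 - p t) = 1 / 4" unfolding t(3) by simp
    then show False using le'[of t] t(1,2) q by simp
  qed
  then have "p 1 * (1 / 2) \<le> p 1 * (1 - p 1)" using p01[of 1] by (intro mult_left_mono) auto
  also have "\<dots> \<le> C * p 0" by (rule le') simp
  finally have "p 1 \<le> 2 * (C * p 0)" by simp
  also have "\<dots> \<le> 8 * C * p 0" using C p0 by (simp add: mult_right_mono)
  finally show ?thesis .
qed

locale density_setup =
  fixes M :: "'x measure"
    and \<eta> :: "(real ^ 'p) \<times> 'h::{real_inner, complete_space} \<Rightarrow> 'x \<Rightarrow> real"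
    and \<tau>0 :: "(real ^ 'p) \<times> 'h"
    and N :: "((real ^ 'p) \<times> 'h) set"
    and S :: "'w measure"
    and X :: "nat \<Rightarrow> 'w \<Rightarrow> 'x"
  assumes model: "density_model M \<eta> \<tau>0"
    and prob: "prob_space S"
    and indep: "prob_space.indep_vars S (\<lambda>_. M) X {1..}"
    and distr: "\<And>i. i \<ge> 1 \<Longrightarrow> distributed S M (X i) (\<lambda>x. ennreal (dens M \<eta> \<tau>0 x))"
    and N_open: "open N" and N_mem: "\<tau>0 \<in> N" and N_convex: "convex N"
    and a3: "smooth_identifiable M \<eta> \<tau>0 N S X"
    and a6: "variance_comparison M \<eta> \<tau>0 N"
    and convex_crit: "AE \<omega> in S. \<forall>n\<ge>1. convex_on UNIV (crit M \<eta> n (\<lambda>i. X i \<omega>))"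
begin

definition P0 :: "'x measure" where "P0 = law M \<eta> \<tau>0"

definition A :: "(real ^ 'p) \<times> 'h \<Rightarrow> real" where
  "A \<tau> = ln (\<integral>x. exp (\<eta> \<tau> x) \<partial>M)"

definition loss :: "(real ^ 'p) \<times> 'h \<Rightarrow> 'x \<Rightarrow> real" where
  "loss v x = A (\<tau>0 + v) - A \<tau>0 - (\<eta> (\<tau>0 + v) x - \<eta> \<tau>0 x)"

lemma loss_zero: "loss 0 x = 0"
  by (simp add: loss_def)

sublocale S: prob_space S by (rule prob)

lemma sets_P0 [simp, measurable_cong]: "sets P0 = sets M"
  and space_P0 [simp]: "space P0 = space M"
  by (simp_all add: P0_def law_def)

lemma \<eta>_L20: "\<eta> \<tau> \<in> L20 P0"
  using model unfolding density_model_def P0_def by blast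

lemma \<eta>_measurable [measurable]: "\<eta> \<tau> \<in> borel_measurable M"
  using L20_measurable[OF \<eta>_L20[of \<tau>]] unfolding measurable_cong_sets[OF sets_P0 refl] .

lemma loss_measurable [measurable]: "loss v \<in> borel_measurable M"
  unfolding loss_def by measurable

lemma exp_\<eta>_integrable: "integrable M (\<lambda>x. exp (\<eta> \<tau> x))"
  using model unfolding density_model_def by blast

lemma X_measurable: "1 \<le> i \<Longrightarrow> X i \<in> measurable S M"
  using distr[of i] by (simp add: distributed_def)

lemma distr_X: "1 \<le> i \<Longrightarrow> distr S M (X i) = P0"
  using distributed_distr_eq_density[OF distr[of i]] by (simp add: P0_def law_def)

sublocale P: prob_space P0
  using S.prob_space_distr[OF X_measurable[of 1]] distr_X[of 1] by simp

lemma prob_P0 [simp]: "measure P0 (space M) = 1"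
  using P.prob_space by simp

text \<open>Were the integral of this positive function 0, the reference measure would be null,
  whereas \<open>P0\<close> has a density with respect to it and mass 1.\<close>

lemma norm_const_pos: "0 < (\<integral>x. exp (\<eta> \<tau> x) \<partial>M)"
proof -
  have "(\<integral>x. exp (\<eta> \<tau> x) \<partial>M) \<noteq> 0"
  proof
    assume "(\<integral>x. exp (\<eta> \<tau> x) \<partial>M) = 0"
    then have "AE x in M. exp (\<eta> \<tau> x) = 0"
      using exp_\<eta>_integrable by (subst (asm) integral_nonneg_eq_0_iff_AE) auto
    then have "AE x in M. False" by simp
    then have "AE x in P0. False"
      unfolding P0_def law_def by (subst AE_density) (auto simp: dens_def)
    then show False using P.AE_False by simp
  qed
  moreover have "0 \<le> (\<integral>x. exp (\<eta> \<tau> x) \<partial>M)" by (rule integral_nonneg_AE) simp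
  ultimately show ?thesis by linarith
qed

lemma dens_eq: "dens M \<eta> \<tau> x = exp (\<eta> \<tau> x - A \<tau>)"
  using norm_const_pos[of \<tau>] by (simp add: dens_def A_def exp_diff)

lemma dens_loss: "dens M \<eta> \<tau> x = dens M \<eta> \<tau>0 x * exp (- loss (\<tau> - \<tau>0) x)"
  unfolding dens_eq loss_def by (simp add: exp_add[symmetric])

lemma dens_measurable [measurable]: "dens M \<eta> \<tau> \<in> borel_measurable M"
  unfolding dens_eq by measurable

lemma dens_pos: "0 < dens M \<eta> \<tau> x"
  by (simp add: dens_eq)

lemma mean_eq:
  assumes [measurable]: "f \<in> borel_measurable M"
  shows "mean M \<eta> \<tau> f = (\<integral>x. f x * exp (- loss (\<tau> - \<tau>0) x) \<partial>P0)"
proof -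
  have "(\<integral>x. f x * exp (- loss (\<tau> - \<tau>0) x) \<partial>P0)
    = (\<integral>x. dens M \<eta> \<tau>0 x *\<^sub>R (f x * exp (- loss (\<tau> - \<tau>0) x)) \<partial>M)"
    unfolding P0_def law_def by (intro integral_density AE_I2 less_imp_le dens_pos) measurable
  then show ?thesis unfolding mean_def dens_loss[of \<tau>] by (simp add: mult_ac)
qed

lemma mean0_eq: "f \<in> borel_measurable M \<Longrightarrow> mean M \<eta> \<tau>0 f = (\<integral>x. f x \<partial>P0)"
  by (simp add: mean_eq loss_zero)

lemma dens_integrable: "integrable M (dens M \<eta> \<tau>)" "(\<integral>x. dens M \<eta> \<tau> x \<partial>M) = 1"
  using exp_\<eta>_integrable[of \<tau>] norm_const_pos[of \<tau>] unfolding dens_def[abs_def] by auto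

lemma loss_density: "(\<integral>x. exp (- loss v x) \<partial>P0) = 1"
  using mean_eq[of "\<lambda>_. 1" "\<tau>0 + v"] dens_integrable(2)[of "\<tau>0 + v"] by (simp add: mean_def)

text \<open>A function that is not integrable has integral 0 by convention, and this integral is
  1.\<close>

lemma loss_exp_integrable: "integrable P0 (\<lambda>x. exp (- loss v x))"
proof (rule ccontr)
  assume "\<not> integrable P0 (\<lambda>x. exp (- loss v x))"
  then show False using loss_density[of v] by (simp add: not_integrable_integral_eq)
qed

lemma loss_integral: "integrable P0 (loss v)" "(\<integral>x. loss v x \<partial>P0) = A (\<tau>0 + v) - A \<tau>0"
  using P.L20_integrable[OF \<eta>_L20] L20_integral[OF \<eta>_L20]
  unfolding loss_def by auto

lemma crit_loss:
  assumes "1 \<le> n"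
  shows "crit M \<eta> n xs (\<tau>0 + v) - crit M \<eta> n xs \<tau>0 = (\<Sum>i=1..n. loss v (xs i)) / real n"
proof -
  have "(\<Sum>i=1..n. loss v (xs i)) = real n * (A (\<tau>0 + v) - A \<tau>0) - (\<Sum>i=1..n. \<eta> (\<tau>0 + v) (xs i)) + (\<Sum>i=1..n. \<eta> \<tau>0 (xs i))"
    unfolding loss_def by (simp add: sum_subtractf)
  moreover have "real n \<noteq> 0" using assms by simp
  ultimately have "(\<Sum>i=1..n. loss v (xs i)) / real n = A (\<tau>0 + v) - A \<tau>0
     - (\<Sum>i=1..n. \<eta> (\<tau>0 + v) (xs i)) / real n + (\<Sum>i=1..n. \<eta> \<tau>0 (xs i)) / real n"
    by (simp add: add_divide_distrib diff_divide_distrib)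
  then show ?thesis unfolding crit_def A_def[symmetric] by simp
qed

lemma AE_P0_I:
  assumes "AE \<omega> in S. Q (X 1 \<omega>)" and "{x \<in> space M. Q x} \<in> sets M"
  shows "AE x in P0. Q x"
  using assms(1)
  by (simp only: distr_X[OF order_refl, symmetric] AE_distr_iff[OF X_measurable[OF order_refl] assms(2)])

text \<open>For a sample of size 1 the criterion is the loss at \<open>X 1\<close> up to a term free
  of \<open>v\<close>, so convexity of the criterion passes to the loss. The exceptional null set
  may depend on \<open>u\<close>, \<open>v\<close> and \<open>t\<close>, which is why later
  arguments work with countably many points.\<close>

lemma loss_convex:
  assumes "0 \<le> t" "t \<le> 1"
  shows "AE x in P0. loss ((1 - t) *\<^sub>R u + t *\<^sub>R v) x \<le> (1 - t) * loss u x + t * loss v x"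
proof (rule AE_P0_I)
  show "AE \<omega> in S. loss ((1 - t) *\<^sub>R u + t *\<^sub>R v) (X 1 \<omega>) \<le> (1 - t) * loss u (X 1 \<omega>) + t * loss v (X 1 \<omega>)"
    using convex_crit
  proof eventually_elim
    case (elim \<omega>)
    have l: "loss w (X 1 \<omega>) = crit M \<eta> 1 (\<lambda>i. X i \<omega>) (\<tau>0 + w) - crit M \<eta> 1 (\<lambda>i. X i \<omega>) \<tau>0" for w
      using crit_loss[of 1 "\<lambda>i. X i \<omega>" w] by simp
    have "convex_on UNIV (crit M \<eta> 1 (\<lambda>i. X i \<omega>))" using elim by auto
    from convex_onD[OF this assms, of "\<tau>0 + u" "\<tau>0 + v"]
    have "crit M \<eta> 1 (\<lambda>i. X i \<omega>) ((1 - t) *\<^sub>R (\<tau>0 + u) + t *\<^sub>R (\<tau>0 + v))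
       \<le> (1 - t) * crit M \<eta> 1 (\<lambda>i. X i \<omega>) (\<tau>0 + u) + t * crit M \<eta> 1 (\<lambda>i. X i \<omega>) (\<tau>0 + v)" by simp
    moreover have "(1 - t) *\<^sub>R (\<tau>0 + u) + t *\<^sub>R (\<tau>0 + v) = \<tau>0 + ((1 - t) *\<^sub>R u + t *\<^sub>R v)"
      by (simp add: scaleR_add_right scaleR_left_diff_distrib)
    ultimately show ?case unfolding l by (simp add: algebra_simps)
  qed
qed measurable

text \<open>As \<open>\<eta>\<close> is centred under \<open>P0\<close>, the mean of the loss is the
  increment of \<open>A\<close>; integration makes almost sure convexity of the loss into genuine
  convexity of \<open>A\<close>.\<close>

lemma A_convex: "convex_on UNIV A"
proof (rule convex_onI)
  fix t :: real and x y :: "(real ^ 'p) \<times> 'h"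
  assume t: "0 < t" "t < 1"
  define u v where "u = x - \<tau>0" and "v = y - \<tau>0"
  have "(\<integral>z. loss ((1 - t) *\<^sub>R u + t *\<^sub>R v) z \<partial>P0) \<le> (\<integral>z. (1 - t) * loss u z + t * loss v z \<partial>P0)"
    using loss_convex[of t u v] t loss_integral(1) by (intro integral_mono_AE) auto
  also have "\<dots> = (1 - t) * (\<integral>z. loss u z \<partial>P0) + t * (\<integral>z. loss v z \<partial>P0)"
    using loss_integral(1) by simp
  finally have "A (\<tau>0 + ((1 - t) *\<^sub>R u + t *\<^sub>R v)) - A \<tau>0 \<le> (1 - t) * (A x - A \<tau>0) + t * (A y - A \<tau>0)"
    unfolding loss_integral(2) by (simp add: u_def v_def)
  moreover have "\<tau>0 + ((1 - t) *\<^sub>R u + t *\<^sub>R v) = (1 - t) *\<^sub>R x + t *\<^sub>R y"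
    unfolding u_def v_def by (simp add: algebra_simps)
  moreover have "(1 - t) * (A x - A \<tau>0) + t * (A y - A \<tau>0) = (1 - t) * A x + t * A y - A \<tau>0"
    by (simp add: algebra_simps)
  ultimately show "A ((1 - t) *\<^sub>R x + t *\<^sub>R y) \<le> (1 - t) * A x + t * A y"
    by simp
qed simp

lemma \<eta>_differentiable: "x \<in> space M \<Longrightarrow> \<tau> \<in> N \<Longrightarrow> (\<lambda>\<tau>. \<eta> \<tau> x) differentiable (at \<tau>)"
  using a3 by (auto simp: smooth_identifiable_def)

lemma \<eta>_continuous: "x \<in> space M \<Longrightarrow> continuous_on N (\<lambda>\<tau>. \<eta> \<tau> x)"
  by (intro continuous_at_imp_continuous_on ballI differentiable_imp_continuous_within \<eta>_differentiable)

lemma segment_mem: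
  assumes "\<tau> \<in> N" "\<sigma> \<in> N" "t \<in> {0..1}" shows "\<sigma> + t *\<^sub>R (\<tau> - \<sigma>) \<in> N"
proof -
  have "\<sigma> + t *\<^sub>R (\<tau> - \<sigma>) = (1 - t) *\<^sub>R \<sigma> + t *\<^sub>R \<tau>" by (simp add: algebra_simps)
  then show ?thesis using convexD[OF N_convex assms(2,1), of "1 - t" t] assms(3) by simp
qed

text \<open>Finite convex functions on the real line are continuous. Continuity along lines is what
  the comparison of laws by paths requires.\<close>

lemma A_line_continuous: "continuous_on UNIV (\<lambda>t::real. A (\<sigma> + t *\<^sub>R \<delta>))"
proof (rule convex_on_continuous)
  show "convex_on UNIV (\<lambda>t::real. A (\<sigma> + t *\<^sub>R \<delta>))"
  proof (rule convex_onI)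
    fix s x y :: real assume "0 < s" "s < 1"
    then have "A ((1 - s) *\<^sub>R (\<sigma> + x *\<^sub>R \<delta>) + s *\<^sub>R (\<sigma> + y *\<^sub>R \<delta>)) \<le> (1 - s) * A (\<sigma> + x *\<^sub>R \<delta>) + s * A (\<sigma> + y *\<^sub>R \<delta>)"
      by (intro convex_onD[OF A_convex]) auto
    moreover have "(1 - s) *\<^sub>R (\<sigma> + x *\<^sub>R \<delta>) + s *\<^sub>R (\<sigma> + y *\<^sub>R \<delta>) = \<sigma> + ((1 - s) *\<^sub>R x + s *\<^sub>R y) *\<^sub>R \<delta>"
      by (simp add: algebra_simps)
    ultimately show "A (\<sigma> + ((1 - s) *\<^sub>R x + s *\<^sub>R y) *\<^sub>R \<delta>) \<le> (1 - s) * A (\<sigma> + x *\<^sub>R \<delta>) + s * A (\<sigma> + y *\<^sub>R \<delta>)"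
      by simp
  qed simp
qed simp

section \<open>Mutual domination of the laws in the neighbourhood\<close>

definition pr :: "(real ^ 'p) \<times> 'h \<Rightarrow> 'x set \<Rightarrow> real" where
  "pr \<tau> B = mean M \<eta> \<tau> (indicator B)"

lemma pr_bounds:
  assumes [measurable]: "B \<in> sets M" shows "0 \<le> pr \<tau> B" "pr \<tau> B \<le> 1"
proof -
  show "0 \<le> pr \<tau> B" unfolding pr_def mean_def
    by (rule integral_nonneg_AE) (simp add: dens_pos less_imp_le)
  have i: "integrable M (\<lambda>x. indicator B x * dens M \<eta> \<tau> x)"
    using integrable_mult_indicator[OF assms dens_integrable(1)[of \<tau>]] by simp
  have "pr \<tau> B \<le> (\<integral>x. dens M \<eta> \<tau> x \<partial>M)"
    unfolding pr_def mean_def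
    by (rule integral_mono[OF i dens_integrable(1)]) (simp add: mult_left_le_one_le dens_pos less_imp_le)
  then show "pr \<tau> B \<le> 1" by (simp add: dens_integrable)
qed

text \<open>The densities converge pointwise along the segment and all have mass 1, so by Scheffe's
  lemma they converge in mean.\<close>

lemma pr_continuous:
  assumes B [measurable]: "B \<in> sets M" and N: "\<tau> \<in> N" "\<sigma> \<in> N"
  shows "continuous_on {0..1} (\<lambda>t. pr (\<sigma> + t *\<^sub>R (\<tau> - \<sigma>)) B)"
proof (rule continuous_on_sequentiallyI)
  define \<gamma> where "\<gamma> t = \<sigma> + t *\<^sub>R (\<tau> - \<sigma>)" for t
  fix u :: "nat \<Rightarrow> real" and t assume u: "\<forall>n. u n \<in> {0..1}" and t: "t \<in> {0..1}" and lim: "u \<longlonglongrightarrow> t"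
  have \<gamma>N: "\<gamma> s \<in> N" if "s \<in> {0..1}" for s unfolding \<gamma>_def by (rule segment_mem[OF N that])
  have \<gamma>lim: "(\<lambda>n. \<gamma> (u n)) \<longlonglongrightarrow> \<gamma> t" unfolding \<gamma>_def by (intro tendsto_intros lim)
  have Alim: "(\<lambda>n. A (\<gamma> (u n))) \<longlonglongrightarrow> A (\<gamma> t)"
    using A_line_continuous[of \<sigma> "\<tau> - \<sigma>"] lim unfolding \<gamma>_def
    by (auto simp: continuous_on_sequentially o_def)
  have "(\<lambda>n. \<integral>\<^sup>+ x. norm (dens M \<eta> (\<gamma> (u n)) x - dens M \<eta> (\<gamma> t) x) \<partial>M) \<longlonglongrightarrow> 0"
  proof (rule Scheffe_lemma2)
    show "AE x in M. (\<lambda>n. dens M \<eta> (\<gamma> (u n)) x) \<longlonglongrightarrow> dens M \<eta> (\<gamma> t) x"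
    proof (rule AE_I2)
      fix x assume "x \<in> space M"
      then have "(\<lambda>n. \<eta> (\<gamma> (u n)) x) \<longlonglongrightarrow> \<eta> (\<gamma> t) x"
        using \<eta>_continuous[of x] \<gamma>lim \<gamma>N u t by (auto simp: continuous_on_sequentially o_def)
      then show "(\<lambda>n. dens M \<eta> (\<gamma> (u n)) x) \<longlonglongrightarrow> dens M \<eta> (\<gamma> t) x"
        unfolding dens_eq by (intro tendsto_intros Alim)
    qed
    have "(\<integral>\<^sup>+ x. norm (dens M \<eta> \<tau> x) \<partial>M) = 1" for \<tau>
      using nn_integral_eq_integral[OF dens_integrable(1)[of \<tau>]] dens_pos[of \<tau>] dens_integrable(2)[of \<tau>]
      by (simp add: less_imp_le)
    then show "(\<integral>\<^sup>+ x. norm (dens M \<eta> (\<gamma> (u n)) x) \<partial>M) \<le> (\<integral>\<^sup>+ x. norm (dens M \<eta> (\<gamma> t) x) \<partial>M)" for n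
      by simp
  qed (simp_all add: dens_integrable)
  then have lim1: "(\<lambda>n. \<integral>x. norm (dens M \<eta> (\<gamma> (u n)) x - dens M \<eta> (\<gamma> t) x) \<partial>M) \<longlonglongrightarrow> 0"
  proof -
    have eq: "(\<integral>\<^sup>+ x. norm (dens M \<eta> (\<gamma> (u n)) x - dens M \<eta> (\<gamma> t) x) \<partial>M)
       = ennreal (\<integral>x. norm (dens M \<eta> (\<gamma> (u n)) x - dens M \<eta> (\<gamma> t) x) \<partial>M)" for n
      by (rule nn_integral_eq_integral) (auto simp: dens_integrable)
    assume "(\<lambda>n. \<integral>\<^sup>+ x. norm (dens M \<eta> (\<gamma> (u n)) x - dens M \<eta> (\<gamma> t) x) \<partial>M) \<longlonglongrightarrow> 0"
    then have "(\<lambda>n. ennreal (\<integral>x. norm (dens M \<eta> (\<gamma> (u n)) x - dens M \<eta> (\<gamma> t) x) \<partial>M)) \<longlonglongrightarrow> ennreal 0"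
      unfolding eq by simp
    then show ?thesis by (rule tendsto_ennrealD) (auto intro!: integral_nonneg_AE)
  qed
  have "(\<lambda>n. pr (\<gamma> (u n)) B - pr (\<gamma> t) B) \<longlonglongrightarrow> 0"
  proof (rule Lim_null_comparison[OF _ lim1], intro always_eventually allI)
    fix n
    have i: "integrable M (\<lambda>x. indicator B x * dens M \<eta> \<tau> x)" for \<tau>
      using integrable_mult_indicator[OF B dens_integrable(1)[of \<tau>]] by simp
    have "pr (\<gamma> (u n)) B - pr (\<gamma> t) B = (\<integral>x. indicator B x * (dens M \<eta> (\<gamma> (u n)) x - dens M \<eta> (\<gamma> t) x) \<partial>M)"
      unfolding pr_def mean_def using i by (simp add: right_diff_distrib)
    also have "norm \<dots> \<le> (\<integral>x. norm (indicator B x * (dens M \<eta> (\<gamma> (u n)) x - dens M \<eta> (\<gamma> t) x)) \<partial>M)"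
      by (rule integral_norm_bound)
    also have "\<dots> \<le> (\<integral>x. norm (dens M \<eta> (\<gamma> (u n)) x - dens M \<eta> (\<gamma> t) x) \<partial>M)"
      using i by (intro integral_mono) (auto simp: dens_integrable right_diff_distrib indicator_def)
    finally show "norm (pr (\<gamma> (u n)) B - pr (\<gamma> t) B) \<le> (\<integral>x. norm (dens M \<eta> (\<gamma> (u n)) x - dens M \<eta> (\<gamma> t) x) \<partial>M)" .
  qed
  then show "(\<lambda>n. pr (\<sigma> + u n *\<^sub>R (\<tau> - \<sigma>)) B) \<longlonglongrightarrow> pr (\<sigma> + t *\<^sub>R (\<tau> - \<sigma>)) B"
    unfolding \<gamma>_def by (rule LIM_zero_cancel)
qed

lemma indicator_dens_integrable: "B \<in> sets M \<Longrightarrow> integrable M (\<lambda>x. indicator B x * dens M \<eta> \<tau> x)"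
  using integrable_mult_indicator[OF _ dens_integrable(1)[of \<tau>], of B] by simp

text \<open>The shift \<open>q\<close> leaves the variance unchanged. It is taken to be the
  probability under \<open>\<tau>0\<close>, which puts the indicator among the centred functions to
  which the variance comparison applies.\<close>

lemma var_indicator:
  assumes [measurable]: "B \<in> sets M"
  shows "var M \<eta> \<tau> (\<lambda>x. indicator B x - q) = pr \<tau> B * (1 - pr \<tau> B)"
proof -
  have m1: "mean M \<eta> \<tau> (\<lambda>x. indicator B x - q) = pr \<tau> B - q"
    unfolding mean_def pr_def left_diff_distrib
    using indicator_dens_integrable[OF assms] dens_integrable by simp
  have "(indicator B x - q) * (indicator B x - q) * dens M \<eta> \<tau> x
     = (1 - 2 * q) * (indicator B x * dens M \<eta> \<tau> x) + q\<^sup>2 * dens M \<eta> \<tau> x" for x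
    by (auto simp: indicator_def power2_eq_square algebra_simps)
  then have m2: "mean M \<eta> \<tau> (\<lambda>x. (indicator B x - q) * (indicator B x - q)) = (1 - 2 * q) * pr \<tau> B + q\<^sup>2"
    unfolding mean_def pr_def
    using indicator_dens_integrable[OF assms] dens_integrable by simp
  show "var M \<eta> \<tau> (\<lambda>x. indicator B x - q) = pr \<tau> B * (1 - pr \<tau> B)"
    unfolding cov_def m1 m2 by (simp add: power2_eq_square algebra_simps)
qed

lemma indicator_L20:
  assumes [measurable]: "B \<in> sets M"
  shows "(\<lambda>x. indicator B x - pr \<tau>0 B) \<in> L20 P0"
proof -
  have "integrable P0 (indicator B :: _ \<Rightarrow> real)" by (intro P.integrable_const_bound[of _ 1]) auto
  moreover have "integrable P0 (\<lambda>x. (indicator B x - pr \<tau>0 B)\<^sup>2)"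
  proof -
    have "(indicator B x - q)\<^sup>2 = (1 - 2 * q) * indicator B x + q\<^sup>2" for x and q :: real
      by (auto simp: indicator_def power2_eq_square algebra_simps)
    then show ?thesis using calculation by simp
  qed
  moreover have "pr \<tau>0 B = (\<integral>x. indicator B x \<partial>P0)" unfolding pr_def by (rule mean0_eq) simp
  ultimately show ?thesis unfolding L20_def by simp
qed

text \<open>The variance comparison is applied to centred indicators along a segment. In both
  directions the path starts at the law that is to dominate.\<close>

lemma pr_comparable:
  obtains K where "1 \<le> K"
    "\<And>\<tau> B. \<tau> \<in> N \<Longrightarrow> B \<in> sets M \<Longrightarrow> pr \<tau> B \<le> K * pr \<tau>0 B"
    "\<And>\<tau> B. \<tau> \<in> N \<Longrightarrow> B \<in> sets M \<Longrightarrow> pr \<tau>0 B \<le> K * pr \<tau> B"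
proof -
  obtain C3 C4 where C: "0 < C3" "0 < C4"
    and V: "\<And>\<tau> f. \<tau> \<in> N \<Longrightarrow> f \<in> L20 P0 \<Longrightarrow> C3 * var M \<eta> \<tau>0 f \<le> var M \<eta> \<tau> f \<and> var M \<eta> \<tau> f \<le> C4 * var M \<eta> \<tau>0 f"
    using a6 unfolding variance_comparison_def P0_def by blast
  define K where "K = max 1 (max C4 (C4 / C3))"
  have K: "1 \<le> K" "C4 \<le> K" "C4 / C3 \<le> K" unfolding K_def by auto
  have pV: "C3 * (pr \<tau>0 B * (1 - pr \<tau>0 B)) \<le> pr \<tau> B * (1 - pr \<tau> B)"
    "pr \<tau> B * (1 - pr \<tau> B) \<le> C4 * (pr \<tau>0 B * (1 - pr \<tau>0 B))" if "\<tau> \<in> N" "B \<in> sets M" for \<tau> B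
    using V[OF that(1) indicator_L20[OF that(2)]] unfolding var_indicator[OF that(2)] by auto
  have pos: "0 \<le> pr \<tau> B * (1 - pr \<tau> B)" if "B \<in> sets M" for \<tau> B
    using pr_bounds[OF that] by (intro mult_nonneg_nonneg) auto
  have 1: "pr \<tau> B \<le> 8 * K * pr \<tau>0 B" if \<tau>: "\<tau> \<in> N" and B: "B \<in> sets M" for \<tau> B
  proof -
    define p where "p t = pr (\<tau>0 + t *\<^sub>R (\<tau> - \<tau>0)) B" for t
    have "p 1 \<le> 8 * K * p 0"
    proof (rule continuous_path_comparison[OF _ _ K(1)])
      show "continuous_on {0..1} p" unfolding p_def by (rule pr_continuous[OF B \<tau> N_mem])
      fix t :: real assume t: "t \<in> {0..1}"
      show "0 \<le> p t \<and> p t \<le> 1" unfolding p_def using pr_bounds[OF B] by auto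
      have "p t * (1 - p t) \<le> C4 * (p 0 * (1 - p 0))"
        unfolding p_def using pV(2)[OF segment_mem[OF \<tau> N_mem t] B] by simp
      also have "\<dots> \<le> K * (p 0 * (1 - p 0))" using K pos[OF B] unfolding p_def by (intro mult_right_mono) auto
      finally show "p t * (1 - p t) \<le> K * (p 0 * (1 - p 0))" .
    qed
    then show ?thesis unfolding p_def by simp
  qed
  have 2: "pr \<tau>0 B \<le> 8 * K * pr \<tau> B" if \<tau>: "\<tau> \<in> N" and B: "B \<in> sets M" for \<tau> B
  proof -
    define p where "p t = pr (\<tau> + t *\<^sub>R (\<tau>0 - \<tau>)) B" for t
    have "p 1 \<le> 8 * K * p 0"
    proof (rule continuous_path_comparison[OF _ _ K(1)])
      show "continuous_on {0..1} p" unfolding p_def by (rule pr_continuous[OF B N_mem \<tau>])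
      fix t :: real assume t: "t \<in> {0..1}"
      show "0 \<le> p t \<and> p t \<le> 1" unfolding p_def using pr_bounds[OF B] by auto
      \<comment> \<open>Both ends are compared through the variance at \<open>\<tau>0\<close>:
        upwards to the point of the path, downwards to its start \<open>\<tau>\<close>.\<close>
      have "p t * (1 - p t) \<le> C4 * (pr \<tau>0 B * (1 - pr \<tau>0 B))"
        unfolding p_def using pV(2)[OF segment_mem[OF N_mem \<tau> t] B] by simp
      also have "\<dots> \<le> C4 * ((p 0 * (1 - p 0)) / C3)"
        using pV(1)[OF \<tau> B] C unfolding p_def by (intro mult_left_mono) (auto simp: pos_le_divide_eq mult.commute)
      also have "\<dots> = C4 / C3 * (p 0 * (1 - p 0))" by simp
      also have "\<dots> \<le> K * (p 0 * (1 - p 0))" using K pos[OF B] unfolding p_def by (intro mult_right_mono) auto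
      finally show "p t * (1 - p t) \<le> K * (p 0 * (1 - p 0))" .
    qed
    then show ?thesis unfolding p_def by simp
  qed
  show ?thesis by (rule that[of "8 * K"]) (use K 1 2 in auto)
qed

lemma pr_loss: "B \<in> sets M \<Longrightarrow> pr (\<tau>0 + v) B = (\<integral>x. indicator B x * exp (- loss v x) \<partial>P0)"
  unfolding pr_def by (subst mean_eq) auto

lemma pr0: "B \<in> sets M \<Longrightarrow> pr \<tau>0 B = (\<integral>x. indicator B x \<partial>P0)"
  unfolding pr_def by (rule mean0_eq) simp

lemma AE_from_indicator:
  assumes [measurable]: "{x \<in> space M. 0 < f x} \<in> sets M" "f \<in> borel_measurable M" and f: "integrable P0 f"
    and le: "(\<integral>x. indicator {x \<in> space M. 0 < f x} x * f x \<partial>P0) \<le> (0 :: real)"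
  shows "AE x in P0. f x \<le> 0"
proof -
  define g where "g x = indicator {x \<in> space M. 0 < f x} x * f x" for x
  have g0: "0 \<le> g x" for x unfolding g_def by (auto simp: indicator_def)
  have gi: "integrable P0 g"
    unfolding g_def using integrable_mult_indicator[OF _ f, of "{x \<in> space M. 0 < f x}"] by simp
  have "(\<integral>x. g x \<partial>P0) = 0"
    using le g0 unfolding g_def[symmetric] by (intro antisym integral_nonneg_AE) auto
  then have "AE x in P0. g x = 0"
    using gi g0 by (subst (asm) integral_nonneg_eq_0_iff_AE) auto
  then show ?thesis using AE_space
    by eventually_elim (auto simp: g_def indicator_def not_less split: if_splits)
qed

text \<open>Domination on all measurable sets is domination of densities: testing it on the set
  where the ratio exceeds \<open>K\<close> shows that this set is null, and likewise for the inverse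
  ratio.\<close>

lemma loss_bound:
  obtains \<Lambda> where "1 \<le> \<Lambda>" "\<And>v. \<tau>0 + v \<in> N \<Longrightarrow> AE x in P0. \<bar>loss v x\<bar> \<le> \<Lambda>"
proof -
  obtain K where K: "1 \<le> K"
    "\<And>\<tau> B. \<tau> \<in> N \<Longrightarrow> B \<in> sets M \<Longrightarrow> pr \<tau> B \<le> K * pr \<tau>0 B"
    "\<And>\<tau> B. \<tau> \<in> N \<Longrightarrow> B \<in> sets M \<Longrightarrow> pr \<tau>0 B \<le> K * pr \<tau> B"
    by (rule pr_comparable) blast
  define \<Lambda> where "\<Lambda> = max 1 (ln K)"
  have "AE x in P0. \<bar>loss v x\<bar> \<le> \<Lambda>" if v: "\<tau>0 + v \<in> N" for v
  proof -
    note i = loss_exp_integrable[of v]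
    have ii: "integrable P0 (\<lambda>x. indicator B x * exp (- loss v x))" "integrable P0 (indicator B :: _ \<Rightarrow> real)"
      if [measurable]: "B \<in> sets M" for B
      using integrable_mult_indicator[OF _ i, of B] that by (auto intro!: P.integrable_const_bound[of _ 1])
    have "AE x in P0. exp (- loss v x) - K \<le> 0"
    proof (rule AE_from_indicator)
      define B where "B = {x \<in> space M. 0 < exp (- loss v x) - K}"
      have B[measurable]: "B \<in> sets M" unfolding B_def by measurable
      then show "{x \<in> space M. 0 < exp (- loss v x) - K} \<in> sets M" unfolding B_def .
      have "(\<integral>x. indicator B x * (exp (- loss v x) - K) \<partial>P0) = pr (\<tau>0 + v) B - K * pr \<tau>0 B"
        unfolding pr_loss[OF B] pr0[OF B] right_diff_distrib using ii[OF B] by (simp add: mult.commute[of _ K])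
      then show "(\<integral>x. indicator {x \<in> space M. 0 < exp (- loss v x) - K} x * (exp (- loss v x) - K) \<partial>P0) \<le> 0"
        using K(2)[OF v B] unfolding B_def by simp
    qed (use i in auto)
    moreover have "AE x in P0. 1 - K * exp (- loss v x) \<le> 0"
    proof (rule AE_from_indicator)
      define B where "B = {x \<in> space M. 0 < 1 - K * exp (- loss v x)}"
      have B[measurable]: "B \<in> sets M" unfolding B_def by measurable
      then show "{x \<in> space M. 0 < 1 - K * exp (- loss v x)} \<in> sets M" unfolding B_def .
      have "(\<integral>x. indicator B x * (1 - K * exp (- loss v x)) \<partial>P0) = pr \<tau>0 B - K * pr (\<tau>0 + v) B"
        unfolding pr_loss[OF B] pr0[OF B] right_diff_distrib using ii[OF B] by (simp add: mult.left_commute[of _ K])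
      then show "(\<integral>x. indicator {x \<in> space M. 0 < 1 - K * exp (- loss v x)} x * (1 - K * exp (- loss v x)) \<partial>P0) \<le> 0"
        using K(3)[OF v B] unfolding B_def by simp
    qed (use i in auto)
    ultimately show ?thesis
    proof eventually_elim
      case (elim x)
      have "exp (- loss v x) \<le> exp (ln K)" using elim K by simp
      moreover have "exp (- ln K) \<le> exp (- loss v x)"
        using elim K by (simp add: exp_minus field_simps)
      ultimately show ?case unfolding \<Lambda>_def exp_le_cancel_iff by linarith
    qed
  qed
  moreover have "1 \<le> \<Lambda>" unfolding \<Lambda>_def by simp
  ultimately show ?thesis using that by blast
qed

section \<open>Derivatives and the tangent inequality\<close>

lemma D_joint_derivative:
  assumes x: "x \<in> space M" and \<tau>: "\<tau> \<in> N"
  shows "((\<lambda>\<sigma>. \<eta> \<sigma> x) has_derivative (\<lambda>\<delta>. D_joint \<eta> \<tau> \<delta> x)) (at \<tau>)"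
proof -
  obtain F where F: "((\<lambda>\<sigma>. \<eta> \<sigma> x) has_derivative F) (at \<tau>)"
    using \<eta>_differentiable[OF x \<tau>] unfolding differentiable_def by blast
  have F': "((\<lambda>\<sigma>. \<eta> \<sigma> x) has_derivative F) (at (fst \<tau>, snd \<tau>))" using F by simp
  have "((\<lambda>t. \<eta> (t, snd \<tau>) x) has_derivative (\<lambda>\<zeta>. F (\<zeta>, 0))) (at (fst \<tau>))"
    by (rule has_derivative_compose[where f = "\<lambda>t. (t, snd \<tau>)" and x = "fst \<tau>" and s = UNIV, OF _ F'])
       (auto intro!: derivative_eq_intros)
  then have 1: "D_theta \<eta> \<tau> \<zeta> x = F (\<zeta>, 0)" for \<zeta>
    unfolding D_theta_def using frechet_derivative_at by metis
  have "((\<lambda>h. \<eta> (fst \<tau>, h) x) has_derivative (\<lambda>g. F (0, g))) (at (snd \<tau>))"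
    by (rule has_derivative_compose[where f = "\<lambda>h. (fst \<tau>, h)" and x = "snd \<tau>" and s = UNIV, OF _ F'])
       (auto intro!: derivative_eq_intros)
  then have 2: "D_h \<eta> \<tau> g x = F (0, g)" for g
    unfolding D_h_def using frechet_derivative_at by metis
  have "D_joint \<eta> \<tau> \<delta> x = F \<delta>" for \<delta>
  proof -
    have "F \<delta> = F ((fst \<delta>, 0) + (0, snd \<delta>))" by simp
    also have "\<dots> = F (fst \<delta>, 0) + F (0, snd \<delta>)"
      using has_derivative_linear[OF F] by (rule linear_add)
    finally show ?thesis unfolding D_joint_def 1 2 by simp
  qed
  then show ?thesis using F by presburger
qed

lemma D_joint_bounded_linear: "x \<in> space M \<Longrightarrow> \<tau> \<in> N \<Longrightarrow> bounded_linear (\<lambda>\<delta>. D_joint \<eta> \<tau> \<delta> x)"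
  by (rule has_derivative_bounded_linear[OF D_joint_derivative])

lemma D_joint_linear: "x \<in> space M \<Longrightarrow> \<tau> \<in> N \<Longrightarrow> linear (\<lambda>\<delta>. D_joint \<eta> \<tau> \<delta> x)"
  by (rule has_derivative_linear[OF D_joint_derivative])

text \<open>The expansion of order \<open>j = 0\<close> in mean square, transferred to the
  derivative of the pointwise sections by their almost sure agreement.\<close>

lemma D_joint_remainder:
  assumes \<tau>: "\<tau> \<in> N" and \<epsilon>: "0 < \<epsilon>"
    and [measurable]: "\<And>\<delta>. D_joint \<eta> \<tau> \<delta> \<in> borel_measurable M"
  shows "\<exists>d>0. \<forall>v. norm v < d \<and> \<tau> + v \<in> N \<longrightarrow>
     L2_norm P0 (\<lambda>x. \<eta> (\<tau> + v) x - \<eta> \<tau> x - D_joint \<eta> \<tau> v x) \<le> \<epsilon> * norm v"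
proof -
  obtain D where D: "Frechet_Ck_L20 P0 3 N \<eta> D"
    and DJ: "\<And>\<tau> \<delta>. \<tau> \<in> N \<Longrightarrow> AE x in P0. D \<tau> [\<delta>] x = D_joint \<eta> \<tau> \<delta> x"
    using a3 unfolding smooth_identifiable_def P0_def by blast
  have "\<forall>a\<in>N. \<eta> a \<in> L20 P0 \<and> D a [] = \<eta> a"
    using D unfolding Frechet_Ck_L20_def by (elim conjE) assumption
  then have D0: "D \<sigma> [] = \<eta> \<sigma>" if "\<sigma> \<in> N" for \<sigma> using that by blast
  have "\<forall>a\<in>N. \<forall>j<3::nat. \<forall>\<epsilon>>0. \<exists>d>0. \<forall>v. norm v < d \<and> a + v \<in> N \<longrightarrow>
        (\<forall>vs. length vs = j \<longrightarrow>
           L2_norm P0 (\<lambda>x. D (a + v) vs x - D a vs x - D a (v # vs) x)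
             \<le> \<epsilon> * norm v * prod_list (map norm vs))"
    using D unfolding Frechet_Ck_L20_def by (elim conjE) assumption
  from this[rule_format, OF \<tau> _ \<epsilon>, of 0] obtain d where d: "0 < d"
    "\<And>v. norm v < d \<Longrightarrow> \<tau> + v \<in> N \<Longrightarrow> L2_norm P0 (\<lambda>x. D (\<tau> + v) [] x - D \<tau> [] x - D \<tau> [v] x) \<le> \<epsilon> * norm v"
    by auto
  have meas[measurable]: "D \<tau> [v] \<in> borel_measurable M" for v
  proof -
    have "\<forall>a\<in>N. \<forall>vs. length vs < 3 \<longrightarrow> bounded_linear_L20 P0 (\<lambda>v. D a (v # vs))"
      using D unfolding Frechet_Ck_L20_def by (elim conjE) assumption
    from this[rule_format, OF \<tau>, of "[]"] have "bounded_linear_L20 P0 (\<lambda>v. D \<tau> (v # []))" by simp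
    then have "D \<tau> [v] \<in> L20 P0" unfolding bounded_linear_L20_def by blast
    from L20_measurable[OF this] show ?thesis unfolding measurable_cong_sets[OF sets_P0 refl] .
  qed
  show ?thesis
  proof (intro exI[of _ d] conjI allI impI d(1))
    fix v assume v: "norm v < d \<and> \<tau> + v \<in> N"
    have "L2_norm P0 (\<lambda>x. \<eta> (\<tau> + v) x - \<eta> \<tau> x - D_joint \<eta> \<tau> v x) = L2_norm P0 (\<lambda>x. \<eta> (\<tau> + v) x - \<eta> \<tau> x - D \<tau> [v] x)"
      unfolding L2_norm_def
    proof (intro arg_cong[of _ _ sqrt] integral_cong_AE)
      show "AE x in P0. (\<eta> (\<tau> + v) x - \<eta> \<tau> x - D_joint \<eta> \<tau> v x)\<^sup>2 = (\<eta> (\<tau> + v) x - \<eta> \<tau> x - D \<tau> [v] x)\<^sup>2"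
        using DJ[OF \<tau>, of v] by eventually_elim simp
    qed measurable
    also have "\<dots> \<le> \<epsilon> * norm v" using d(2)[of v] v D0 \<tau> by simp
    finally show "L2_norm P0 (\<lambda>x. \<eta> (\<tau> + v) x - \<eta> \<tau> x - D_joint \<eta> \<tau> v x) \<le> \<epsilon> * norm v" .
  qed
qed

text \<open>The integral is the relative entropy of the law at \<open>a\<close> with respect to the
  law at \<open>v\<close>; the tangent of \<open>exp\<close> bounds it below by a difference of two
  masses, both 1.\<close>

lemma kl_nonneg:
  assumes int: "integrable P0 (\<lambda>x. (loss v x - loss a x) * exp (- loss a x))"
  shows "0 \<le> (\<integral>x. (loss v x - loss a x) * exp (- loss a x) \<partial>P0)"
proof -
  have "(\<integral>x. exp (- loss a x) - exp (- loss v x) \<partial>P0) \<le> (\<integral>x. (loss v x - loss a x) * exp (- loss a x) \<partial>P0)"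
  proof (rule integral_mono[OF _ int])
    fix x
    show "exp (- loss a x) - exp (- loss v x) \<le> (loss v x - loss a x) * exp (- loss a x)"
      using exp_tangent[of "- loss a x" "- loss v x"] by (simp add: algebra_simps)
  qed (use loss_exp_integrable in auto)
  then show ?thesis using loss_exp_integrable by (simp add: loss_density)
qed

lemma integrable_mult_exp_loss:
  assumes "integrable P0 f" "\<tau>0 + a \<in> N"
  shows "integrable P0 (\<lambda>x. f x * exp (- loss a x))"
proof -
  obtain \<Lambda> where "AE x in P0. \<bar>loss a x\<bar> \<le> \<Lambda>" using loss_bound assms(2) by metis
  then have bd: "AE x in P0. norm (f x * exp (- loss a x)) \<le> norm (exp \<Lambda> * f x)"
  proof eventually_elim
    case (elim x)
    have "\<bar>f x\<bar> * exp (- loss a x) \<le> \<bar>f x\<bar> * exp \<Lambda>" using elim by (intro mult_left_mono) auto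
    then show ?case by (simp add: abs_mult mult.commute)
  qed
  have [measurable]: "f \<in> borel_measurable M"
    using borel_measurable_integrable[OF assms(1)] unfolding measurable_cong_sets[OF sets_P0 refl] .
  show ?thesis
    by (rule Bochner_Integration.integrable_bound[OF _ _ bd]) (use assms in auto)
qed

lemma integral_exp_loss_le_L2:
  assumes f: "f \<in> L20 P0" and a: "\<tau>0 + a \<in> N" and bd: "AE x in P0. \<bar>loss a x\<bar> \<le> \<Lambda>"
  shows "\<bar>\<integral>x. f x * exp (- loss a x) \<partial>P0\<bar> \<le> exp \<Lambda> * L2_norm P0 f"
proof -
  have fi: "integrable P0 f" by (rule P.L20_integrable[OF f])
  have "\<bar>\<integral>x. f x * exp (- loss a x) \<partial>P0\<bar> \<le> (\<integral>x. \<bar>f x * exp (- loss a x)\<bar> \<partial>P0)"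
    by (rule integral_abs_bound)
  also have "\<dots> \<le> (\<integral>x. exp \<Lambda> * \<bar>f x\<bar> \<partial>P0)"
  proof (rule integral_mono_AE)
    show "AE x in P0. \<bar>f x * exp (- loss a x)\<bar> \<le> exp \<Lambda> * \<bar>f x\<bar>"
      using bd
    proof eventually_elim
      case (elim x)
      have "\<bar>f x\<bar> * exp (- loss a x) \<le> \<bar>f x\<bar> * exp \<Lambda>" using elim by (intro mult_left_mono) auto
      then show ?case by (simp add: abs_mult mult.commute)
    qed
  qed (use fi integrable_mult_exp_loss[OF fi a] in auto)
  also have "\<dots> = exp \<Lambda> * (\<integral>x. \<bar>f x\<bar> \<partial>P0)" by simp
  also have "(\<integral>x. \<bar>f x\<bar> \<partial>P0) \<le> L2_norm P0 f"
  proof -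
    have "0 \<le> P.variance (\<lambda>x. \<bar>f x\<bar>)" by (rule P.variance_positive)
    also have "\<dots> = (\<integral>x. \<bar>f x\<bar>\<^sup>2 \<partial>P0) - (\<integral>x. \<bar>f x\<bar> \<partial>P0)\<^sup>2"
      using fi L20_square_integrable[OF f] by (intro P.variance_eq) auto
    finally show ?thesis unfolding L2_norm_def by (intro real_le_rsqrt) simp
  qed
  finally show ?thesis by simp
qed

text \<open>The log normalizing constant need not be differentiable; nonnegativity of the relative entropy
  bounds its difference quotients from below, which is the direction required here.\<close>

lemma tangent:
  assumes a: "\<tau>0 + a \<in> N" and b: "\<tau>0 + b \<in> N"
    and D_L20: "\<And>\<delta>. D_joint \<eta> (\<tau>0 + a) \<delta> \<in> L20 P0"
  shows "AE x in P0. (\<integral>y. D_joint \<eta> (\<tau>0 + a) (b - a) y * exp (- loss a y) \<partial>P0)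
     - D_joint \<eta> (\<tau>0 + a) (b - a) x \<le> loss b x - loss a x"
proof -
  define w where "w = b - a"
  define \<tau> where "\<tau> = \<tau>0 + a"
  have \<tau>N: "\<tau> \<in> N" unfolding \<tau>_def by (rule a)
  \<comment> \<open>A sequence of step sizes, so that only countably many null sets arise from
    convexity.\<close>
  define t :: "nat \<Rightarrow> real" where "t j = 1 / real (Suc j)" for j
  have t: "0 < t j" "t j \<le> 1" "t \<longlonglongrightarrow> 0" for j
  proof -
    show "t \<longlonglongrightarrow> 0" using LIMSEQ_inverse_real_of_nat unfolding t_def inverse_eq_divide .
  qed (simp_all add: t_def)
  define J where "J f = (\<integral>y. f y * exp (- loss a y) \<partial>P0)" for f
  define Dw where "Dw = D_joint \<eta> \<tau> w"
  define r where "r j x = \<eta> (\<tau> + t j *\<^sub>R w) x - \<eta> \<tau> x - D_joint \<eta> \<tau> (t j *\<^sub>R w) x" for j x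
  define q where "q j x = \<eta> (\<tau> + t j *\<^sub>R w) x - \<eta> \<tau> x" for j x
  obtain \<Lambda> where \<Lambda>: "AE x in P0. \<bar>loss a x\<bar> \<le> \<Lambda>" using loss_bound a by metis
  have D_meas: "D_joint \<eta> \<tau> \<delta> \<in> borel_measurable M" for \<delta>
    using L20_measurable[OF D_L20] unfolding \<tau>_def measurable_cong_sets[OF sets_P0 refl] .
  have mem: "\<tau> + t j *\<^sub>R w \<in> N" for j
    using segment_mem[OF b a, of "t j"] t(1,2)[of j] unfolding \<tau>_def w_def by simp
  have q_L20: "q j \<in> L20 P0" for j
    using P.L20_lincomb[OF \<eta>_L20[of "\<tau> + t j *\<^sub>R w"] \<eta>_L20[of \<tau>], of 1 "-1"] unfolding q_def by simp
  have r_L20: "r j \<in> L20 P0" for j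
    using P.L20_lincomb[OF q_L20[of j] D_L20[of "t j *\<^sub>R w"], of 1 "-1"] unfolding r_def q_def \<tau>_def by simp
  have J_int: "integrable P0 (\<lambda>y. f y * exp (- loss a y))" if "f \<in> L20 P0" for f
    by (rule integrable_mult_exp_loss[OF P.L20_integrable[OF that] a])
  have Dt: "D_joint \<eta> \<tau> (t j *\<^sub>R w) x = t j * Dw x" if "x \<in> space M" for j x
    using linear_cmul[OF D_joint_linear[OF that \<tau>N]] unfolding Dw_def by simp
  have loss_eq: "loss (a + t j *\<^sub>R w) x - loss a x = A (\<tau> + t j *\<^sub>R w) - A \<tau> - q j x" for j x
    unfolding loss_def q_def \<tau>_def by (simp add: add.assoc)
  \<comment> \<open>Relative entropy bounds the increment of \<open>A\<close> from below by the mean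
    increment of \<open>\<eta>\<close> under the law at \<open>a\<close>.\<close>
  have KL: "J (q j) \<le> A (\<tau> + t j *\<^sub>R w) - A \<tau>" for j
  proof -
    define k where "k = A (\<tau> + t j *\<^sub>R w) - A \<tau>"
    have i: "integrable P0 (\<lambda>x. (k - q j x) * exp (- loss a x))"
      unfolding left_diff_distrib using J_int[OF q_L20] loss_exp_integrable by auto
    have "0 \<le> (\<integral>x. (k - q j x) * exp (- loss a x) \<partial>P0)"
      using kl_nonneg[of "a + t j *\<^sub>R w" a] i unfolding loss_eq k_def by simp
    also have "\<dots> = k - J (q j)"
      unfolding left_diff_distrib J_def using J_int[OF q_L20] loss_exp_integrable by (simp add: loss_density)
    finally show ?thesis unfolding k_def by simp
  qed
  have cv: "AE x in P0. \<forall>j. loss ((1 - t j) *\<^sub>R a + t j *\<^sub>R b) x \<le> (1 - t j) * loss a x + t j * loss b x"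
    unfolding AE_all_countable by (intro allI loss_convex less_imp_le t(1) t(2))
  have mid: "(1 - t j) *\<^sub>R a + t j *\<^sub>R b = a + t j *\<^sub>R w" for j
    unfolding w_def by (simp add: algebra_simps)
  have conv: "AE x in P0. \<forall>j. J (q j) / t j - q j x / t j \<le> loss b x - loss a x"
    using cv unfolding mid
  proof eventually_elim
    case (elim x)
    show ?case
    proof
      fix j
      have "loss (a + t j *\<^sub>R w) x - loss a x \<le> t j * (loss b x - loss a x)"
        using elim[rule_format, of j] by (simp add: left_diff_distrib right_diff_distrib)
      then have "J (q j) - q j x \<le> t j * (loss b x - loss a x)"
        unfolding loss_eq using KL[of j] by linarith
      then show "J (q j) / t j - q j x / t j \<le> loss b x - loss a x"
        using t(1)[of j] by (simp add: diff_divide_distrib[symmetric] pos_divide_le_eq mult.commute)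
    qed
  qed
  have qr: "q j x = t j * Dw x + r j x" if "x \<in> space M" for j x
    unfolding q_def r_def Dt[OF that] by simp
  have limx: "(\<lambda>j. q j x / t j) \<longlonglongrightarrow> Dw x" if x: "x \<in> space M" for x
  proof (cases "w = 0")
    case True
    then have "q j x = 0" "Dw x = 0" for j
      using linear_0[OF D_joint_linear[OF x \<tau>N]] by (simp_all add: q_def Dw_def)
    then show ?thesis by simp
  next
    case False
    have "((\<lambda>s. \<eta> (\<tau> + s *\<^sub>R w) x) has_derivative (\<lambda>s. D_joint \<eta> \<tau> (s *\<^sub>R w) x)) (at 0)"
      by (rule has_derivative_compose[where f = "\<lambda>s. \<tau> + s *\<^sub>R w" and x = 0 and s = UNIV])
         (auto intro!: derivative_eq_intros D_joint_derivative x \<tau>N)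
    then have "((\<lambda>s. \<eta> (\<tau> + s *\<^sub>R w) x) has_real_derivative Dw x) (at 0)"
    proof -
      have "(\<lambda>s. D_joint \<eta> \<tau> (s *\<^sub>R w) x) = (*) (Dw x)"
        using linear_cmul[OF D_joint_linear[OF x \<tau>N]] by (auto simp: Dw_def mult.commute)
      then show ?thesis
        using \<open>((\<lambda>s. \<eta> (\<tau> + s *\<^sub>R w) x) has_derivative (\<lambda>s. D_joint \<eta> \<tau> (s *\<^sub>R w) x)) (at 0)\<close>
        unfolding has_field_derivative_def by simp
    qed
    then have "((\<lambda>s. (\<eta> (\<tau> + s *\<^sub>R w) x - \<eta> \<tau> x) / s) \<longlongrightarrow> Dw x) (at 0)"
      unfolding DERIV_def by simp
    moreover have "filterlim t (at 0) sequentially"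
      unfolding filterlim_at using t by (auto intro!: always_eventually simp: less_imp_neq[symmetric])
    ultimately have "((\<lambda>j. (\<eta> (\<tau> + t j *\<^sub>R w) x - \<eta> \<tau> x) / t j) \<longlonglongrightarrow> Dw x)"
      by (rule filterlim_compose)
    then show ?thesis unfolding q_def .
  qed
  \<comment> \<open>The quotients at a fixed \<open>x\<close> converge by pointwise
    differentiability; their mean converges by the expansion in mean square, as the density ratio is
    bounded.\<close>
  have limJ: "(\<lambda>j. J (q j) / t j) \<longlonglongrightarrow> J Dw"
  proof (rule LIMSEQ_I)
    fix e :: real assume e: "0 < e"
    define \<epsilon> where "\<epsilon> = e / (2 * exp \<Lambda> * (norm w + 1))"
    have \<epsilon>: "0 < \<epsilon>" unfolding \<epsilon>_def using e by (intro divide_pos_pos mult_pos_pos) (auto simp: add_nonneg_pos)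
    obtain d where d: "0 < d" "\<And>v. norm v < d \<Longrightarrow> \<tau> + v \<in> N \<Longrightarrow>
       L2_norm P0 (\<lambda>x. \<eta> (\<tau> + v) x - \<eta> \<tau> x - D_joint \<eta> \<tau> v x) \<le> \<epsilon> * norm v"
      using D_joint_remainder[OF \<tau>N \<epsilon> D_meas] by blast
    have "(\<lambda>j. norm (t j *\<^sub>R w)) \<longlonglongrightarrow> norm (0 *\<^sub>R w)" by (intro tendsto_intros t)
    then have "eventually (\<lambda>j. norm (t j *\<^sub>R w) < d) sequentially"
      using d(1) by (intro order_tendstoD) auto
    then obtain n0 where n0: "\<And>j. n0 \<le> j \<Longrightarrow> norm (t j *\<^sub>R w) < d"
      unfolding eventually_sequentially by auto
    have "norm (J (q j) / t j - J Dw) < e" if j: "n0 \<le> j" for j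
    proof -
      have "J (q j) = (\<integral>y. t j * (Dw y * exp (- loss a y)) + r j y * exp (- loss a y) \<partial>P0)"
        unfolding J_def by (intro Bochner_Integration.integral_cong) (auto simp: qr algebra_simps)
      also have "\<dots> = t j * J Dw + J (r j)"
        unfolding J_def using J_int[OF r_L20] J_int[OF D_L20[of w]] by (simp add: Dw_def \<tau>_def)
      finally have "J (q j) / t j - J Dw = J (r j) / t j" using t(1)[of j] by (simp add: add_divide_distrib)
      also have "norm \<dots> \<le> exp \<Lambda> * L2_norm P0 (r j) / t j"
        using integral_exp_loss_le_L2[OF r_L20 a \<Lambda>, of j] t(1)[of j] unfolding J_def
        by (simp add: divide_right_mono)
      also have "\<dots> \<le> exp \<Lambda> * (\<epsilon> * norm (t j *\<^sub>R w)) / t j"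
        using d(2)[OF n0[OF j] mem] t(1)[of j] unfolding r_def by (intro divide_right_mono mult_left_mono) auto
      also have "\<dots> = exp \<Lambda> * \<epsilon> * norm w" using t(1)[of j] by simp
      also have "\<dots> \<le> exp \<Lambda> * \<epsilon> * (norm w + 1)" using \<epsilon> by (intro mult_left_mono) auto
      also have "\<dots> = e / 2"
      proof -
        have "exp \<Lambda> * (norm w + 1) \<noteq> 0" using norm_ge_zero[of w] by (simp add: add_nonneg_eq_0_iff)
        then show ?thesis unfolding \<epsilon>_def by (simp add: mult.commute mult.left_commute)
      qed
      also have "\<dots> < e" using e by simp
      finally show ?thesis .
    qed
    then show "\<exists>n0. \<forall>j\<ge>n0. norm (J (q j) / t j - J Dw) < e" by blast
  qed
  show ?thesis
    using conv AE_space
  proof eventually_elim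
    case (elim x)
    then have x: "x \<in> space M" by simp
    have "J Dw - Dw x \<le> loss b x - loss a x"
      using elim(1) by (intro LIMSEQ_le_const2[OF tendsto_diff[OF limJ limx[OF x]]]) auto
    then show ?case unfolding J_def Dw_def \<tau>_def w_def .
  qed
qed

end

section \<open>Effective dimension and quadratic forms\<close>

text \<open>The mean value theorem for \<open>powr (1 - r)\<close>, a telescoping form of the
  integral test.\<close>

lemma powr_minus_le_telescope:
  assumes "1 < r" "2 \<le> \<nu>"
  shows "real \<nu> powr (- r) \<le> (real (\<nu> - 1) powr (1 - r) - real \<nu> powr (1 - r)) / (r - 1)"
proof -
  have lt: "real (\<nu> - 1) < real \<nu>" "0 < real (\<nu> - 1)" using assms by auto
  have "\<exists>z. real (\<nu> - 1) < z \<and> z < real \<nu> \<and>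
     real \<nu> powr (1 - r) - real (\<nu> - 1) powr (1 - r) = (real \<nu> - real (\<nu> - 1)) * ((1 - r) * z powr (1 - r - 1))"
    using lt by (intro MVT2) (auto intro!: derivative_eq_intros)
  then obtain z where z: "real (\<nu> - 1) < z" "z < real \<nu>"
    "real \<nu> powr (1 - r) - real (\<nu> - 1) powr (1 - r) = (real \<nu> - real (\<nu> - 1)) * ((1 - r) * z powr (1 - r - 1))"
    by blast
  have "real \<nu> - real (\<nu> - 1) = 1" using assms by (simp add: of_nat_diff)
  moreover have "1 - r - 1 = - r" by simp
  ultimately have "real \<nu> powr (1 - r) - real (\<nu> - 1) powr (1 - r) = 1 * ((1 - r) * z powr (- r))"
    using z(3) by (simp only:)
  moreover have "1 * ((1 - r) * z powr (- r)) = - ((r - 1) * z powr (- r))"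
    by (simp add: left_diff_distrib)
  ultimately have e: "real (\<nu> - 1) powr (1 - r) - real \<nu> powr (1 - r) = (r - 1) * z powr (- r)"
    by linarith
  have "real \<nu> powr (- r) \<le> z powr (- r)"
    using z lt assms by (intro powr_mono2') auto
  then show ?thesis unfolding e using assms by simp
qed

lemma sum_powr_tail_le:
  assumes r: "1 < r" and m: "1 \<le> m"
  shows "(\<Sum>\<nu>=Suc m..K. real \<nu> powr (- r)) \<le> real m powr (1 - r) / (r - 1)"
proof (cases "m < K")
  case True
  define h where "h \<nu> = real \<nu> powr (1 - r)" for \<nu> :: nat
  have "(\<Sum>\<nu>=Suc m..K. real \<nu> powr (- r)) \<le> (\<Sum>\<nu>=Suc m..K. (h (\<nu> - 1) - h \<nu>) / (r - 1))"
    unfolding h_def using r m by (intro sum_mono powr_minus_le_telescope) auto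
  also have "\<dots> = (\<Sum>\<nu>=Suc m..K. h (\<nu> - 1) - h \<nu>) / (r - 1)" by (simp add: sum_divide_distrib)
  also have "(\<Sum>\<nu>=Suc m..K. h (\<nu> - 1) - h \<nu>) = h m - h K"
  proof -
    have "m \<le> K" using True by simp
    then show ?thesis by (induction K rule: dec_induct) auto
  qed
  also have "\<dots> / (r - 1) \<le> h m / (r - 1)"
    using r by (intro divide_right_mono) (auto simp: h_def)
  finally show ?thesis unfolding h_def .
qed (use r in auto)

text \<open>The sum is cut near the index \<open>L = l powr (- 1 / r)\<close>, where
  \<open>l * real \<nu> powr r\<close> passes 1. Below it every term is at most 1; above it the
  terms are dominated by a convergent power series whose tail is again of order
  \<open>L\<close>.\<close>

lemma effective_dimension_le:
  assumes r: "1 < r" and \<beta>: "0 < \<beta>" and \<rho>: "\<And>\<nu>. 1 \<le> \<nu> \<Longrightarrow> \<beta> * real \<nu> powr r \<le> \<rho> \<nu>"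
    and l: "0 < l" "l \<le> 1"
  shows "(\<Sum>\<nu>=1..K. 1 / (1 + l * \<rho> \<nu>)) \<le> (1 + 2 powr (r - 1) / (\<beta> * (r - 1))) * l powr (- 1 / r)"
proof -
  define L where "L = l powr (- 1 / r)"
  define m where "m = nat \<lfloor>L\<rfloor>"
  have L1: "1 \<le> L" unfolding L_def using powr_mono2'[of "-1/r" l 1] l r by simp
  have "1 \<le> \<lfloor>L\<rfloor>" using L1 by simp
  \<comment> \<open>As \<open>L \<ge> 1\<close>, rounding down loses at most a factor 2, the source
    of \<open>2 powr (r - 1)\<close>.\<close>
  then have m: "1 \<le> m" "real m \<le> L" "L / 2 \<le> real m" unfolding m_def by linarith+
  have lL: "l = L powr (- r)" unfolding L_def using l r by (simp add: powr_powr)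
  have \<rho>0: "0 \<le> \<rho> \<nu>" if "1 \<le> \<nu>" for \<nu>
    using \<rho>[OF that] \<beta> by (meson less_imp_le mult_nonneg_nonneg order_trans powr_ge_zero)
  have t0: "0 \<le> 1 / (1 + l * \<rho> \<nu>)" "1 / (1 + l * \<rho> \<nu>) \<le> 1" if "1 \<le> \<nu>" for \<nu>
    using \<rho>0[OF that] l by (auto simp: divide_le_eq_1 add_nonneg_pos)
  have tail: "1 / (1 + l * \<rho> \<nu>) \<le> L powr r / \<beta> * real \<nu> powr (- r)" if "1 \<le> \<nu>" for \<nu>
  proof -
    have pos: "0 < l * (\<beta> * real \<nu> powr r)" using l \<beta> that by (intro mult_pos_pos) auto
    have "l * (\<beta> * real \<nu> powr r) \<le> 1 + l * \<rho> \<nu>"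
      using mult_left_mono[OF \<rho>[OF that], of l] l(1) by linarith
    then have "1 / (1 + l * \<rho> \<nu>) \<le> 1 / (l * (\<beta> * real \<nu> powr r))"
      using pos by (intro frac_le) auto
    also have "\<dots> = L powr r / \<beta> * real \<nu> powr (- r)"
      unfolding lL powr_minus by (simp add: divide_inverse)
    finally show ?thesis .
  qed
  have "(\<Sum>\<nu>=1..K. 1 / (1 + l * \<rho> \<nu>)) \<le> (\<Sum>\<nu>\<in>{1..m} \<union> {Suc m..K}. 1 / (1 + l * \<rho> \<nu>))"
    using t0(1) by (intro sum_mono2) auto
  also have "\<dots> = (\<Sum>\<nu>=1..m. 1 / (1 + l * \<rho> \<nu>)) + (\<Sum>\<nu>=Suc m..K. 1 / (1 + l * \<rho> \<nu>))"
    by (intro sum.union_disjoint) auto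
  also have "(\<Sum>\<nu>=1..m. 1 / (1 + l * \<rho> \<nu>)) \<le> (\<Sum>\<nu>=1..m. 1)"
    using t0(2) by (intro sum_mono) auto
  also have "(\<Sum>\<nu>=1..m. 1 :: real) = real m" by simp
  also have "(\<Sum>\<nu>=Suc m..K. 1 / (1 + l * \<rho> \<nu>)) \<le> (\<Sum>\<nu>=Suc m..K. L powr r / \<beta> * real \<nu> powr (- r))"
    by (intro sum_mono tail) auto
  also have "\<dots> = L powr r / \<beta> * (\<Sum>\<nu>=Suc m..K. real \<nu> powr (- r))" by (simp add: sum_distrib_left)
  also have "\<dots> \<le> L powr r / \<beta> * (real m powr (1 - r) / (r - 1))"
    using \<beta> by (intro mult_left_mono sum_powr_tail_le r m) auto
  also have "\<dots> \<le> L powr r / \<beta> * ((L / 2) powr (1 - r) / (r - 1))"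
    using \<beta> r m L1 by (intro mult_left_mono divide_right_mono powr_mono2') auto
  also have "(L / 2) powr (1 - r) = L powr (1 - r) * 2 powr (r - 1)"
  proof -
    have "(L / 2) powr (1 - r) = L powr (1 - r) / 2 powr (1 - r)"
      by (rule powr_divide)
    also have "(2::real) powr (1 - r) = 1 / 2 powr (r - 1)"
      using powr_minus_divide[of 2 "r - 1"] unfolding minus_diff_eq .
    finally show ?thesis by simp
  qed
  also have "L powr r / \<beta> * (L powr (1 - r) * 2 powr (r - 1) / (r - 1)) = (L powr r * L powr (1 - r)) * (2 powr (r - 1) / (\<beta> * (r - 1)))"
    unfolding times_divide_eq_left times_divide_eq_right divide_divide_eq_left mult.assoc ..
  also have "L powr r * L powr (1 - r) = L" using L1 by (simp add: powr_add[symmetric])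
  finally have "(\<Sum>\<nu>=1..K. 1 / (1 + l * \<rho> \<nu>)) \<le> real m + L * (2 powr (r - 1) / (\<beta> * (r - 1)))" by simp
  also have "\<dots> \<le> (1 + 2 powr (r - 1) / (\<beta> * (r - 1))) * L"
  proof -
    have "a + L * d \<le> (1 + d) * L" if "a \<le> L" for a d :: real
      using that by (simp add: algebra_simps)
    from this[OF m(2)] show ?thesis .
  qed
  finally show ?thesis unfolding L_def .
qed

section \<open>Nonnegative symmetric forms\<close>

lemma psd_form_convex:
  fixes Q :: "'a::real_vector \<Rightarrow> 'a \<Rightarrow> real"
  assumes bil: "bilinear Q" and sym: "\<And>x y. Q x y = Q y x" and pos: "\<And>x. 0 \<le> Q x x"
  shows "convex_on UNIV (\<lambda>x. Q x x)"
proof (rule convex_onI)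
  fix t :: real and x y assume t: "0 < t" "t < 1"
  have "Q ((1 - t) *\<^sub>R x + t *\<^sub>R y) ((1 - t) *\<^sub>R x + t *\<^sub>R y)
     = (1 - t) * Q x x + t * Q y y - t * (1 - t) * Q (x - y) (x - y)"
    using sym[of y x]
    by (simp add: bilinear_ladd[OF bil] bilinear_radd[OF bil] bilinear_lsub[OF bil] bilinear_rsub[OF bil]
        bilinear_lmul[OF bil] bilinear_rmul[OF bil] algebra_simps)
  moreover have "0 \<le> t * (1 - t) * Q (x - y) (x - y)" using t pos by simp
  ultimately show "Q ((1 - t) *\<^sub>R x + t *\<^sub>R y) ((1 - t) *\<^sub>R x + t *\<^sub>R y) \<le> (1 - t) * Q x x + t * Q y y"
    by linarith
qed simp

lemma psd_form_triangle:
  fixes Q :: "'a::real_vector \<Rightarrow> 'a \<Rightarrow> real"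
  assumes bil: "bilinear Q" and sym: "\<And>x y. Q x y = Q y x" and pos: "\<And>x. 0 \<le> Q x x"
  shows "Q (x + y) (x + y) \<le> 2 * Q x x + 2 * Q y y" and "Q (x - y) (x - y) \<le> 2 * Q x x + 2 * Q y y"
    and "- Q x x / 2 - 2 * Q y y \<le> 2 * Q x y"
proof -
  have e: "Q (x + y) (x + y) = Q x x + 2 * Q x y + Q y y" "Q (x - y) (x - y) = Q x x - 2 * Q x y + Q y y"
    using sym[of y x]
    by (simp_all add: bilinear_ladd[OF bil] bilinear_radd[OF bil] bilinear_lsub[OF bil] bilinear_rsub[OF bil])
  show "Q (x + y) (x + y) \<le> 2 * Q x x + 2 * Q y y" "Q (x - y) (x - y) \<le> 2 * Q x x + 2 * Q y y"
    using pos[of "x + y"] pos[of "x - y"] unfolding e by linarith+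
  have "0 \<le> Q (x + 2 *\<^sub>R y) (x + 2 *\<^sub>R y)" by (rule pos)
  also have "\<dots> = Q x x + 4 * Q x y + 4 * Q y y"
    using sym[of y x]
    by (simp add: bilinear_ladd[OF bil] bilinear_radd[OF bil] bilinear_lmul[OF bil] bilinear_rmul[OF bil])
  finally show "- Q x x / 2 - 2 * Q y y \<le> 2 * Q x y" by simp
qed

text \<open>Nonnegativity at \<open>x + y\<close> and \<open>x - y\<close> bounds twice the absolute
  value of \<open>Q x y\<close> by \<open>Q x x + Q y y\<close>, so a bound on the diagonal bounds
  the whole form.\<close>

lemma psd_form_continuous:
  fixes Q :: "'a::real_normed_vector \<Rightarrow> 'a \<Rightarrow> real"
  assumes bil: "bilinear Q" and sym: "\<And>x y. Q x y = Q y x" and pos: "\<And>x. 0 \<le> Q x x"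
    and bd: "\<And>x. Q x x \<le> K * (norm x)\<^sup>2"
  shows "continuous_on UNIV (\<lambda>x. Q x x)"
proof -
  have unit: "\<bar>Q x y\<bar> \<le> K" if "norm x = 1" "norm y = 1" for x y
  proof -
    have "0 \<le> Q (x + y) (x + y)" "0 \<le> Q (x - y) (x - y)" by (rule pos)+
    moreover have "Q (x + y) (x + y) = Q x x + 2 * Q x y + Q y y" "Q (x - y) (x - y) = Q x x - 2 * Q x y + Q y y"
      using sym[of y x]
      by (simp_all add: bilinear_ladd[OF bil] bilinear_radd[OF bil] bilinear_lsub[OF bil] bilinear_rsub[OF bil])
    ultimately show ?thesis using bd[of x] bd[of y] that by simp
  qed
  have "bounded_bilinear Q"
  proof (rule bounded_bilinear.intro)
    have "norm (Q x y) \<le> norm x * norm y * K" for x y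
    proof (cases "x = 0 \<or> y = 0")
      case True
      then show ?thesis using bilinear_lzero[OF bil] bilinear_rzero[OF bil] by auto
    next
      case False
      then have "\<bar>Q (sgn x) (sgn y)\<bar> \<le> K" by (intro unit) (auto simp: norm_sgn)
      moreover have "Q x y = norm x * (norm y * Q (sgn x) (sgn y))"
        using False unfolding sgn_div_norm bilinear_lmul[OF bil] bilinear_rmul[OF bil] by (simp add: field_simps)
      ultimately show ?thesis
        by (simp add: abs_mult mult_left_mono mult.assoc)
    qed
    then show "\<exists>K. \<forall>x y. norm (Q x y) \<le> norm x * norm y * K" by blast
  qed (simp_all add: bilinear_ladd[OF bil] bilinear_radd[OF bil] bilinear_lmul[OF bil] bilinear_rmul[OF bil])
  from bounded_bilinear.continuous_on[OF this continuous_on_id continuous_on_id] show ?thesis .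
qed

section \<open>Comparison of the joint variance with a decoupled form\<close>

locale density_ops = density_setup M \<eta> \<tau>0 N S X
  for M :: "'x measure"
    and \<eta> :: "(real ^ 'p) \<times> 'h::{real_inner, complete_space} \<Rightarrow> 'x \<Rightarrow> real"
    and \<tau>0 :: "(real ^ 'p) \<times> 'h"
    and N :: "((real ^ 'p) \<times> 'h) set"
    and S :: "'w measure"
    and X :: "nat \<Rightarrow> 'w \<Rightarrow> 'x" +
  fixes JB :: "'h \<Rightarrow> 'h \<Rightarrow> real"
    and L\<theta> :: "real ^ 'p \<Rightarrow> 'x \<Rightarrow> real"
    and Lh :: "'h \<Rightarrow> 'x \<Rightarrow> real"
    and C1 C2 :: real
  assumes a1: "penalty_form JB"
    and a2: "comparison_operators M \<eta> \<tau>0 JB L\<theta> Lh"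
    and a4: "derivative_comparison M \<eta> \<tau>0 N L\<theta> Lh C1 C2"
begin

definition VB :: "'h \<Rightarrow> 'h \<Rightarrow> real" where
  "VB f g = cov M \<eta> \<tau>0 (Lh f) (Lh g)"

text \<open>A decoupled replacement for the joint variance of \<open>L\<theta>\<close> and
  \<open>Lh\<close>: it is comparable to that variance, and in it the parameter axes and the
  eigenfunctions are jointly orthonormal.\<close>

definition form :: "(real ^ 'p) \<times> 'h \<Rightarrow> (real ^ 'p) \<times> 'h \<Rightarrow> real" where
  "form u v = fst u \<bullet> fst v + VB (snd u) (snd v)"

lemma JB: "bilinear JB" "JB f g = JB g f" "0 \<le> JB g g"
proof -
  note a1' = a1[unfolded penalty_form_def]
  show "bilinear JB" by (rule conjunct1[OF a1'])
  show "JB f g = JB g f" using conjunct1[OF conjunct2[OF a1']] by blast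
  show "0 \<le> JB g g" using conjunct1[OF conjunct2[OF conjunct2[OF a1']]] by blast
qed

lemma L\<theta>_L20: "L\<theta> \<zeta> \<in> L20 P0"
  and L\<theta>_linear: "AE x in P0. L\<theta> (k *\<^sub>R \<zeta> + \<zeta>') x = k * L\<theta> \<zeta> x + L\<theta> \<zeta>' x"
  and Lh_L20: "Lh g \<in> L20 P0"
  and Lh_linear: "AE x in P0. Lh (k *\<^sub>R g + g') x = k * Lh g x + Lh g' x"
proof -
  have 1: "bounded_linear_L20 P0 L\<theta>" "bounded_linear_L20 P0 Lh"
    using a2 unfolding comparison_operators_def P0_def by - (elim conjE, assumption)+
  note 2 = 1(1)[unfolded bounded_linear_L20_def] 1(2)[unfolded bounded_linear_L20_def]
  show "L\<theta> \<zeta> \<in> L20 P0" "Lh g \<in> L20 P0" using conjunct1[OF 2(1)] conjunct1[OF 2(2)] by blast+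
  show "AE x in P0. L\<theta> (k *\<^sub>R \<zeta> + \<zeta>') x = k * L\<theta> \<zeta> x + L\<theta> \<zeta>' x"
    using conjunct1[OF conjunct2[OF 2(1)]] by blast
  show "AE x in P0. Lh (k *\<^sub>R g + g') x = k * Lh g x + Lh g' x"
    using conjunct1[OF conjunct2[OF 2(2)]] by blast
qed

lemma L20_cov:
  assumes f: "f \<in> L20 P0" and g: "g \<in> L20 P0"
  shows "cov M \<eta> \<tau>0 f g = (\<integral>x. f x * g x \<partial>P0)"
proof -
  have [measurable]: "f \<in> borel_measurable M" "g \<in> borel_measurable M"
    using L20_measurable[OF f] L20_measurable[OF g] unfolding measurable_cong_sets[OF sets_P0 refl] .
  show ?thesis unfolding cov_def by (simp add: mean0_eq L20_integral[OF f])
qed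

lemma L20_mult_integrable: "f \<in> L20 P0 \<Longrightarrow> g \<in> L20 P0 \<Longrightarrow> integrable P0 (\<lambda>x. f x * g x)"
  by (rule integrable_mult_of_squares[OF L20_measurable L20_measurable L20_square_integrable L20_square_integrable])

lemma VB_eq: "VB f g = (\<integral>x. Lh f x * Lh g x \<partial>P0)"
  unfolding VB_def by (rule L20_cov[OF Lh_L20 Lh_L20])

lemma VB_sym: "VB f g = VB g f"
  unfolding VB_eq by (simp add: mult.commute)

lemma VB_pos: "0 \<le> VB g g"
  unfolding VB_eq by (rule integral_nonneg_AE) simp

lemma VB_lin: "VB (k *\<^sub>R f + f') g = k * VB f g + VB f' g"
proof -
  have "VB (k *\<^sub>R f + f') g = (\<integral>x. k * (Lh f x * Lh g x) + Lh f' x * Lh g x \<partial>P0)"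
    unfolding VB_eq
  proof (rule integral_cong_AE)
    show "AE x in P0. Lh (k *\<^sub>R f + f') x * Lh g x = k * (Lh f x * Lh g x) + Lh f' x * Lh g x"
      using Lh_linear[of k f f'] by eventually_elim (simp add: algebra_simps)
  qed (use L20_mult_integrable[OF Lh_L20 Lh_L20] in \<open>auto intro!: borel_measurable_integrable Bochner_Integration.integrable_add\<close>)
  also have "\<dots> = k * VB f g + VB f' g"
    unfolding VB_eq using L20_mult_integrable[OF Lh_L20 Lh_L20] by simp
  finally show ?thesis .
qed

lemma VB_bilinear: "bilinear VB"
proof -
  have 0: "VB 0 g = 0" for g using VB_lin[of 1 0 0 g] by simp
  have l: "linear (\<lambda>f. VB f g)" for g
    using VB_lin[of 1 _ _ g] VB_lin[of _ _ 0 g] 0 by (intro linearI) auto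
  then have "linear (VB f)" for f using VB_sym[of f] by (metis (no_types, lifting) ext)
  then show ?thesis unfolding bilinear_def using l by auto
qed

lemma form_bilinear: "bilinear form"
  unfolding bilinear_def form_def
  by (auto intro!: linearI simp: inner_add_left inner_add_right algebra_simps
      bilinear_ladd[OF VB_bilinear] bilinear_radd[OF VB_bilinear] bilinear_lmul[OF VB_bilinear] bilinear_rmul[OF VB_bilinear])

lemma form_sym: "form u v = form v u"
  unfolding form_def by (simp add: inner_commute VB_sym)

lemma form_pos: "0 \<le> form u u"
  unfolding form_def using VB_pos by simp

lemma form_bound:
  obtains K where "\<And>u. form u u \<le> K * (norm u)\<^sup>2" "\<And>g. JB g g \<le> K * (norm g)\<^sup>2"
proof -
  have "\<forall>l>0. \<exists>M1>0. \<exists>M2>0. \<forall>g. M1 * (norm g)\<^sup>2 \<le> var M \<eta> \<tau>0 (Lh g) + l * JB g g \<and>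
        var M \<eta> \<tau>0 (Lh g) + l * JB g g \<le> M2 * (norm g)\<^sup>2"
    using a2 unfolding comparison_operators_def by (elim conjE) assumption
  from this[rule_format, of 1] obtain M2 where M2: "0 < M2" "\<And>g. VB g g + JB g g \<le> M2 * (norm g)\<^sup>2"
    unfolding VB_def by auto
  show ?thesis
  proof (rule that[of "1 + M2"])
    fix u :: "(real ^ 'p) \<times> 'h" and g :: 'h
    have n: "(norm u)\<^sup>2 = (norm (fst u))\<^sup>2 + (norm (snd u))\<^sup>2" by (simp add: norm_prod_def)
    have "form u u \<le> (norm (fst u))\<^sup>2 + M2 * (norm (snd u))\<^sup>2"
      using M2(2)[of "snd u"] JB(3)[of "snd u"] unfolding form_def by (simp add: power2_norm_eq_inner)
    also have "\<dots> \<le> (1 + M2) * (norm u)\<^sup>2"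
      unfolding n using M2(1) by (simp add: algebra_simps)
    finally show "form u u \<le> (1 + M2) * (norm u)\<^sup>2" .
    have "M2 * (norm g)\<^sup>2 \<le> (1 + M2) * (norm g)\<^sup>2" by (intro mult_right_mono) auto
    then show "JB g g \<le> (1 + M2) * (norm g)\<^sup>2" using M2(2)[of g] VB_pos[of g] by linarith
  qed
qed

lemma L_joint_L20: "L_joint L\<theta> Lh \<delta> \<in> L20 P0"
  unfolding L_joint_def[abs_def] using P.L20_lincomb[OF L\<theta>_L20 Lh_L20, of 1 _ 1] by simp

lemma var_L_joint: "var M \<eta> \<tau>0 (L_joint L\<theta> Lh \<delta>) = (\<integral>x. (L_joint L\<theta> Lh \<delta> x)\<^sup>2 \<partial>P0)"
  unfolding L20_cov[OF L_joint_L20 L_joint_L20] power2_eq_square ..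

text \<open>The two components cannot nearly cancel, because \<open>L\<theta> \<zeta>\<close> keeps
  a uniform distance from the range of \<open>Lh\<close> for unit \<open>\<zeta>\<close>. Hence the
  joint variance controls the norm of \<open>\<zeta>\<close>, and then the variance of the
  functional part.\<close>

lemma var_form_equiv:
  obtains k1 k2 where "0 < k1" "0 < k2"
    "\<And>\<delta>. k1 * form \<delta> \<delta> \<le> var M \<eta> \<tau>0 (L_joint L\<theta> Lh \<delta>)"
    "\<And>\<delta>. var M \<eta> \<tau>0 (L_joint L\<theta> Lh \<delta>) \<le> k2 * form \<delta> \<delta>"
proof -
  have "\<exists>c>0. \<forall>\<zeta> g. norm \<zeta> = 1 \<longrightarrow> c < var M \<eta> \<tau>0 (\<lambda>x. L\<theta> \<zeta> x - Lh g x)"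
    using a2 unfolding comparison_operators_def by (elim conjE) assumption
  then obtain c where c: "0 < c" "\<And>\<zeta> g. norm \<zeta> = 1 \<Longrightarrow> c < var M \<eta> \<tau>0 (\<lambda>x. L\<theta> \<zeta> x - Lh g x)" by blast
  obtain b where b: "\<And>\<zeta>. L2_norm P0 (L\<theta> \<zeta>) \<le> b * norm \<zeta>"
  proof -
    have "bounded_linear_L20 P0 L\<theta>"
      using a2 unfolding comparison_operators_def P0_def by (elim conjE)
    then have "\<exists>b. \<forall>\<zeta>. L2_norm P0 (L\<theta> \<zeta>) \<le> b * norm \<zeta>"
      unfolding bounded_linear_L20_def by (elim conjE)
    then show ?thesis using that by blast
  qed
  have T: "(\<integral>x. (L\<theta> \<zeta> x)\<^sup>2 \<partial>P0) \<le> b\<^sup>2 * (norm \<zeta>)\<^sup>2" for \<zeta>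
  proof -
    have i0: "0 \<le> (\<integral>x. (L\<theta> \<zeta> x)\<^sup>2 \<partial>P0)" by (rule integral_nonneg_AE) simp
    have "(L2_norm P0 (L\<theta> \<zeta>))\<^sup>2 \<le> (b * norm \<zeta>)\<^sup>2"
      using b[of \<zeta>] i0 by (intro power_mono) (auto simp: L2_norm_def)
    then show ?thesis using i0 by (simp add: L2_norm_def power_mult_distrib)
  qed
  define V where "V \<delta> = (\<integral>x. (L_joint L\<theta> Lh \<delta> x)\<^sup>2 \<partial>P0)" for \<delta>
  have VBsq: "VB g g = (\<integral>x. (Lh g x)\<^sup>2 \<partial>P0)" for g unfolding VB_eq by (simp add: power2_eq_square)
  note sqi = L20_square_integrable[OF L_joint_L20] L20_square_integrable[OF L\<theta>_L20] L20_square_integrable[OF Lh_L20]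
  have up: "V (\<zeta>, g) \<le> 2 * (\<integral>x. (L\<theta> \<zeta> x)\<^sup>2 \<partial>P0) + 2 * VB g g" for \<zeta> g
  proof -
    have "V (\<zeta>, g) \<le> (\<integral>x. 2 * (L\<theta> \<zeta> x)\<^sup>2 + 2 * (Lh g x)\<^sup>2 \<partial>P0)"
      unfolding V_def
    proof (rule integral_mono)
      fix x show "(L_joint L\<theta> Lh (\<zeta>, g) x)\<^sup>2 \<le> 2 * (L\<theta> \<zeta> x)\<^sup>2 + 2 * (Lh g x)\<^sup>2"
        using zero_le_power2[of "L\<theta> \<zeta> x - Lh g x"] unfolding L_joint_def power2_sum power2_diff by simp
    qed (use sqi in auto)
    also have "\<dots> = 2 * (\<integral>x. (L\<theta> \<zeta> x)\<^sup>2 \<partial>P0) + 2 * VB g g" unfolding VBsq using sqi by simp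
    finally show ?thesis .
  qed
  have lo1: "VB g g \<le> 2 * V (\<zeta>, g) + 2 * (\<integral>x. (L\<theta> \<zeta> x)\<^sup>2 \<partial>P0)" for \<zeta> g
  proof -
    have "VB g g \<le> (\<integral>x. 2 * (L_joint L\<theta> Lh (\<zeta>, g) x)\<^sup>2 + 2 * (L\<theta> \<zeta> x)\<^sup>2 \<partial>P0)"
      unfolding VBsq
    proof (rule integral_mono)
      fix x show "(Lh g x)\<^sup>2 \<le> 2 * (L_joint L\<theta> Lh (\<zeta>, g) x)\<^sup>2 + 2 * (L\<theta> \<zeta> x)\<^sup>2"
        using zero_le_power2[of "2 * L\<theta> \<zeta> x + Lh g x"] unfolding L_joint_def
        by (simp add: power2_eq_square algebra_simps)
    qed (use sqi in auto)
    also have "\<dots> = 2 * V (\<zeta>, g) + 2 * (\<integral>x. (L\<theta> \<zeta> x)\<^sup>2 \<partial>P0)" unfolding V_def using sqi by simp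
    finally show ?thesis .
  qed
  have lo2: "c * (norm \<zeta>)\<^sup>2 \<le> V (\<zeta>, g)" for \<zeta> g
  proof (cases "\<zeta> = 0")
    case True
    then show ?thesis unfolding V_def by (auto intro!: integral_nonneg_AE)
  next
    case False
    define s where "s = norm \<zeta>"
    have s: "0 < s" unfolding s_def using False by simp
    \<comment> \<open>The lower bound is stated for a difference, so \<open>g\<close> enters with
      the opposite sign.\<close>
    define f where "f x = L\<theta> ((1 / s) *\<^sub>R \<zeta>) x - Lh ((- 1 / s) *\<^sub>R g) x" for x
    have f: "f \<in> L20 P0" unfolding f_def using P.L20_lincomb[OF L\<theta>_L20 Lh_L20, of 1 _ "-1"] by simp
    have "norm ((1 / s) *\<^sub>R \<zeta>) = 1" using s unfolding s_def by simp
    from c(2)[OF this, of "(- 1 / s) *\<^sub>R g"] have "c < (\<integral>x. (f x)\<^sup>2 \<partial>P0)"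
      unfolding f_def[symmetric] L20_cov[OF f f] by (simp add: power2_eq_square)
    moreover have "V (\<zeta>, g) = (\<integral>x. s\<^sup>2 * (f x)\<^sup>2 \<partial>P0)"
      unfolding V_def
    proof (rule integral_cong_AE)
      show "(\<lambda>x. (L_joint L\<theta> Lh (\<zeta>, g) x)\<^sup>2) \<in> borel_measurable P0"
        by (rule borel_measurable_integrable[OF sqi(1)])
      show "(\<lambda>x. s\<^sup>2 * (f x)\<^sup>2) \<in> borel_measurable P0"
        using L20_square_integrable[OF f] by auto
      have "AE x in P0. L\<theta> (s *\<^sub>R ((1 / s) *\<^sub>R \<zeta>) + 0) x = s * L\<theta> ((1 / s) *\<^sub>R \<zeta>) x + L\<theta> 0 x"
        by (rule L\<theta>_linear)
      \<comment> \<open>This instance forces \<open>L\<theta> 0\<close> to vanish almost everywhere;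
        linearity is available only up to null sets.\<close>
      moreover have "AE x in P0. L\<theta> (1 *\<^sub>R 0 + 0) x = 1 * L\<theta> 0 x + L\<theta> 0 x" by (rule L\<theta>_linear)
      moreover have "AE x in P0. Lh ((- s) *\<^sub>R ((- 1 / s) *\<^sub>R g) + 0) x = (- s) * Lh ((- 1 / s) *\<^sub>R g) x + Lh 0 x"
        by (rule Lh_linear)
      moreover have "AE x in P0. Lh (1 *\<^sub>R 0 + 0) x = 1 * Lh 0 x + Lh 0 x" by (rule Lh_linear)
      ultimately show "AE x in P0. (L_joint L\<theta> Lh (\<zeta>, g) x)\<^sup>2 = s\<^sup>2 * (f x)\<^sup>2"
      proof eventually_elim
        case (elim x)
        then have "L\<theta> \<zeta> x = s * L\<theta> ((1 / s) *\<^sub>R \<zeta>) x" "Lh g x = - s * Lh ((- 1 / s) *\<^sub>R g) x"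
          using s by auto
        then have "L_joint L\<theta> Lh (\<zeta>, g) x = s * f x" unfolding L_joint_def f_def by (simp add: right_diff_distrib)
        then show ?case by (simp add: power_mult_distrib)
      qed
    qed
    ultimately show ?thesis using s unfolding s_def[symmetric] by (simp add: mult.commute)
  qed
  define k where "k = 1 / c + 2 + 2 * b\<^sup>2 / c"
  have k: "0 < k" unfolding k_def using c by (intro add_pos_nonneg add_pos_pos) auto
  show ?thesis
  proof (rule that[of "1 / k" "2 * b\<^sup>2 + 2"])
    show "0 < 1 / k" "0 < 2 * b\<^sup>2 + 2" using k by (auto simp: add_nonneg_pos)
    fix \<delta> :: "(real ^ 'p) \<times> 'h"
    obtain \<zeta> g where \<delta>: "\<delta> = (\<zeta>, g)" by force
    have fm: "form \<delta> \<delta> = (norm \<zeta>)\<^sup>2 + VB g g" unfolding form_def \<delta> by (simp add: power2_norm_eq_inner)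
    have 1: "(norm \<zeta>)\<^sup>2 \<le> V (\<zeta>, g) / c" using lo2[of \<zeta> g] c by (simp add: pos_le_divide_eq mult.commute)
    have "2 * (\<integral>x. (L\<theta> \<zeta> x)\<^sup>2 \<partial>P0) \<le> 2 * (b\<^sup>2 * (V (\<zeta>, g) / c))"
      using order_trans[OF T mult_left_mono[OF 1, of "b\<^sup>2"]] by simp
    then have "form \<delta> \<delta> \<le> V (\<zeta>, g) / c + 2 * V (\<zeta>, g) + 2 * (b\<^sup>2 * (V (\<zeta>, g) / c))"
      using fm lo1[of g \<zeta>] 1 by linarith
    also have "\<dots> = k * V (\<zeta>, g)" unfolding k_def by (simp add: algebra_simps)
    finally show "1 / k * form \<delta> \<delta> \<le> var M \<eta> \<tau>0 (L_joint L\<theta> Lh \<delta>)"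
      unfolding var_L_joint V_def[symmetric] \<delta> using k by (simp add: pos_divide_le_eq mult.commute)
    have "V (\<zeta>, g) \<le> 2 * (b\<^sup>2 * (norm \<zeta>)\<^sup>2) + 2 * VB g g" using up[of \<zeta> g] T[of \<zeta>] by linarith
    also have "\<dots> \<le> (2 * b\<^sup>2 + 2) * form \<delta> \<delta>"
    proof -
      have "0 \<le> 2 * b\<^sup>2 * VB g g" using VB_pos by simp
      moreover have "(2 * b\<^sup>2 + 2) * form \<delta> \<delta> = 2 * (b\<^sup>2 * (norm \<zeta>)\<^sup>2) + 2 * (norm \<zeta>)\<^sup>2 + 2 * b\<^sup>2 * VB g g + 2 * VB g g"
        unfolding fm by (simp add: algebra_simps)
      ultimately show ?thesis using zero_le_power2[of "norm \<zeta>"] by linarith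
    qed
    finally show "var M \<eta> \<tau>0 (L_joint L\<theta> Lh \<delta>) \<le> (2 * b\<^sup>2 + 2) * form \<delta> \<delta>"
      unfolding var_L_joint V_def[symmetric] \<delta> .
  qed
qed

lemma D_joint_L20:
  assumes "\<tau> \<in> N" shows "D_joint \<eta> \<tau> \<delta> \<in> L20 P0"
proof -
  have "\<forall>\<tau>\<in>N. bounded_linear_L20 P0 (D_theta \<eta> \<tau>) \<and> bounded_linear_L20 P0 (D_h \<eta> \<tau>)"
    using a4 unfolding derivative_comparison_def P0_def by (elim conjE)
  then have "D_theta \<eta> \<tau> \<zeta> \<in> L20 P0" "D_h \<eta> \<tau> g \<in> L20 P0" for \<zeta> g
    using assms unfolding bounded_linear_L20_def by blast+
  from P.L20_lincomb[OF this, of 1 _ 1] show ?thesis unfolding D_joint_def[abs_def] by simp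
qed

lemma D_joint_measurable: "\<tau> \<in> N \<Longrightarrow> D_joint \<eta> \<tau> \<delta> \<in> borel_measurable M"
  using L20_measurable[OF D_joint_L20] unfolding measurable_cong_sets[OF sets_P0 refl] .

lemma C_pos: "0 < C1" "0 < C2"
  using a4 unfolding derivative_comparison_def by - (elim conjE, assumption)+

lemma var_D_joint:
  assumes "\<tau> \<in> N"
  shows "C1 * var M \<eta> \<tau>0 (L_joint L\<theta> Lh \<delta>) \<le> var M \<eta> \<tau>0 (D_joint \<eta> \<tau> \<delta>)"
    and "var M \<eta> \<tau>0 (D_joint \<eta> \<tau> \<delta>) \<le> C2 * var M \<eta> \<tau>0 (L_joint L\<theta> Lh \<delta>)"
proof -
  have "\<forall>\<tau>\<in>N. \<forall>\<delta>. C1 * var M \<eta> \<tau>0 (L_joint L\<theta> Lh \<delta>) \<le> var M \<eta> \<tau>0 (D_joint \<eta> \<tau> \<delta>) \<and>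
        var M \<eta> \<tau>0 (D_joint \<eta> \<tau> \<delta>) \<le> C2 * var M \<eta> \<tau>0 (L_joint L\<theta> Lh \<delta>)"
    using a4 unfolding derivative_comparison_def by (elim conjE)
  then show "C1 * var M \<eta> \<tau>0 (L_joint L\<theta> Lh \<delta>) \<le> var M \<eta> \<tau>0 (D_joint \<eta> \<tau> \<delta>)"
    and "var M \<eta> \<tau>0 (D_joint \<eta> \<tau> \<delta>) \<le> C2 * var M \<eta> \<tau>0 (L_joint L\<theta> Lh \<delta>)"
    using assms by blast+
qed

lemma var_D_joint_eq:
  "\<tau> \<in> N \<Longrightarrow> var M \<eta> \<tau>0 (D_joint \<eta> \<tau> \<delta>) = (\<integral>x. (D_joint \<eta> \<tau> \<delta> x)\<^sup>2 \<partial>P0)"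
  unfolding L20_cov[OF D_joint_L20 D_joint_L20] power2_eq_square ..

lemma centred_second_moment:
  assumes a: "\<tau>0 + a \<in> N" and f: "f \<in> L20 P0"
  shows "(\<integral>x. ((\<integral>y. f y * exp (- loss a y) \<partial>P0) - f x)\<^sup>2 * exp (- loss a x) \<partial>P0) = var M \<eta> (\<tau>0 + a) f"
proof -
  have [measurable]: "f \<in> borel_measurable M"
    using L20_measurable[OF f] unfolding measurable_cong_sets[OF sets_P0 refl] .
  define m where "m = (\<integral>y. f y * exp (- loss a y) \<partial>P0)"
  have i1: "integrable P0 (\<lambda>x. f x * exp (- loss a x))"
    by (rule integrable_mult_exp_loss[OF P.L20_integrable[OF f] a])
  have i2: "integrable P0 (\<lambda>x. (f x)\<^sup>2 * exp (- loss a x))"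
    by (rule integrable_mult_exp_loss[OF L20_square_integrable[OF f] a])
  have e: "(m - f x)\<^sup>2 * exp (- loss a x) = m\<^sup>2 * exp (- loss a x) - 2 * m * (f x * exp (- loss a x)) + (f x)\<^sup>2 * exp (- loss a x)" for x
    by (simp add: power2_eq_square algebra_simps)
  have "(\<integral>x. (m - f x)\<^sup>2 * exp (- loss a x) \<partial>P0) = m\<^sup>2 - 2 * m * m + (\<integral>x. (f x)\<^sup>2 * exp (- loss a x) \<partial>P0)"
    unfolding e using i1 i2 loss_exp_integrable[of a] by (simp add: loss_density m_def[symmetric])
  also have "\<dots> = (\<integral>x. (f x)\<^sup>2 * exp (- loss a x) \<partial>P0) - m * m" by (simp add: power2_eq_square)
  also have "\<dots> = var M \<eta> (\<tau>0 + a) f"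
    unfolding cov_def using mean_eq[of f "\<tau>0 + a"] mean_eq[of "\<lambda>x. f x * f x" "\<tau>0 + a"]
    by (simp add: m_def power2_eq_square)
  finally show ?thesis unfolding m_def .
qed

lemma P_indep: "S.indep_vars (\<lambda>_. P0) X {1..}"
proof -
  have "measurable S P0 = measurable S M" by (rule measurable_cong_sets) auto
  then show ?thesis using indep unfolding S.indep_vars_def2 by simp
qed

text \<open>The upper constant is \<open>C2 * k2\<close>: from the score to the comparison
  operators, and from these to \<open>form\<close>. The lower one is \<open>C3 * C1 * k1\<close>,
  where \<open>C3\<close> also changes the law from \<open>\<tau>0\<close> to the base
  point.\<close>

lemma iid_likelihood_instance:
  obtains \<Lambda> C c where "iid_likelihood P0 loss (\<lambda>a. D_joint \<eta> (\<tau>0 + a)) {v. \<tau>0 + v \<in> N} form \<Lambda> C c S X"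
proof -
  obtain \<Lambda> where \<Lambda>: "1 \<le> \<Lambda>" "\<And>v. \<tau>0 + v \<in> N \<Longrightarrow> AE x in P0. \<bar>loss v x\<bar> \<le> \<Lambda>"
    by (rule loss_bound) blast
  obtain k1 k2 where k: "0 < k1" "0 < k2"
    "\<And>\<delta>. k1 * form \<delta> \<delta> \<le> var M \<eta> \<tau>0 (L_joint L\<theta> Lh \<delta>)"
    "\<And>\<delta>. var M \<eta> \<tau>0 (L_joint L\<theta> Lh \<delta>) \<le> k2 * form \<delta> \<delta>"
    by (rule var_form_equiv) blast
  obtain C3 where C3: "0 < C3"
    "\<And>\<tau> f. \<tau> \<in> N \<Longrightarrow> f \<in> L20 P0 \<Longrightarrow> C3 * var M \<eta> \<tau>0 f \<le> var M \<eta> \<tau> f"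
    using a6 unfolding variance_comparison_def P0_def by blast
  have "iid_likelihood P0 loss (\<lambda>a. D_joint \<eta> (\<tau>0 + a)) {v. \<tau>0 + v \<in> N} form \<Lambda> (C2 * k2) (C3 * C1 * k1) S X"
  proof (intro iid_likelihood.intro convex_likelihood.intro convex_likelihood_axioms.intro
      iid_likelihood_axioms.intro P.prob_space_axioms)
    fix v :: "(real ^ 'p) \<times> 'h" assume v: "v \<in> {v. \<tau>0 + v \<in> N}"
    show "loss v \<in> borel_measurable P0" by measurable
    show "(1 / 2) *\<^sub>R v \<in> {v. \<tau>0 + v \<in> N}"
      using segment_mem[of "\<tau>0 + v" \<tau>0 "1/2"] v N_mem by simp
    show "AE x in P0. \<bar>loss v x\<bar> \<le> \<Lambda>" using \<Lambda>(2) v by simp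
    show "(\<integral>x. exp (- loss v x) \<partial>P0) = 1" by (rule loss_density)
  next
    fix a w :: "(real ^ 'p) \<times> 'h" assume "a \<in> {v. \<tau>0 + v \<in> N}"
    then have a: "\<tau>0 + a \<in> N" by simp
    show "D_joint \<eta> (\<tau>0 + a) w \<in> borel_measurable P0" by (rule L20_measurable[OF D_joint_L20[OF a]])
    show "integrable P0 (\<lambda>x. (D_joint \<eta> (\<tau>0 + a) w x)\<^sup>2)" by (rule L20_square_integrable[OF D_joint_L20[OF a]])
    show "(\<integral>x. D_joint \<eta> (\<tau>0 + a) w x \<partial>P0) = 0" by (rule L20_integral[OF D_joint_L20[OF a]])
    have "(\<integral>x. (D_joint \<eta> (\<tau>0 + a) w x)\<^sup>2 \<partial>P0) \<le> C2 * var M \<eta> \<tau>0 (L_joint L\<theta> Lh w)"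
      using var_D_joint(2)[OF a] unfolding var_D_joint_eq[OF a] .
    also have "\<dots> \<le> C2 * (k2 * form w w)" using k(4) C_pos by (intro mult_left_mono) auto
    finally show "(\<integral>x. (D_joint \<eta> (\<tau>0 + a) w x)\<^sup>2 \<partial>P0) \<le> C2 * k2 * form w w" by (simp add: mult.assoc)
    have "C3 * C1 * k1 * form w w \<le> C3 * (C1 * var M \<eta> \<tau>0 (L_joint L\<theta> Lh w))"
      using mult_left_mono[OF k(3)[of w], of "C3 * C1"] C3 C_pos by (simp add: mult.assoc)
    also have "\<dots> \<le> C3 * var M \<eta> \<tau>0 (D_joint \<eta> (\<tau>0 + a) w)"
      using var_D_joint(1)[OF a] C3 by (intro mult_left_mono) auto
    also have "\<dots> \<le> var M \<eta> (\<tau>0 + a) (D_joint \<eta> (\<tau>0 + a) w)"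
      by (rule C3(2)[OF a D_joint_L20[OF a]])
    also have "\<dots> = (\<integral>x. ((\<integral>y. D_joint \<eta> (\<tau>0 + a) w y * exp (- loss a y) \<partial>P0) - D_joint \<eta> (\<tau>0 + a) w x)\<^sup>2 * exp (- loss a x) \<partial>P0)"
      by (rule centred_second_moment[OF a D_joint_L20[OF a], symmetric])
    finally show "C3 * C1 * k1 * form w w \<le> (\<integral>x. ((\<integral>y. D_joint \<eta> (\<tau>0 + a) w y * exp (- loss a y) \<partial>P0) - D_joint \<eta> (\<tau>0 + a) w x)\<^sup>2 * exp (- loss a x) \<partial>P0)" .
  next
    fix a b :: "(real ^ 'p) \<times> 'h" assume "a \<in> {v. \<tau>0 + v \<in> N}" "b \<in> {v. \<tau>0 + v \<in> N}"
    then have ab: "\<tau>0 + a \<in> N" "\<tau>0 + b \<in> N" by auto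
    show "AE x in P0. (\<integral>y. D_joint \<eta> (\<tau>0 + a) (b - a) y * exp (- loss a y) \<partial>P0) - D_joint \<eta> (\<tau>0 + a) (b - a) x \<le> loss b x - loss a x"
      by (rule tangent[OF ab D_joint_L20[OF ab(1)]])
  next
    fix a x assume "a \<in> {v. \<tau>0 + v \<in> N}" "x \<in> space P0"
    then show "linear (\<lambda>w. D_joint \<eta> (\<tau>0 + a) w x)" using D_joint_linear[of x "\<tau>0 + a"] by simp
  next
    fix i :: nat assume "1 \<le> i"
    have "distr S P0 (X i) = distr S M (X i)" by (rule distr_cong) auto
    then show "distr S P0 (X i) = P0" using distr_X[OF \<open>1 \<le> i\<close>] by simp
  qed (use N_mem loss_zero form_bilinear form_sym form_pos \<Lambda>(1) k C3(1) C_pos P_indep prob in auto)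
  then show ?thesis by (rule that)
qed

end

section \<open>Coordinates adapted to the penalty\<close>

locale density_eigen = density_ops M \<eta> \<tau>0 N S X JB L\<theta> Lh C1 C2
  for M :: "'x measure"
    and \<eta> :: "(real ^ 'p) \<times> 'h::{real_inner, complete_space} \<Rightarrow> 'x \<Rightarrow> real"
    and \<tau>0 :: "(real ^ 'p) \<times> 'h"
    and N :: "((real ^ 'p) \<times> 'h) set"
    and S :: "'w measure"
    and X :: "nat \<Rightarrow> 'w \<Rightarrow> 'x"
    and JB :: "'h \<Rightarrow> 'h \<Rightarrow> real"
    and L\<theta> :: "real ^ 'p \<Rightarrow> 'x \<Rightarrow> real"
    and Lh :: "'h \<Rightarrow> 'x \<Rightarrow> real"
    and C1 C2 :: real +
  fixes \<phi> :: "nat \<Rightarrow> 'h" and \<rho> :: "nat \<Rightarrow> real" and r :: real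
  assumes eigen: "eigensystem (\<lambda>f g. cov M \<eta> \<tau>0 (Lh f) (Lh g)) JB \<phi> \<rho>"
    and a8: "eigenvalue_growth \<rho> r"
begin

definition dim_theta :: nat where "dim_theta = CARD('p)"

definition coord :: "nat \<Rightarrow> 'p" where
  "coord = (SOME f. bij_betw f {..<dim_theta} UNIV)"

text \<open>One orthonormal system for the product space: the axes of the parameter, on which the
  penalty vanishes, followed by the eigenfunctions. \<open>Suc\<close> accounts for eigenfunctions
  being indexed from 1.\<close>

definition \<psi> :: "nat \<Rightarrow> (real ^ 'p) \<times> 'h" where
  "\<psi> i = (if i < dim_theta then (axis (coord i) 1, 0) else (0, \<phi> (Suc (i - dim_theta))))"

definition \<rho>' :: "nat \<Rightarrow> real" where
  "\<rho>' i = (if i < dim_theta then 0 else \<rho> (Suc (i - dim_theta)))"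

definition pen :: "(real ^ 'p) \<times> 'h \<Rightarrow> (real ^ 'p) \<times> 'h \<Rightarrow> real" where
  "pen u v = JB (snd u) (snd v)"

lemma coord_bij: "bij_betw coord {..<dim_theta} UNIV"
proof -
  have "\<exists>f. bij_betw f {..<dim_theta} (UNIV :: 'p set)"
    using ex_bij_betw_nat_finite[of "UNIV :: 'p set"] by (simp add: dim_theta_def atLeast0LessThan)
  then show ?thesis unfolding coord_def by (rule someI_ex)
qed

lemma eigen_facts:
  "1 \<le> \<nu> \<Longrightarrow> 1 \<le> \<mu> \<Longrightarrow> VB (\<phi> \<nu>) (\<phi> \<mu>) = (if \<nu> = \<mu> then 1 else 0)"
  "1 \<le> \<nu> \<Longrightarrow> 1 \<le> \<mu> \<Longrightarrow> JB (\<phi> \<nu>) (\<phi> \<mu>) = (if \<nu> = \<mu> then \<rho> \<nu> else 0)"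
  "1 \<le> \<nu> \<Longrightarrow> 0 \<le> \<rho> \<nu>"
  "closure (span (\<phi> ` {1..})) = UNIV"
  using eigen unfolding eigensystem_def VB_def by auto

lemma r_gt_1: "1 < r"
  using a8 by (simp add: eigenvalue_growth_def)

lemma pen_bilinear: "bilinear pen"
  unfolding bilinear_def pen_def
  by (auto intro!: linearI simp: bilinear_ladd[OF JB(1)] bilinear_radd[OF JB(1)] bilinear_lmul[OF JB(1)] bilinear_rmul[OF JB(1)])

lemma pen_sym: "pen u v = pen v u" unfolding pen_def by (rule JB(2))

lemma pen_pos: "0 \<le> pen u u" unfolding pen_def by (rule JB(3))

lemma VB_zero [simp]: "VB 0 g = 0" "VB g 0 = 0"
  by (rule bilinear_lzero[OF VB_bilinear], rule bilinear_rzero[OF VB_bilinear])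

lemma JB_zero [simp]: "JB 0 g = 0" "JB g 0 = 0"
  by (rule bilinear_lzero[OF JB(1)], rule bilinear_rzero[OF JB(1)])

lemma \<psi>_orth: "form (\<psi> i) (\<psi> j) = (if i = j then 1 else 0)"
proof -
  have inj: "coord i = coord j \<longleftrightarrow> i = j" if "i < dim_theta" "j < dim_theta"
    using bij_betw_imp_inj_on[OF coord_bij] that by (auto simp: inj_on_def)
  show ?thesis
    using inj by (auto simp: form_def \<psi>_def eigen_facts(1) inner_axis_axis)
qed

lemma \<psi>_pen: "pen (\<psi> i) (\<psi> j) = (if i = j then \<rho>' i else 0)"
  by (auto simp: pen_def \<psi>_def \<rho>'_def eigen_facts(2))

lemma \<rho>'_nonneg: "0 \<le> \<rho>' i"
  by (simp add: \<rho>'_def eigen_facts(3))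

lemma effective_dim:
  obtains CT where "1 \<le> CT"
    "\<And>l K. 0 < l \<Longrightarrow> l \<le> 1 \<Longrightarrow> (\<Sum>i<K. 1 / (1 + l * \<rho>' i)) \<le> CT * l powr (- 1 / r)"
proof -
  obtain \<beta>1 \<beta>2 \<kappa> where b: "0 < \<beta>1" "\<And>\<nu>. 1 \<le> \<nu> \<Longrightarrow> \<rho> \<nu> = \<kappa> \<nu> * real \<nu> powr r \<and> \<beta>1 < \<kappa> \<nu> \<and> \<kappa> \<nu> < \<beta>2"
    using a8 unfolding eigenvalue_growth_def by blast
  have b': "\<beta>1 * real \<nu> powr r \<le> \<rho> \<nu>" if "1 \<le> \<nu>" for \<nu>
    using b(2)[OF that] by (auto intro!: mult_right_mono)
  define C where "C = 1 + 2 powr (r - 1) / (\<beta>1 * (r - 1))"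
  have C: "1 \<le> C" unfolding C_def using b(1) r_gt_1 by simp
  have "(\<Sum>i<K. 1 / (1 + l * \<rho>' i)) \<le> (real dim_theta + C) * l powr (- 1 / r)" if l: "0 < l" "l \<le> 1" for l K
  proof -
    have L1: "1 \<le> l powr (- 1 / r)" using powr_mono2'[of "-1/r" l 1] l r_gt_1 by simp
    have pos: "0 \<le> 1 / (1 + l * \<rho>' i)" for i using \<rho>'_nonneg[of i] l by simp
    have "(\<Sum>i<K. 1 / (1 + l * \<rho>' i)) \<le> (\<Sum>i\<in>{..<dim_theta} \<union> {dim_theta..<dim_theta + K}. 1 / (1 + l * \<rho>' i))"
      using pos by (intro sum_mono2) auto
    also have "\<dots> = (\<Sum>i<dim_theta. 1 / (1 + l * \<rho>' i)) + (\<Sum>i=dim_theta..<dim_theta + K. 1 / (1 + l * \<rho>' i))"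
      by (intro sum.union_disjoint) auto
    also have "(\<Sum>i<dim_theta. 1 / (1 + l * \<rho>' i)) = real dim_theta" by (simp add: \<rho>'_def)
    also have "(\<Sum>i=dim_theta..<dim_theta + K. 1 / (1 + l * \<rho>' i)) = (\<Sum>\<nu>=1..K. 1 / (1 + l * \<rho> \<nu>))"
      by (rule sum.reindex_bij_witness[of _ "\<lambda>\<nu>. \<nu> - 1 + dim_theta" "\<lambda>i. Suc (i - dim_theta)"]) (auto simp: \<rho>'_def)
    also have "\<dots> \<le> C * l powr (- 1 / r)"
      unfolding C_def by (rule effective_dimension_le[OF r_gt_1 b(1) b' l])
    \<comment> \<open>Each parameter axis adds 1 to the sum; for \<open>l \<le> 1\<close> these are
      absorbed into the nonparametric order.\<close>
    also have "real dim_theta \<le> real dim_theta * l powr (- 1 / r)" using mult_left_mono[OF L1, of "real dim_theta"] by simp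
    finally show ?thesis by (simp add: distrib_right)
  qed
  moreover have "1 \<le> real dim_theta + C" using C by simp
  ultimately show ?thesis using that by blast
qed

text \<open>The penalty is diagonal in these coordinates. There is equality once the first
  \<open>K\<close> vectors span \<open>v\<close>, and a shorter sum omits nonnegative terms.\<close>

lemma pen_bessel:
  assumes v: "v \<in> span (range \<psi>)"
  shows "(\<Sum>i<K. \<rho>' i * (form v (\<psi> i))\<^sup>2) \<le> pen v v"
proof -
  obtain K0 where "{v} \<subseteq> span (\<psi> ` {..<K0})" using span_range_bounded[of "{v}" \<psi>] v by auto
  moreover have "\<psi> ` {..<K0} \<subseteq> \<psi> ` {..<max K K0}" by (intro image_mono) auto
  ultimately have "v \<in> span (\<psi> ` {..<max K K0})" using span_mono by blast
  define K1 where "K1 = max K K0"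
  have v1: "v \<in> span (\<psi> ` {..<K1})" unfolding K1_def by fact
  define x where "x i = form v (\<psi> i)" for i
  have ve: "v = (\<Sum>i<K1. x i *\<^sub>R \<psi> i)"
    unfolding x_def by (rule orthonormal_expansion[OF form_bilinear \<psi>_orth v1])
  have l1: "linear (\<lambda>u. pen u w)" "linear (\<lambda>u. pen w u)" for w
    using pen_bilinear unfolding bilinear_def by blast+
  have "pen v (\<psi> j) = \<rho>' j * x j" if "j < K1" for j
  proof -
    have "pen v (\<psi> j) = (\<Sum>i<K1. x i * pen (\<psi> i) (\<psi> j))"
      by (subst ve) (simp add: linear_sum[OF l1(1)] linear_cmul[OF l1(1)])
    also have "\<dots> = (\<Sum>i<K1. if i = j then x j * \<rho>' j else 0)"
      by (intro sum.cong) (auto simp: \<psi>_pen)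
    finally show ?thesis using that by (simp add: mult.commute)
  qed
  then have "pen v (\<Sum>i<K1. x i *\<^sub>R \<psi> i) = (\<Sum>i<K1. \<rho>' i * (x i)\<^sup>2)"
    by (simp add: linear_sum[OF l1(2)] linear_cmul[OF l1(2)] power2_eq_square mult_ac)
  then have "pen v v = (\<Sum>i<K1. \<rho>' i * (x i)\<^sup>2)" using ve by simp
  moreover have "(\<Sum>i<K. \<rho>' i * (x i)\<^sup>2) \<le> (\<Sum>i<K1. \<rho>' i * (x i)\<^sup>2)"
    unfolding K1_def using \<rho>'_nonneg by (intro sum_mono2) auto
  ultimately show ?thesis unfolding x_def by simp
qed

text \<open>Rational combinations, so that the set is countable: almost sure statements hold on it
  simultaneously, and reach every point by continuity.\<close>

definition dense :: "((real ^ 'p) \<times> 'h) set" where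
  "dense = range (\<lambda>ps :: (rat \<times> nat) list. \<Sum>(q, i)\<leftarrow>ps. of_rat q *\<^sub>R \<psi> i)"

lemma dense_countable: "countable dense"
  unfolding dense_def by simp

lemma dense_span: "dense \<subseteq> span (range \<psi>)"
proof -
  have "(\<Sum>(q, i)\<leftarrow>ps. of_rat q *\<^sub>R \<psi> i) \<in> span (range \<psi>)" for ps :: "(rat \<times> nat) list"
    by (induction ps) (auto intro!: span_add span_scale span_zero intro: span_base)
  then show ?thesis unfolding dense_def by auto
qed

lemma span_subset_closure_dense: "span (range \<psi>) \<subseteq> closure dense"
proof
  fix v assume "v \<in> span (range \<psi>)"
  then show "v \<in> closure dense"
  proof (induction rule: span_induct_alt)
    case base
    have "0 \<in> dense" unfolding dense_def by (rule range_eqI[of _ _ "[]"]) simp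
    then show ?case by (rule closure_subset[THEN subsetD])
  next
    case (step k x y)
    then obtain i where x: "x = \<psi> i" by auto
    obtain u where u: "\<And>n. u n \<in> dense" "u \<longlonglongrightarrow> y"
      using step.IH unfolding closure_sequential by auto
    have "k \<in> closure \<rat>" by (simp add: Rats_closure_real)
    then obtain q where q: "\<And>n. q n \<in> \<rat>" "q \<longlonglongrightarrow> k" unfolding closure_sequential by auto
    have "q n *\<^sub>R \<psi> i + u n \<in> dense" for n
    proof -
      obtain s where s: "q n = of_rat s" using q(1)[of n] by (auto simp: Rats_def)
      obtain ps :: "(rat \<times> nat) list" where ps: "u n = (\<Sum>(q, i)\<leftarrow>ps. of_rat q *\<^sub>R \<psi> i)"
        using u(1)[of n] unfolding dense_def by auto
      show ?thesis unfolding dense_def s ps by (rule range_eqI[of _ _ "(s, i) # ps"]) simp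
    qed
    moreover have "(\<lambda>n. q n *\<^sub>R \<psi> i + u n) \<longlonglongrightarrow> k *\<^sub>R \<psi> i + y"
      by (intro tendsto_intros q u)
    ultimately show ?case unfolding closure_sequential x
      by (intro exI[of _ "\<lambda>n. q n *\<^sub>R \<psi> i + u n"]) auto
  qed
qed

lemma closure_dense: "closure dense = UNIV"
proof -
  have ax: "(axis a 1, 0) \<in> span (range \<psi>)" for a :: 'p
  proof -
    obtain i where "i < dim_theta" "coord i = a" using coord_bij unfolding bij_betw_def by (metis UNIV_I imageE lessThan_iff)
    then have "(axis a 1, 0) = \<psi> i" by (simp add: \<psi>_def)
    then show ?thesis by (auto intro: span_base)
  qed
  have 1: "(\<zeta>, 0) \<in> span (range \<psi>)" for \<zeta> :: "real ^ 'p"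
  proof -
    have "(\<zeta>, 0 :: 'h) = (\<Sum>a\<in>UNIV. (\<zeta> $ a) *\<^sub>R (axis a 1, 0))"
    proof (rule prod_eqI)
      have "fst (\<Sum>a\<in>UNIV. (\<zeta> $ a) *\<^sub>R (axis a (1::real), 0 :: 'h)) = (\<Sum>a\<in>UNIV. (\<zeta> $ a) *\<^sub>R axis a 1)"
        by (simp add: fst_sum)
      also have "\<dots> = \<zeta>" using basis_expansion[of \<zeta>] by (simp add: scalar_mult_eq_scaleR)
      finally show "fst (\<zeta>, 0 :: 'h) = fst (\<Sum>a\<in>UNIV. (\<zeta> $ a) *\<^sub>R (axis a 1, 0 :: 'h))" by simp
    qed (simp add: snd_sum)
    then show ?thesis by (simp only:) (intro span_sum span_scale ax)
  qed
  have 2: "(0, g) \<in> span (range \<psi>)" if "g \<in> span (\<phi> ` {1..})" for g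
    using that
  proof (induction rule: span_induct_alt)
    case base
    have "(0, 0) = (0 :: (real ^ 'p) \<times> 'h)" by (simp add: zero_prod_def)
    then show ?case by (metis span_zero)
  next
    case (step k x y)
    then obtain \<nu> where \<nu>: "1 \<le> \<nu>" "x = \<phi> \<nu>" by auto
    have "\<psi> (\<nu> - 1 + dim_theta) = (0, x)" using \<nu> by (simp add: \<psi>_def)
    then have "(0, x) \<in> span (range \<psi>)" by (metis rangeI span_base)
    then have "k *\<^sub>R (0, x) + (0, y) \<in> span (range \<psi>)" using step.IH by (intro span_add span_scale) auto
    then show ?case by simp
  qed
  have "UNIV \<times> span (\<phi> ` {1..}) \<subseteq> span (range \<psi>)"
  proof
    fix u :: "(real ^ 'p) \<times> 'h" assume "u \<in> UNIV \<times> span (\<phi> ` {1..})"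
    then have "(fst u, 0) + (0, snd u) \<in> span (range \<psi>)" by (intro span_add 1 2) auto
    then show "u \<in> span (range \<psi>)" by simp
  qed
  then have "UNIV \<times> span (\<phi> ` {1..}) \<subseteq> closure dense" using span_subset_closure_dense by blast
  then have "closure (UNIV \<times> span (\<phi> ` {1..})) \<subseteq> closure dense" by (rule closure_minimal) simp
  then show ?thesis unfolding closure_Times eigen_facts(4) by auto
qed

lemma dense_sequence:
  obtains u where "\<And>n. u n \<in> dense" "u \<longlonglongrightarrow> v"
  using closure_dense unfolding closure_sequential[symmetric] by (metis UNIV_I closure_sequential)

lemma form_continuous: "continuous_on UNIV (\<lambda>u. form u u)"
proof -
  obtain K where "\<And>u. form u u \<le> K * (norm u)\<^sup>2" using form_bound by metis
  from psd_form_continuous[OF form_bilinear form_sym form_pos this] show ?thesis .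
qed

lemma pen_continuous: "continuous_on UNIV (\<lambda>u. pen u u)"
proof -
  obtain K where "\<And>g. JB g g \<le> K * (norm g)\<^sup>2" using form_bound by metis
  from psd_form_continuous[OF JB(1) JB(2) JB(3) this] have "continuous_on UNIV (\<lambda>g. JB g g)" .
  then have "continuous_on UNIV (\<lambda>u :: (real ^ 'p) \<times> 'h. JB (snd u) (snd u))"
    by (rule continuous_on_compose2) (auto intro: continuous_on_snd continuous_on_id)
  then show ?thesis unfolding pen_def .
qed

end

section \<open>Rates of convergence\<close>

locale density_eigen_iid = density_eigen M \<eta> \<tau>0 N S X JB L\<theta> Lh C1 C2 \<phi> \<rho> r
  for M :: "'x measure"
    and \<eta> :: "(real ^ 'p) \<times> 'h::{real_inner, complete_space} \<Rightarrow> 'x \<Rightarrow> real"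
    and \<tau>0 :: "(real ^ 'p) \<times> 'h"
    and N :: "((real ^ 'p) \<times> 'h) set"
    and S :: "'w measure"
    and X :: "nat \<Rightarrow> 'w \<Rightarrow> 'x"
    and JB :: "'h \<Rightarrow> 'h \<Rightarrow> real"
    and L\<theta> :: "real ^ 'p \<Rightarrow> 'x \<Rightarrow> real"
    and Lh :: "'h \<Rightarrow> 'x \<Rightarrow> real"
    and C1 C2 :: real
    and \<phi> :: "nat \<Rightarrow> 'h" and \<rho> :: "nat \<Rightarrow> real" and r :: real +
  fixes \<Lambda> C c CT :: real
  assumes iid: "iid_likelihood P0 loss (\<lambda>a. D_joint \<eta> (\<tau>0 + a)) {v. \<tau>0 + v \<in> N} form \<Lambda> C c S X"
    and CT: "1 \<le> CT"
    and eff: "\<And>l K. 0 < l \<Longrightarrow> l \<le> 1 \<Longrightarrow> (\<Sum>i<K. 1 / (1 + l * \<rho>' i)) \<le> CT * l powr (- 1 / r)"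
begin

sublocale L: iid_likelihood P0 loss "\<lambda>a. D_joint \<eta> (\<tau>0 + a)" "{v. \<tau>0 + v \<in> N}" form \<Lambda> C c S X
  by (rule iid)

definition sqnorm :: "real \<Rightarrow> (real ^ 'p) \<times> 'h \<Rightarrow> real" where
  "sqnorm l v = form v v + l * pen v v"

definition eff_dim :: "real \<Rightarrow> real" where
  "eff_dim l = CT * l powr (- 1 / r)"

definition rate :: "nat \<Rightarrow> real \<Rightarrow> real" where
  "rate n l = inverse (real n) * l powr (- 1 / r) + l"

lemma sqnorm_nonneg: "0 \<le> l \<Longrightarrow> 0 \<le> sqnorm l v"
  unfolding sqnorm_def using form_pos pen_pos by simp

lemma sqnorm_continuous: "continuous_on UNIV (sqnorm l)"
  unfolding sqnorm_def[abs_def] by (intro continuous_intros form_continuous pen_continuous)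

lemma sqnorm_tendsto: "u \<longlonglongrightarrow> v \<Longrightarrow> (\<lambda>k. sqnorm l (u k)) \<longlonglongrightarrow> sqnorm l v"
  by (rule continuous_on_tendsto_compose[OF sqnorm_continuous]) auto

lemma sqnorm_scaleR: "sqnorm l (t *\<^sub>R v) = t\<^sup>2 * sqnorm l v"
  unfolding sqnorm_def
  by (simp add: bilinear_lmul[OF form_bilinear] bilinear_rmul[OF form_bilinear]
      bilinear_lmul[OF pen_bilinear] bilinear_rmul[OF pen_bilinear] power2_eq_square algebra_simps)

lemma eff_dim_ge_1: assumes "0 < l" "l \<le> 1" shows "1 \<le> eff_dim l"
proof -
  have "1 \<le> l powr (- 1 / r)" using powr_mono2'[of "-1/r" l 1] assms r_gt_1 by simp
  from mult_mono[OF CT this] show ?thesis unfolding eff_dim_def using CT by simp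
qed

lemma rate_pos: "1 \<le> n \<Longrightarrow> 0 < l \<Longrightarrow> 0 < rate n l"
  unfolding rate_def by (intro add_nonneg_pos) auto

lemma eff_dim_rate: assumes "0 < l" shows "eff_dim l / real n \<le> CT * rate n l"
proof -
  have "eff_dim l / real n = CT * (inverse (real n) * l powr (- 1 / r))"
    unfolding eff_dim_def by (simp add: divide_inverse)
  also have "\<dots> \<le> CT * rate n l" unfolding rate_def using CT assms by (intro mult_left_mono) auto
  finally show ?thesis .
qed

lemma X_space: "\<omega> \<in> space S \<Longrightarrow> 1 \<le> i \<Longrightarrow> X i \<omega> \<in> space M"
  using measurable_space[OF X_measurable] by auto

text \<open>For a fixed sample both sides are continuous in \<open>v\<close>, so the bound passes
  from finite combinations of the basis to all directions. It is used for the rough part of the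
  sphere and for the quadratic criterion.\<close>

lemma score_event:
  assumes n: "1 \<le> n" and l: "0 < l" "l \<le> 1" and \<epsilon>: "0 < \<epsilon>"
  shows "\<exists>E\<in>sets S. measure S E \<le> \<epsilon> \<and> (\<forall>\<omega>\<in>space S - E. \<forall>v.
    (\<Sum>j=1..n. D_joint \<eta> \<tau>0 v (X j \<omega>))\<^sup>2 \<le> real n * C * eff_dim l / \<epsilon> * sqnorm l v)"
proof -
  have \<tau>: "0 \<le> l * \<rho>' i" for i using l \<rho>'_nonneg by simp
  have U: "0 \<le> real n * C * eff_dim l / \<epsilon>" using L.C0 eff_dim_ge_1[OF l] \<epsilon> by simp
  obtain E where E: "E \<in> sets S" "measure S E \<le> \<epsilon>"
    "\<And>\<omega> K v. \<omega> \<in> space S - E \<Longrightarrow> v \<in> span (\<psi> ` {..<K}) \<Longrightarrow>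
    (\<Sum>j=1..n. D_joint \<eta> (\<tau>0 + 0) v (X j \<omega>))\<^sup>2 \<le> real n * C * eff_dim l / \<epsilon> * (\<Sum>i<K. (1 + l * \<rho>' i) * (form v (\<psi> i))\<^sup>2)"
    using L.score_bound[OF \<psi>_orth \<tau> eff[OF l, folded eff_dim_def] eff_dim_ge_1[OF l] n \<epsilon>] by blast
  have span: "(\<Sum>j=1..n. D_joint \<eta> \<tau>0 v (X j \<omega>))\<^sup>2 \<le> real n * C * eff_dim l / \<epsilon> * sqnorm l v"
    if \<omega>: "\<omega> \<in> space S - E" and v: "v \<in> span (range \<psi>)" for \<omega> v
  proof -
    obtain K where "{v} \<subseteq> span (\<psi> ` {..<K})" using span_range_bounded[of "{v}" \<psi>] v by auto
    then have vK: "v \<in> span (\<psi> ` {..<K})" by simp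
    have "(\<Sum>i<K. (1 + l * \<rho>' i) * (form v (\<psi> i))\<^sup>2) = (\<Sum>i<K. (form v (\<psi> i))\<^sup>2) + l * (\<Sum>i<K. \<rho>' i * (form v (\<psi> i))\<^sup>2)"
      by (simp add: distrib_right sum.distrib sum_distrib_left mult.assoc)
    also have "(\<Sum>i<K. (form v (\<psi> i))\<^sup>2) = form v v"
      by (rule orthonormal_parseval[OF form_bilinear \<psi>_orth vK, symmetric])
    also have "form v v + l * (\<Sum>i<K. \<rho>' i * (form v (\<psi> i))\<^sup>2) \<le> sqnorm l v"
      unfolding sqnorm_def using pen_bessel[OF v] l by (intro add_left_mono mult_left_mono) auto
    finally show ?thesis
      using E(3)[OF \<omega> vK] U by (simp only: add_0_right) (meson mult_left_mono order_trans)
  qed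
  show ?thesis
  proof (intro bexI[of _ E] conjI ballI allI E)
    fix \<omega> v assume \<omega>: "\<omega> \<in> space S - E"
    obtain u where u: "\<And>k. u k \<in> dense" "u \<longlonglongrightarrow> v" using dense_sequence[of v] by blast
    have lim1: "(\<lambda>k. \<Sum>j=1..n. D_joint \<eta> \<tau>0 (u k) (X j \<omega>)) \<longlonglongrightarrow> (\<Sum>j=1..n. D_joint \<eta> \<tau>0 v (X j \<omega>))"
    proof (intro tendsto_sum)
      fix j assume "j \<in> {1..n}"
      then have "X j \<omega> \<in> space M" using X_space[of \<omega> j] \<omega> by auto
      from bounded_linear.tendsto[OF D_joint_bounded_linear[OF this N_mem] u(2)]
      show "(\<lambda>k. D_joint \<eta> \<tau>0 (u k) (X j \<omega>)) \<longlonglongrightarrow> D_joint \<eta> \<tau>0 v (X j \<omega>)" .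
    qed
    have lim2: "(\<lambda>k. sqnorm l (u k)) \<longlonglongrightarrow> sqnorm l v"
      by (rule sqnorm_tendsto[OF u(2)])
    have le: "(\<Sum>j=1..n. D_joint \<eta> \<tau>0 (u k) (X j \<omega>))\<^sup>2 \<le> real n * C * eff_dim l / \<epsilon> * sqnorm l (u k)" for k
      using span[OF \<omega>] u(1) dense_span by blast
    show "(\<Sum>j=1..n. D_joint \<eta> \<tau>0 v (X j \<omega>))\<^sup>2 \<le> real n * C * eff_dim l / \<epsilon> * sqnorm l v"
      by (rule LIMSEQ_le[OF tendsto_power[OF lim1] tendsto_mult_left[OF lim2]]) (use le in blast)
  qed
qed

text \<open>\<open>A\<close> is convex, and bounded on the open set \<open>N\<close> since its
  increments are means of bounded losses; in a normed space this implies continuity.\<close>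

lemma A_continuous: "continuous_on N A"
proof -
  have bd: "\<bar>A \<tau>\<bar> \<le> \<Lambda> + \<bar>A \<tau>0\<bar>" if "\<tau> \<in> N" for \<tau>
  proof -
    have "AE x in P0. \<bar>loss (\<tau> - \<tau>0) x\<bar> \<le> \<Lambda>" using L.l_bounded[of "\<tau> - \<tau>0"] that by simp
    then have "(\<integral>x. \<bar>loss (\<tau> - \<tau>0) x\<bar> \<partial>P0) \<le> (\<integral>x. \<Lambda> \<partial>P0)"
      using loss_integral(1) by (intro integral_mono_AE) auto
    with integral_abs_bound have "\<bar>\<integral>x. loss (\<tau> - \<tau>0) x \<partial>P0\<bar> \<le> (\<integral>x. \<Lambda> \<partial>P0)"
      by (rule order_trans)
    then have "\<bar>\<integral>x. loss (\<tau> - \<tau>0) x \<partial>P0\<bar> \<le> \<Lambda>" by simp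
    then show ?thesis unfolding loss_integral(2) by simp
  qed
  show ?thesis
  proof (rule convex_on_bounded_continuous[OF N_open])
    show "convex_on N A" by (rule convex_on_subset[OF A_convex _ N_convex]) simp
    show "\<forall>\<tau>\<in>N. \<bar>A \<tau>\<bar> \<le> \<Lambda> + \<bar>A \<tau>0\<bar>" using bd by blast
  qed
qed

lemma pen_crit_continuous:
  assumes \<omega>: "\<omega> \<in> space S"
  shows "continuous_on N (pen_crit M \<eta> JB l n (\<lambda>i. X i \<omega>))"
proof -
  have "continuous_on N (\<lambda>\<tau>. pen \<tau> \<tau>)" by (rule continuous_on_subset[OF pen_continuous]) simp
  then show ?thesis
    unfolding pen_crit_def crit_def A_def[symmetric] pen_def[symmetric]
    by (intro continuous_intros A_continuous \<eta>_continuous X_space[OF \<omega>]) auto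
qed

text \<open>The cross term between \<open>v\<close> and \<open>\<tau>0\<close> is absorbed by half
  of the penalty of \<open>v\<close>; what it leaves, \<open>l * pen \<tau>0 \<tau>0\<close>, is the
  bias.\<close>

lemma pen_crit_diff:
  assumes "1 \<le> n" "0 < l"
  shows "(\<Sum>i=1..n. loss v (X i \<omega>)) / real n + l / 4 * pen v v - l * pen \<tau>0 \<tau>0
     \<le> pen_crit M \<eta> JB l n (\<lambda>i. X i \<omega>) (\<tau>0 + v) - pen_crit M \<eta> JB l n (\<lambda>i. X i \<omega>) \<tau>0"
proof -
  have "pen (\<tau>0 + v) (\<tau>0 + v) = pen \<tau>0 \<tau>0 + 2 * pen v \<tau>0 + pen v v"
    using pen_sym[of v \<tau>0] by (simp add: bilinear_ladd[OF pen_bilinear] bilinear_radd[OF pen_bilinear])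
  then have "pen v v / 2 - 2 * pen \<tau>0 \<tau>0 \<le> pen (\<tau>0 + v) (\<tau>0 + v) - pen \<tau>0 \<tau>0"
    using psd_form_triangle(3)[OF pen_bilinear pen_sym pen_pos, of v \<tau>0] by linarith
  from mult_left_mono[OF this, of "l / 2"]
  have "l / 4 * pen v v - l * pen \<tau>0 \<tau>0 \<le> l / 2 * pen (\<tau>0 + v) (\<tau>0 + v) - l / 2 * pen \<tau>0 \<tau>0"
    using assms by (simp add: right_diff_distrib)
  then show ?thesis
    using crit_loss[OF assms(1), of "\<lambda>i. X i \<omega>" v] unfolding pen_crit_def pen_def by linarith
qed

text \<open>At the true parameter the drift vanishes, the score being centred there.\<close>

lemma tangent_at_zero:
  "AE \<omega> in S. \<forall>u\<in>dense. \<tau>0 + u \<in> N \<longrightarrow> (\<forall>i\<ge>1. - D_joint \<eta> \<tau>0 u (X i \<omega>) \<le> loss u (X i \<omega>))"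
proof -
  have "AE \<omega> in S. \<tau>0 + u \<in> N \<longrightarrow> (\<forall>i\<ge>1. - D_joint \<eta> \<tau>0 u (X i \<omega>) \<le> loss u (X i \<omega>))" for u
  proof (cases "\<tau>0 + u \<in> N")
    case True
    have "AE x in P0. - D_joint \<eta> \<tau>0 u x \<le> loss u x"
      using L.tangent[of 0 u] True N_mem by (simp add: loss_zero L20_integral[OF D_joint_L20[OF N_mem]])
    from L.X_AE[OF this] show ?thesis by simp
  qed simp
  then show ?thesis by (simp add: AE_ball_countable[OF dense_countable])
qed

text \<open>On the sphere \<open>sqnorm l v = R * rate n l\<close> either the penalty carries a fixed fraction of the norm and
  beats the tangent of the likelihood at \<open>\<tau>0\<close>, or \<open>v\<close> is smooth enough for the uniform lower bound.\<close>

lemma lower_event: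
  assumes \<epsilon>: "0 < \<epsilon>" "\<epsilon> \<le> 1"
  shows "\<exists>R>0. \<forall>n l. 1 \<le> n \<longrightarrow> 0 < l \<longrightarrow> l \<le> 1 \<longrightarrow> (\<exists>E\<in>sets S. measure S E \<le> \<epsilon> \<and>
    (\<forall>\<omega>\<in>space S - E. \<forall>v. \<tau>0 + v \<in> N \<longrightarrow> sqnorm l v = R * rate n l \<longrightarrow>
      pen_crit M \<eta> JB l n (\<lambda>i. X i \<omega>) \<tau>0 < pen_crit M \<eta> JB l n (\<lambda>i. X i \<omega>) (\<tau>0 + v)))"
proof -
  define ch where "ch = L.c_hell"
  define cl where "cl = L.c_loss"
  have ch: "0 < ch" unfolding ch_def by (rule L.c_hell_pos)
  have cl: "0 < cl" unfolding cl_def by (rule L.c_loss_pos)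
  define j0 where "j0 = pen \<tau>0 \<tau>0"
  have j0: "0 \<le> j0" unfolding j0_def by (rule pen_pos)
  \<comment> \<open>The mesh \<open>s\<close> and the smoothness level \<open>\<kappa>\<close> are
    chosen to make the loss between net and point,
    \<open>cl * (2 * s\<^sup>2 + 8 * \<kappa>) * \<Gamma>\<close>, at most
    \<open>ch / 32 * \<Gamma>\<close>.\<close>
  define s where "s = min 1 (sqrt (ch / (128 * cl)))"
  have s: "0 < s" "s \<le> 1" unfolding s_def using ch cl by auto
  have s2: "2 * s\<^sup>2 * cl \<le> ch / 64"
  proof -
    have "s\<^sup>2 \<le> (sqrt (ch / (128 * cl)))\<^sup>2" using s unfolding s_def by (intro power_mono) auto
    also have "\<dots> = ch / (128 * cl)" using ch cl by simp
    finally have "2 * cl * s\<^sup>2 \<le> 2 * cl * (ch / (128 * cl))" using cl by (intro mult_left_mono) auto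
    also have "\<dots> = ch / 64" using cl by simp
    finally show ?thesis by (simp add: mult_ac)
  qed
  define \<kappa> where "\<kappa> = min (1 / 4) (ch / (512 * cl))"
  have \<kappa>: "0 < \<kappa>" "\<kappa> \<le> 1 / 4" unfolding \<kappa>_def using ch cl by auto
  have \<kappa>2: "8 * \<kappa> * cl \<le> ch / 64"
  proof -
    have "8 * cl * \<kappa> \<le> 8 * cl * (ch / (512 * cl))" unfolding \<kappa>_def using cl by (intro mult_left_mono) auto
    also have "\<dots> = ch / 64" using cl by simp
    finally show ?thesis by (simp add: mult_ac)
  qed
  \<comment> \<open>All stochastic costs of the uniform bound, per unit of effective
    dimension.\<close>
  define Ks where "Ks = 6 * \<Lambda> * (ln (2 / (\<epsilon> / 2)) + 12 / s\<^sup>2) + 18 * C"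
  have lnn: "0 \<le> ln (2 / (\<epsilon> / 2))" using \<epsilon> by simp
  have Ks: "0 \<le> Ks" unfolding Ks_def using L.\<Lambda>1 L.C0 lnn s by simp
  \<comment> \<open>One summand for each term to be absorbed: the noise and the bias for smooth
    \<open>v\<close>, then the score and the bias for rough \<open>v\<close>.\<close>
  define R where "R = 1 + 32 * Ks * CT / ch + 64 * j0 / ch + 1024 * C * CT / (\<epsilon> * \<kappa>\<^sup>2) + 16 * j0 / \<kappa>"
  have parts: "0 \<le> 32 * Ks * CT / ch" "0 \<le> 64 * j0 / ch" "0 \<le> 1024 * C * CT / (\<epsilon> * \<kappa>\<^sup>2)" "0 \<le> 16 * j0 / \<kappa>"
    using Ks CT ch j0 L.C0 \<epsilon> \<kappa> by auto
  have R: "1 \<le> R" "32 * Ks * CT / ch \<le> R" "64 * j0 / ch \<le> R" "1024 * C * CT / (\<epsilon> * \<kappa>\<^sup>2) \<le> R" "16 * j0 / \<kappa> \<le> R"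
    unfolding R_def using parts by linarith+
  have RK: "Ks * CT \<le> ch / 32 * R" "j0 \<le> ch / 64 * R" "1024 * C * CT / \<epsilon> \<le> \<kappa>\<^sup>2 * R" "j0 \<le> \<kappa> / 16 * R"
    using R(2-5) ch \<kappa> \<epsilon> by (simp_all add: field_simps)
  define \<xi> where "\<xi> = min (ch / 64) (\<kappa> / 16)"
  have \<xi>: "0 < \<xi>" unfolding \<xi>_def using ch \<kappa> by simp
  have "\<exists>E\<in>sets S. measure S E \<le> \<epsilon> \<and>
    (\<forall>\<omega>\<in>space S - E. \<forall>v. \<tau>0 + v \<in> N \<longrightarrow> sqnorm l v = R * rate n l \<longrightarrow>
      pen_crit M \<eta> JB l n (\<lambda>i. X i \<omega>) \<tau>0 < pen_crit M \<eta> JB l n (\<lambda>i. X i \<omega>) (\<tau>0 + v))"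
    if n: "1 \<le> n" and l: "0 < l" "l \<le> 1" for n l
  proof -
    define \<Gamma> where "\<Gamma> = R * rate n l"
    define T where "T = eff_dim l"
    have \<Gamma>: "0 < \<Gamma>" unfolding \<Gamma>_def using R(1) rate_pos[OF n l(1)] by simp
    have T1: "1 \<le> T" unfolding T_def by (rule eff_dim_ge_1[OF l])
    have Tn: "T / real n \<le> CT * rate n l" unfolding T_def by (rule eff_dim_rate[OF l(1)])
    have l_rate: "l \<le> rate n l" unfolding rate_def using l by simp
    have lj1: "l * j0 \<le> ch / 64 * \<Gamma>"
    proof -
      have "l * j0 \<le> rate n l * (ch / 64 * R)" using l_rate RK(2) j0 l by (intro mult_mono) auto
      then show ?thesis unfolding \<Gamma>_def by (simp add: mult_ac)
    qed
    have lj2: "l * j0 \<le> \<kappa> / 16 * \<Gamma>"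
    proof -
      have "l * j0 \<le> rate n l * (\<kappa> / 16 * R)" using l_rate RK(4) j0 l by (intro mult_mono) auto
      then show ?thesis unfolding \<Gamma>_def by (simp add: mult_ac)
    qed
    have KT: "Ks * (T / real n) \<le> ch / 32 * \<Gamma>"
    proof -
      have "Ks * (T / real n) \<le> Ks * (CT * rate n l)" using Tn Ks by (intro mult_left_mono) auto
      also have "\<dots> = (Ks * CT) * rate n l" by simp
      also have "\<dots> \<le> (ch / 32 * R) * rate n l" using RK(1) rate_pos[OF n l(1)] by (intro mult_right_mono) auto
      finally show ?thesis unfolding \<Gamma>_def by simp
    qed
    have \<tau>: "0 \<le> l * \<rho>' i" for i using l \<rho>'_nonneg by simp
    define F where "F = {u \<in> dense. \<tau>0 + u \<in> N \<and> sqnorm l u \<le> 2 * \<Gamma> \<and> l * pen u u \<le> \<kappa> * \<Gamma>}"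
    have F: "countable F" "F \<subseteq> {v. \<tau>0 + v \<in> N}" "F \<subseteq> span (range \<psi>)"
      using dense_span unfolding F_def by (auto intro: countable_subset[OF _ dense_countable])
    have FB: "form u u \<le> 2 * \<Gamma>" if "u \<in> F" for u
    proof -
      have "0 \<le> l * pen u u" using l pen_pos[of u] by simp
      then show ?thesis using that unfolding F_def sqnorm_def by simp
    qed
    have FJ: "(\<Sum>i<K. l * \<rho>' i * (form u (\<psi> i))\<^sup>2) \<le> \<kappa> * \<Gamma>" if "u \<in> F" for u K
    proof -
      have "(\<Sum>i<K. l * \<rho>' i * (form u (\<psi> i))\<^sup>2) = l * (\<Sum>i<K. \<rho>' i * (form u (\<psi> i))\<^sup>2)"
        by (simp add: sum_distrib_left mult.assoc)
      also have "\<dots> \<le> l * pen u u" using pen_bessel[of u K] that F l by (intro mult_left_mono) auto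
      also have "\<dots> \<le> \<kappa> * \<Gamma>" using that unfolding F_def by simp
      finally show ?thesis .
    qed
    have \<epsilon>2: "0 < \<epsilon> / 2" "\<epsilon> / 2 \<le> 1" using \<epsilon> by auto
    obtain E1 where E1: "E1 \<in> sets S" "measure S E1 \<le> \<epsilon> / 2"
      "\<And>\<omega> u. \<omega> \<in> space S - E1 \<Longrightarrow> u \<in> F \<Longrightarrow> (\<Sum>i=1..n. loss u (X i \<omega>)) \<ge>
         real n * (3 / 8 * ch * form u u - cl * ((2 * s\<^sup>2 + 8 * \<kappa>) * \<Gamma>))
         - 6 * \<Lambda> * (ln (2 / (\<epsilon> / 2)) + 12 * T / s\<^sup>2) - 18 * C * T"
      using L.countable_lower_bound[OF \<psi>_orth F \<tau> eff[OF l, folded eff_dim_def] T1[unfolded T_def] n \<Gamma> s \<epsilon>2 FB FJ]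
      unfolding ch_def cl_def T_def by blast
    obtain E2 where E2: "E2 \<in> sets S" "measure S E2 \<le> \<epsilon> / 2"
      "\<And>\<omega> v. \<omega> \<in> space S - E2 \<Longrightarrow> (\<Sum>j=1..n. D_joint \<eta> \<tau>0 v (X j \<omega>))\<^sup>2 \<le> real n * C * T / (\<epsilon> / 2) * sqnorm l v"
      using score_event[OF n l \<epsilon>2(1)] unfolding T_def by blast
    obtain E3 where E3: "E3 \<in> null_sets S"
      "\<And>\<omega>. \<omega> \<in> space S - E3 \<Longrightarrow> \<forall>u\<in>dense. \<tau>0 + u \<in> N \<longrightarrow> (\<forall>i\<ge>1. - D_joint \<eta> \<tau>0 u (X i \<omega>) \<le> loss u (X i \<omega>))"
      using AE_null_setE[OF tangent_at_zero] by metis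
    show ?thesis
    proof (intro bexI[of _ "E1 \<union> E2 \<union> E3"] conjI ballI allI impI)
      show "E1 \<union> E2 \<union> E3 \<in> sets S" using E1 E2 E3 by auto
      have "measure S (E1 \<union> E2 \<union> E3) \<le> measure S (E1 \<union> E2) + measure S E3"
        using E1 E2 E3 by (intro measure_Un_le) auto
      also have "measure S (E1 \<union> E2) \<le> measure S E1 + measure S E2"
        using E1 E2 by (intro measure_Un_le) auto
      also have "measure S E3 = 0" using E3(1) by (simp add: measure_eq_0_null_sets)
      finally show "measure S (E1 \<union> E2 \<union> E3) \<le> \<epsilon>" using E1 E2 by simp
      fix \<omega> v assume \<omega>: "\<omega> \<in> space S - (E1 \<union> E2 \<union> E3)" and v: "\<tau>0 + v \<in> N" "sqnorm l v = R * rate n l"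
      define G where "G = pen_crit M \<eta> JB l n (\<lambda>i. X i \<omega>)"
      \<comment> \<open>Proved on an open shell around the sphere and with a positive margin, so
        that it survives the passage to the limit from \<open>dense\<close>.\<close>
      have low: "\<xi> * \<Gamma> \<le> G (\<tau>0 + u) - G \<tau>0"
        if u: "u \<in> dense" "\<tau>0 + u \<in> N" "\<Gamma> / 2 < sqnorm l u" "sqnorm l u < 2 * \<Gamma>" for u
      proof -
        have diff: "(\<Sum>i=1..n. loss u (X i \<omega>)) / real n + l / 4 * pen u u - l * j0 \<le> G (\<tau>0 + u) - G \<tau>0"
          unfolding G_def j0_def by (rule pen_crit_diff[OF n l(1)])
        have pu: "0 \<le> l * pen u u" using l pen_pos[of u] by simp
        show ?thesis
        proof (cases "l * pen u u \<le> \<kappa> * \<Gamma>")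
          case True
          then have uF: "u \<in> F" unfolding F_def using u by simp
          have "\<kappa> * \<Gamma> \<le> 1 / 4 * \<Gamma>" using \<kappa> \<Gamma> by (intro mult_right_mono) auto
          then have fu: "\<Gamma> / 4 \<le> form u u" using u(3) True unfolding sqnorm_def by linarith
          have "cl * ((2 * s\<^sup>2 + 8 * \<kappa>) * \<Gamma>) \<le> ch / 32 * \<Gamma>"
          proof -
            have "(2 * s\<^sup>2 * cl + 8 * \<kappa> * cl) * \<Gamma> \<le> (ch / 64 + ch / 64) * \<Gamma>"
              using s2 \<kappa>2 \<Gamma> by (intro mult_right_mono add_mono) auto
            then show ?thesis by (simp add: algebra_simps)
          qed
          moreover have "3 / 8 * ch * (\<Gamma> / 4) \<le> 3 / 8 * ch * form u u" using fu ch by (intro mult_left_mono) auto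
          ultimately have main: "ch / 16 * \<Gamma> \<le> 3 / 8 * ch * form u u - cl * ((2 * s\<^sup>2 + 8 * \<kappa>) * \<Gamma>)"
            by linarith
          have rem: "6 * \<Lambda> * (ln (2 / (\<epsilon> / 2)) + 12 * T / s\<^sup>2) + 18 * C * T \<le> Ks * T"
          proof -
            have "ln (2 / (\<epsilon> / 2)) \<le> ln (2 / (\<epsilon> / 2)) * T" using mult_left_mono[OF T1 lnn] by simp
            then have "6 * \<Lambda> * (ln (2 / (\<epsilon> / 2)) + 12 * T / s\<^sup>2) \<le> 6 * \<Lambda> * (ln (2 / (\<epsilon> / 2)) * T + 12 * T / s\<^sup>2)"
              using L.\<Lambda>1 by (intro mult_left_mono) auto
            moreover have "6 * \<Lambda> * (ln (2 / (\<epsilon> / 2)) * T + 12 * T / s\<^sup>2) + 18 * C * T = Ks * T"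
              unfolding Ks_def by (simp add: algebra_simps)
            ultimately show ?thesis by linarith
          qed
          have "real n * (ch / 16 * \<Gamma>) - Ks * T \<le> (\<Sum>i=1..n. loss u (X i \<omega>))"
          proof -
            have "\<omega> \<in> space S - E1" using \<omega> by auto
            from E1(3)[OF this uF] rem mult_left_mono[OF main, of "real n"] show ?thesis by simp
          qed
          then have "(real n * (ch / 16 * \<Gamma>) - Ks * T) / real n \<le> (\<Sum>i=1..n. loss u (X i \<omega>)) / real n"
            by (intro divide_right_mono) auto
          moreover have "(real n * (ch / 16 * \<Gamma>) - Ks * T) / real n = ch / 16 * \<Gamma> - Ks * (T / real n)"
            using n by (simp add: diff_divide_distrib)
          ultimately have "ch / 16 * \<Gamma> - ch / 32 * \<Gamma> - ch / 64 * \<Gamma> \<le> G (\<tau>0 + u) - G \<tau>0"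
            using diff KT lj1 pu by linarith
          moreover have "\<xi> * \<Gamma> \<le> ch / 64 * \<Gamma>" using \<Gamma> unfolding \<xi>_def by (intro mult_right_mono) auto
          ultimately show ?thesis by linarith
        next
          case False
          define Z where "Z = (\<Sum>j=1..n. D_joint \<eta> \<tau>0 u (X j \<omega>))"
          have "\<omega> \<in> space S - E3" using \<omega> by auto
          then have "(\<Sum>i=1..n. - D_joint \<eta> \<tau>0 u (X i \<omega>)) \<le> (\<Sum>i=1..n. loss u (X i \<omega>))"
            using E3(2)[of \<omega>] u by (intro sum_mono) auto
          then have "- Z \<le> (\<Sum>i=1..n. loss u (X i \<omega>))" unfolding Z_def by (simp add: sum_negf)
          then have tan: "- Z / real n \<le> (\<Sum>i=1..n. loss u (X i \<omega>)) / real n" by (intro divide_right_mono) auto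
          have "\<omega> \<in> space S - E2" using \<omega> by auto
          from E2(3)[OF this, of u] have "Z\<^sup>2 \<le> real n * C * T / (\<epsilon> / 2) * sqnorm l u" unfolding Z_def .
          also have "\<dots> \<le> real n * C * T / (\<epsilon> / 2) * (2 * \<Gamma>)"
            using u(4) L.C0 T1 \<epsilon> by (intro mult_left_mono) auto
          finally have "Z\<^sup>2 / (real n)\<^sup>2 \<le> (real n * C * T / (\<epsilon> / 2) * (2 * \<Gamma>)) / (real n)\<^sup>2"
            by (intro divide_right_mono) auto
          also have "\<dots> = 4 * C / \<epsilon> * (T / real n) * \<Gamma>"
            using n by (simp add: power2_eq_square)
          also have "\<dots> \<le> 4 * C / \<epsilon> * (CT * rate n l) * \<Gamma>"
            using Tn L.C0 \<epsilon> \<Gamma> by (intro mult_right_mono mult_left_mono) auto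
          \<comment> \<open>The averaged score is of order
            \<open>sqrt (rate n l * \<Gamma>)\<close>. As \<open>\<Gamma>\<close> is
            \<open>R\<close> times the rate, a large \<open>R\<close> makes it a small fraction of
            \<open>\<Gamma>\<close>; the factor \<open>256\<close> produces
            \<open>\<kappa> / 16\<close>, against a gain of \<open>\<kappa> / 4\<close> from the
            penalty.\<close>
          also have "\<dots> = (1024 * C * CT / \<epsilon>) * (rate n l * \<Gamma>) / 256" by simp
          also have "\<dots> \<le> (\<kappa>\<^sup>2 * R) * (rate n l * \<Gamma>) / 256"
            using RK(3) rate_pos[OF n l(1)] \<Gamma> by (intro divide_right_mono mult_right_mono) auto
          also have "\<dots> = (\<kappa> / 16 * \<Gamma>)\<^sup>2" unfolding \<Gamma>_def by (simp add: power2_eq_square)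
          finally have "(Z / real n)\<^sup>2 \<le> (\<kappa> / 16 * \<Gamma>)\<^sup>2" by (simp add: power_divide)
          then have "\<bar>Z / real n\<bar> \<le> \<kappa> / 16 * \<Gamma>" using \<kappa> \<Gamma> by (simp add: abs_le_square_iff[symmetric])
          then have "- (\<kappa> / 16 * \<Gamma>) \<le> - Z / real n" by (simp only: abs_le_iff minus_divide_left) linarith
          then have "- (\<kappa> / 16 * \<Gamma>) \<le> (\<Sum>i=1..n. loss u (X i \<omega>)) / real n" using tan by linarith
          moreover have "l / 4 * pen u u \<ge> \<kappa> * \<Gamma> / 4" using False by simp
          ultimately have "\<kappa> / 8 * \<Gamma> \<le> G (\<tau>0 + u) - G \<tau>0" using diff lj2 by linarith
          moreover have "\<xi> * \<Gamma> \<le> \<kappa> / 16 * \<Gamma>" using \<Gamma> unfolding \<xi>_def by (intro mult_right_mono) auto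
          moreover have "0 \<le> \<kappa> / 16 * \<Gamma>" using \<kappa> \<Gamma> by simp
          ultimately show ?thesis by linarith
        qed
      qed
      obtain u where u: "\<And>k. u k \<in> dense" "u \<longlonglongrightarrow> v" using dense_sequence[of v] by blast
      have uN: "eventually (\<lambda>k. \<tau>0 + u k \<in> N) sequentially"
        using topological_tendstoD[OF tendsto_add[OF tendsto_const u(2), of \<tau>0] N_open v(1)] .
      have szl: "(\<lambda>k. sqnorm l (u k)) \<longlonglongrightarrow> \<Gamma>"
        using sqnorm_tendsto[OF u(2), of l] v(2) by (simp add: \<Gamma>_def)
      have ev: "eventually (\<lambda>k. \<xi> * \<Gamma> \<le> G (\<tau>0 + u k) - G \<tau>0) sequentially"
      proof (rule eventually_mono)
        have h: "\<Gamma> / 2 < \<Gamma>" "\<Gamma> < 2 * \<Gamma>" using \<Gamma> by auto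
        show "\<forall>\<^sub>F k in sequentially. \<tau>0 + u k \<in> N \<and> \<Gamma> / 2 < sqnorm l (u k) \<and> sqnorm l (u k) < 2 * \<Gamma>"
          by (intro eventually_conj uN order_tendstoD(1)[OF szl h(1)] order_tendstoD(2)[OF szl h(2)])
      qed (use low u(1) in blast)
      have "isCont G (\<tau>0 + v)"
        using pen_crit_continuous[of \<omega> l n] \<omega> N_open v(1) unfolding G_def
        by (simp add: continuous_on_eq_continuous_at)
      then have "(\<lambda>k. G (\<tau>0 + u k)) \<longlonglongrightarrow> G (\<tau>0 + v)"
        by (rule isCont_tendsto_compose) (intro tendsto_intros u)
      then have "(\<lambda>k. G (\<tau>0 + u k) - G \<tau>0) \<longlonglongrightarrow> G (\<tau>0 + v) - G \<tau>0" by (intro tendsto_intros)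
      then have "\<xi> * \<Gamma> \<le> G (\<tau>0 + v) - G \<tau>0" by (rule tendsto_lowerbound[OF _ ev]) simp
      moreover have "0 < \<xi> * \<Gamma>" using \<xi> \<Gamma> by simp
      ultimately show "pen_crit M \<eta> JB l n (\<lambda>i. X i \<omega>) \<tau>0 < pen_crit M \<eta> JB l n (\<lambda>i. X i \<omega>) (\<tau>0 + v)"
        unfolding G_def by simp
    qed
  qed
  moreover have "0 < R" using R(1) by simp
  ultimately show ?thesis by blast
qed

text \<open>If the estimate lay outside the ball, the segment to it from \<open>\<tau>0\<close>
  would meet the sphere inside the convex set \<open>N\<close>, at a point where the criterion
  exceeds both end values, against convexity.\<close>

lemma penalized_rate:
  assumes n: "1 \<le> n" and l: "0 < l" and R: "0 < R"
    and conv: "convex_on UNIV (crit M \<eta> n xs)"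
    and low: "\<And>v. \<tau>0 + v \<in> N \<Longrightarrow> sqnorm l v = R * rate n l \<Longrightarrow>
      pen_crit M \<eta> JB l n xs \<tau>0 < pen_crit M \<eta> JB l n xs (\<tau>0 + v)"
    and est: "penalized_estimate (pen_crit M \<eta> JB l n xs) N \<tau>"
  shows "sqnorm l (\<tau> - \<tau>0) \<le> R * rate n l"
proof (rule ccontr)
  define G where "G = pen_crit M \<eta> JB l n xs"
  define \<Gamma> where "\<Gamma> = R * rate n l"
  define v where "v = \<tau> - \<tau>0"
  assume "\<not> sqnorm l (\<tau> - \<tau>0) \<le> R * rate n l"
  then have q: "\<Gamma> < sqnorm l v" unfolding \<Gamma>_def v_def by simp
  have \<Gamma>: "0 < \<Gamma>" unfolding \<Gamma>_def using R rate_pos[OF n l] by simp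
  have "\<tau> \<in> {s \<in> N. local_min G s}" using est unfolding penalized_estimate_def G_def by blast
  then have \<tau>N: "\<tau> \<in> N" and lm: "local_min G \<tau>" by auto
  have Gc: "convex_on UNIV G"
  proof -
    have "convex_on UNIV (\<lambda>\<tau>. pen \<tau> \<tau>)" by (rule psd_form_convex[OF pen_bilinear pen_sym pen_pos])
    then have "convex_on UNIV (\<lambda>\<tau>. l / 2 * pen \<tau> \<tau>)" using l by (intro convex_on_cmul) auto
    from convex_on_add[OF conv this] show ?thesis unfolding G_def pen_crit_def[abs_def] pen_def .
  qed
  obtain e where e: "0 < e" "\<And>y. dist y \<tau> < e \<Longrightarrow> G \<tau> \<le> G y"
    using lm unfolding local_min_def eventually_nhds_metric by blast
  have "\<forall>y\<in>UNIV. G \<tau> \<le> G y"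
    by (rule convex_local_global_minimum[OF e(1) Gc]) (use e(2) in \<open>auto simp: dist_commute\<close>)
  then have glob: "G \<tau> \<le> G \<tau>0" by blast
  \<comment> \<open>\<open>sqnorm\<close> is quadratic, so this factor scales \<open>v\<close> onto
    the sphere.\<close>
  define t where "t = sqrt (\<Gamma> / sqnorm l v)"
  have t2: "t\<^sup>2 = \<Gamma> / sqnorm l v" unfolding t_def using \<Gamma> q by simp
  have t: "0 \<le> t" "t \<le> 1" unfolding t_def using \<Gamma> q by auto
  have "sqnorm l (t *\<^sub>R v) = R * rate n l" unfolding sqnorm_scaleR t2 \<Gamma>_def[symmetric] using \<Gamma> q by simp
  moreover have "\<tau>0 + t *\<^sub>R v \<in> N" unfolding v_def using segment_mem[OF \<tau>N N_mem] t by simp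
  ultimately have "G \<tau>0 < G (\<tau>0 + t *\<^sub>R v)" using low unfolding G_def by blast
  also have "\<tau>0 + t *\<^sub>R v = (1 - t) *\<^sub>R \<tau>0 + t *\<^sub>R \<tau>" unfolding v_def by (simp add: algebra_simps)
  also have "G \<dots> \<le> (1 - t) * G \<tau>0 + t * G \<tau>" by (rule convex_onD[OF Gc t]) auto
  also have "\<dots> \<le> (1 - t) * G \<tau>0 + t * G \<tau>0" using glob t by (intro add_left_mono mult_left_mono) auto
  finally show False by (simp add: algebra_simps)
qed

text \<open>Comparing the criterion at \<open>\<tau>\<close> and \<open>\<tau>0\<close> bounds a
  multiple of \<open>q = sqnorm l v\<close> by the averaged score at \<open>v\<close> plus the bias.
  The score is at most the root of \<open>z * q\<close>, so the inequality is self-bounding and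
  yields \<open>q\<close> of order \<open>z\<close>, up to the bias.\<close>

lemma quadratic_rate:
  assumes k1: "0 < k1" "\<And>\<delta>. k1 * form \<delta> \<delta> \<le> var M \<eta> \<tau>0 (L_joint L\<theta> Lh \<delta>)"
    and \<epsilon>: "0 < \<epsilon>"
  shows "\<exists>R. \<forall>n l \<omega> \<tau>. 1 \<le> n \<longrightarrow> 0 < l \<longrightarrow> l \<le> 1 \<longrightarrow> \<omega> \<in> space S \<longrightarrow>
    (\<forall>v. (\<Sum>j=1..n. D_joint \<eta> \<tau>0 v (X j \<omega>))\<^sup>2 \<le> real n * C * eff_dim l / \<epsilon> * sqnorm l v) \<longrightarrow>
    quad_crit M \<eta> \<tau>0 JB l n (\<lambda>i. X i \<omega>) \<tau> \<le> quad_crit M \<eta> \<tau>0 JB l n (\<lambda>i. X i \<omega>) \<tau>0 \<longrightarrow>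
    sqnorm l (\<tau> - \<tau>0) \<le> R * rate n l"
proof -
  define k where "k = min (C1 * k1 / 2) (1 / 4)"
  have k: "0 < k" "k \<le> C1 * k1 / 2" "k \<le> 1 / 4" unfolding k_def using k1 C_pos by auto
  define j0 where "j0 = pen \<tau>0 \<tau>0"
  have j0: "0 \<le> j0" unfolding j0_def by (rule pen_pos)
  have "sqnorm l (\<tau> - \<tau>0) \<le> (C * CT / \<epsilon> / k\<^sup>2 + 2 * j0 / k) * rate n l"
    if n: "1 \<le> n" and l: "0 < l" "l \<le> 1" and \<omega>: "\<omega> \<in> space S"
      and Z: "\<And>v. (\<Sum>j=1..n. D_joint \<eta> \<tau>0 v (X j \<omega>))\<^sup>2 \<le> real n * C * eff_dim l / \<epsilon> * sqnorm l v"
      and min: "quad_crit M \<eta> \<tau>0 JB l n (\<lambda>i. X i \<omega>) \<tau> \<le> quad_crit M \<eta> \<tau>0 JB l n (\<lambda>i. X i \<omega>) \<tau>0"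
    for n l \<omega> \<tau>
  proof -
    define v where "v = \<tau> - \<tau>0"
    define q where "q = sqnorm l v"
    have q0: "0 \<le> q" unfolding q_def using l by (intro sqnorm_nonneg) auto
    define Zv where "Zv = (\<Sum>j=1..n. D_joint \<eta> \<tau>0 v (X j \<omega>)) / real n"
    have m0: "mean M \<eta> \<tau>0 (D_joint \<eta> \<tau>0 u) = 0" for u
      using mean0_eq[OF D_joint_measurable[OF N_mem]] L20_integral[OF D_joint_L20[OF N_mem]] by simp
    have v0: "var M \<eta> \<tau>0 (D_joint \<eta> \<tau>0 (\<tau>0 - \<tau>0)) = 0"
    proof -
      have "(\<integral>x. (D_joint \<eta> \<tau>0 0 x)\<^sup>2 \<partial>P0) = (\<integral>x. 0 \<partial>P0)"
        by (intro Bochner_Integration.integral_cong) (auto simp: linear_0[OF D_joint_linear[OF _ N_mem]])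
      then show ?thesis unfolding var_D_joint_eq[OF N_mem] by simp
    qed
    have lin: "(\<Sum>i=1..n. D_joint \<eta> \<tau>0 \<tau> (X i \<omega>)) - (\<Sum>i=1..n. D_joint \<eta> \<tau>0 \<tau>0 (X i \<omega>)) = real n * Zv"
    proof -
      have "(\<Sum>i=1..n. D_joint \<eta> \<tau>0 \<tau> (X i \<omega>)) - (\<Sum>i=1..n. D_joint \<eta> \<tau>0 \<tau>0 (X i \<omega>))
         = (\<Sum>i=1..n. D_joint \<eta> \<tau>0 v (X i \<omega>))"
        unfolding sum_subtractf[symmetric] v_def
        by (intro sum.cong refl) (simp add: linear_diff[OF D_joint_linear[OF X_space[OF \<omega>] N_mem]])
      then show ?thesis unfolding Zv_def using n by simp
    qed
    have pen_eq: "pen \<tau> \<tau> = pen \<tau>0 \<tau>0 + 2 * pen v \<tau>0 + pen v v"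
    proof -
      have "\<tau> = \<tau>0 + v" by (simp add: v_def)
      then show ?thesis using pen_sym[of v \<tau>0]
        by (simp add: bilinear_ladd[OF pen_bilinear] bilinear_radd[OF pen_bilinear])
    qed
    have var_ge: "C1 * k1 * form v v \<le> var M \<eta> \<tau>0 (D_joint \<eta> \<tau>0 v)"
      using order_trans[OF mult_left_mono[OF k1(2)[of v], of C1] var_D_joint(1)[OF N_mem]] C_pos
      by (simp add: mult.assoc)
    have "1 / 2 * var M \<eta> \<tau>0 (D_joint \<eta> \<tau>0 v) + l / 2 * (pen \<tau> \<tau> - pen \<tau>0 \<tau>0) \<le> Zv"
    proof -
      have "Zv = (1 / real n) * ((\<Sum>i=1..n. D_joint \<eta> \<tau>0 \<tau> (X i \<omega>)) - (\<Sum>i=1..n. D_joint \<eta> \<tau>0 \<tau>0 (X i \<omega>)))"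
        unfolding lin using n by simp
      then show ?thesis
        using min unfolding quad_crit_def m0 v0 pen_def[symmetric] v_def[symmetric]
        by (simp add: right_diff_distrib)
    qed
    moreover have "l / 2 * (pen v v / 2 - 2 * j0) \<le> l / 2 * (pen \<tau> \<tau> - pen \<tau>0 \<tau>0)"
      using psd_form_triangle(3)[OF pen_bilinear pen_sym pen_pos, of v \<tau>0] l
      unfolding pen_eq j0_def by (intro mult_left_mono) auto
    ultimately have "C1 * k1 / 2 * form v v + 1 / 4 * (l * pen v v) \<le> Zv + l * j0"
      using var_ge by (simp add: algebra_simps)
    moreover have "k * form v v \<le> C1 * k1 / 2 * form v v" using k form_pos by (intro mult_right_mono) auto
    moreover have "k * (l * pen v v) \<le> 1 / 4 * (l * pen v v)" using k l pen_pos by (intro mult_right_mono) auto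
    ultimately have main: "k * q \<le> Zv + l * j0" unfolding q_def sqnorm_def by (simp add: distrib_left)
    define z where "z = C * CT / \<epsilon> * rate n l"
    have "Zv\<^sup>2 \<le> (real n * C * eff_dim l / \<epsilon> * q) / (real n)\<^sup>2"
      unfolding Zv_def power_divide q_def using Z[of v] by (intro divide_right_mono) auto
    also have "\<dots> = C / \<epsilon> * (eff_dim l / real n) * q" using n by (simp add: power2_eq_square)
    also have "\<dots> \<le> C / \<epsilon> * (CT * rate n l) * q"
      using eff_dim_rate[OF l(1)] L.C0 \<epsilon> q0 by (intro mult_right_mono mult_left_mono) auto
    finally have Z2: "Zv\<^sup>2 \<le> z * q" unfolding z_def by (simp add: mult_ac)
    \<comment> \<open>The arithmetic-geometric mean inequality, weighted so that half of
      \<open>k * q\<close> can be absorbed on the left; \<open>q = 0\<close> is separate because a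
      factor \<open>q\<close> is cancelled.\<close>
    have "Zv \<le> z / (2 * k) + k * q / 2"
    proof -
      have "2 * k * Zv \<le> (k\<^sup>2 * q) + z"
      proof (cases "q = 0")
        case True
        then have "Zv = 0" using Z2 by simp
        moreover have "0 \<le> z" unfolding z_def using L.C0 CT \<epsilon> rate_pos[OF n l(1)] by simp
        ultimately show ?thesis using True by simp
      next
        case False
        then have qp: "0 < q" using q0 by simp
        have "2 * (k * q) * Zv \<le> (k * q)\<^sup>2 + Zv\<^sup>2"
          using zero_le_power2[of "k * q - Zv"] unfolding power2_diff by simp
        also have "\<dots> \<le> (k * q)\<^sup>2 + z * q" using Z2 by simp
        finally have "q * (2 * k * Zv) \<le> q * (k\<^sup>2 * q + z)" by (simp add: power2_eq_square algebra_simps)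
        then show ?thesis using qp by simp
      qed
      then have "2 * k * Zv / (2 * k) \<le> (k\<^sup>2 * q + z) / (2 * k)" using k by (intro divide_right_mono) auto
      then show ?thesis using k by (simp add: add_divide_distrib power2_eq_square)
    qed
    then have "k * q / 2 \<le> z / (2 * k) + l * j0" using main by linarith
    then have "k * q / 2 * (2 / k) \<le> (z / (2 * k) + l * j0) * (2 / k)" using k by (intro mult_right_mono) auto
    also have "(z / (2 * k) + l * j0) * (2 / k) = z / k\<^sup>2 + l * (2 * j0 / k)"
      by (simp add: distrib_right power2_eq_square add_divide_distrib)
    also have "l * (2 * j0 / k) \<le> rate n l * (2 * j0 / k)"
      using j0 k by (intro mult_right_mono) (auto simp: rate_def)
    finally have "q \<le> z / k\<^sup>2 + rate n l * (2 * j0 / k)" using k by simp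
    also have "\<dots> = (C * CT / \<epsilon> / k\<^sup>2 + 2 * j0 / k) * rate n l"
      unfolding z_def by (simp add: algebra_simps)
    finally show ?thesis unfolding q_def v_def .
  qed
  then show ?thesis by blast
qed

end

section \<open>Statements in probability\<close>

lemma bounded_in_probI:
  assumes "\<And>\<epsilon>. 0 < \<epsilon> \<Longrightarrow> \<epsilon> \<le> 1 \<Longrightarrow> \<exists>K. \<forall>\<^sub>F n in sequentially.
    \<exists>E\<in>sets S. measure S E \<le> \<epsilon> \<and> (\<forall>\<omega>\<in>space S - E. \<bar>Y n \<omega>\<bar> \<le> K * a n)"
  shows "bounded_in_prob S Y a"
  unfolding bounded_in_prob_def
proof (intro allI impI)
  fix \<epsilon> :: real assume "0 < \<epsilon>"
  then obtain K where K: "\<forall>\<^sub>F n in sequentially.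
    \<exists>E\<in>sets S. measure S E \<le> min \<epsilon> 1 \<and> (\<forall>\<omega>\<in>space S - E. \<bar>Y n \<omega>\<bar> \<le> K * a n)"
    using assms[of "min \<epsilon> 1"] by auto
  show "\<exists>K. \<forall>\<^sub>F n in sequentially. \<exists>E\<in>sets S. {\<omega> \<in> space S. \<bar>Y n \<omega>\<bar> > K * a n} \<subseteq> E \<and> measure S E \<le> \<epsilon>"
  proof (rule exI[of _ K], rule eventually_mono[OF K])
    fix n assume "\<exists>E\<in>sets S. measure S E \<le> min \<epsilon> 1 \<and> (\<forall>\<omega>\<in>space S - E. \<bar>Y n \<omega>\<bar> \<le> K * a n)"
    then obtain E where "E \<in> sets S" "measure S E \<le> min \<epsilon> 1" "\<And>\<omega>. \<omega> \<in> space S - E \<Longrightarrow> \<bar>Y n \<omega>\<bar> \<le> K * a n"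
      by blast
    then show "\<exists>E\<in>sets S. {\<omega> \<in> space S. \<bar>Y n \<omega>\<bar> > K * a n} \<subseteq> E \<and> measure S E \<le> \<epsilon>"
      by (intro bexI[of _ E]) (auto simp: not_le[symmetric])
  qed
qed

context density_eigen_iid
begin

text \<open>Both estimators are treated on the same event, so that their difference can be bounded
  on it as well.\<close>

lemma estimator_rates:
  assumes lam: "\<And>n. 0 < lam n" "lam \<longlonglongrightarrow> 0"
    and est: "with_prob_tending_to_1 S (\<lambda>n \<omega>.
      penalized_estimate (pen_crit M \<eta> JB (lam n) n (\<lambda>i. X i \<omega>)) N (\<tau>hat n \<omega>) \<and>
      (\<forall>\<tau>. quad_crit M \<eta> \<tau>0 JB (lam n) n (\<lambda>i. X i \<omega>) (\<tau>til n \<omega>)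
            \<le> quad_crit M \<eta> \<tau>0 JB (lam n) n (\<lambda>i. X i \<omega>) \<tau>) \<and>
      \<tau>til n \<omega> \<in> N)"
    and \<epsilon>: "0 < \<epsilon>" "\<epsilon> \<le> 1"
  shows "\<exists>R>0. \<forall>\<^sub>F n in sequentially. \<exists>E\<in>sets S. measure S E \<le> \<epsilon> \<and> (\<forall>\<omega>\<in>space S - E.
     sqnorm (lam n) (\<tau>hat n \<omega> - \<tau>0) \<le> R * rate n (lam n) \<and> sqnorm (lam n) (\<tau>til n \<omega> - \<tau>0) \<le> R * rate n (lam n))"
proof -
  obtain k1 where k1: "0 < k1" "\<And>\<delta>. k1 * form \<delta> \<delta> \<le> var M \<eta> \<tau>0 (L_joint L\<theta> Lh \<delta>)"
    by (rule var_form_equiv) blast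
  \<comment> \<open>One third each for the lower bound on the sphere, for the score and for the
    event on which the estimators have their defining properties.\<close>
  define e where "e = \<epsilon> / 3"
  have e: "0 < e" "e \<le> 1" unfolding e_def using \<epsilon> by auto
  obtain R1 where R1: "0 < R1"
    "\<And>n l. 1 \<le> n \<Longrightarrow> 0 < l \<Longrightarrow> l \<le> 1 \<Longrightarrow> \<exists>E\<in>sets S. measure S E \<le> e \<and>
    (\<forall>\<omega>\<in>space S - E. \<forall>v. \<tau>0 + v \<in> N \<longrightarrow> sqnorm l v = R1 * rate n l \<longrightarrow>
      pen_crit M \<eta> JB l n (\<lambda>i. X i \<omega>) \<tau>0 < pen_crit M \<eta> JB l n (\<lambda>i. X i \<omega>) (\<tau>0 + v))"
    using lower_event[OF e] by metis
  obtain R2 where R2: "\<And>n l \<omega> \<tau>. 1 \<le> n \<Longrightarrow> 0 < l \<Longrightarrow> l \<le> 1 \<Longrightarrow> \<omega> \<in> space S \<Longrightarrow>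
    (\<forall>v. (\<Sum>j=1..n. D_joint \<eta> \<tau>0 v (X j \<omega>))\<^sup>2 \<le> real n * C * eff_dim l / e * sqnorm l v) \<Longrightarrow>
    quad_crit M \<eta> \<tau>0 JB l n (\<lambda>i. X i \<omega>) \<tau> \<le> quad_crit M \<eta> \<tau>0 JB l n (\<lambda>i. X i \<omega>) \<tau>0 \<Longrightarrow>
    sqnorm l (\<tau> - \<tau>0) \<le> R2 * rate n l"
    using quadratic_rate[OF k1 e(1)] by metis
  define R where "R = max R1 R2"
  obtain G where G: "\<And>n. G n \<in> sets S" "(\<lambda>n. measure S (G n)) \<longlonglongrightarrow> 1"
    "\<And>n \<omega>. \<omega> \<in> G n \<Longrightarrow> penalized_estimate (pen_crit M \<eta> JB (lam n) n (\<lambda>i. X i \<omega>)) N (\<tau>hat n \<omega>)"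
    "\<And>n \<omega> \<tau>. \<omega> \<in> G n \<Longrightarrow> quad_crit M \<eta> \<tau>0 JB (lam n) n (\<lambda>i. X i \<omega>) (\<tau>til n \<omega>)
            \<le> quad_crit M \<eta> \<tau>0 JB (lam n) n (\<lambda>i. X i \<omega>) \<tau>"
    using est unfolding with_prob_tending_to_1_def by metis
  obtain E0 where E0: "E0 \<in> null_sets S"
    "\<And>\<omega>. \<omega> \<in> space S - E0 \<Longrightarrow> \<forall>n\<ge>1. convex_on UNIV (crit M \<eta> n (\<lambda>i. X i \<omega>))"
    using AE_null_setE[OF convex_crit] by metis
  have "eventually (\<lambda>n. 1 - e < measure S (G n)) sequentially"
    using G(2) e by (intro order_tendstoD) auto
  moreover have "eventually (\<lambda>n. lam n < 1) sequentially"
    using lam(2) by (intro order_tendstoD) auto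
  ultimately have "\<forall>\<^sub>F n in sequentially. \<exists>E\<in>sets S. measure S E \<le> \<epsilon> \<and> (\<forall>\<omega>\<in>space S - E.
     sqnorm (lam n) (\<tau>hat n \<omega> - \<tau>0) \<le> R * rate n (lam n) \<and> sqnorm (lam n) (\<tau>til n \<omega> - \<tau>0) \<le> R * rate n (lam n))"
    using eventually_ge_at_top[of 1]
  proof eventually_elim
    case (elim n)
    then have n: "1 \<le> n" and l: "lam n \<le> 1" by auto
    obtain E1 where E1: "E1 \<in> sets S" "measure S E1 \<le> e"
      "\<And>\<omega> v. \<omega> \<in> space S - E1 \<Longrightarrow> \<tau>0 + v \<in> N \<Longrightarrow> sqnorm (lam n) v = R1 * rate n (lam n) \<Longrightarrow>
      pen_crit M \<eta> JB (lam n) n (\<lambda>i. X i \<omega>) \<tau>0 < pen_crit M \<eta> JB (lam n) n (\<lambda>i. X i \<omega>) (\<tau>0 + v)"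
      using R1(2)[OF n lam(1) l] by blast
    obtain E2 where E2: "E2 \<in> sets S" "measure S E2 \<le> e"
      "\<And>\<omega>. \<omega> \<in> space S - E2 \<Longrightarrow> \<forall>v. (\<Sum>j=1..n. D_joint \<eta> \<tau>0 v (X j \<omega>))\<^sup>2 \<le> real n * C * eff_dim (lam n) / e * sqnorm (lam n) v"
      using score_event[OF n lam(1) l e(1)] by blast
    define E where "E = (E1 \<union> E2) \<union> ((space S - G n) \<union> E0)"
    have "measure S E \<le> measure S (E1 \<union> E2) + measure S ((space S - G n) \<union> E0)"
      unfolding E_def using E1 E2 E0 G by (intro measure_Un_le) auto
    also have "measure S (E1 \<union> E2) \<le> measure S E1 + measure S E2"
      using E1 E2 by (intro measure_Un_le) auto
    also have "measure S ((space S - G n) \<union> E0) \<le> measure S (space S - G n) + measure S E0"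
      using E0 G by (intro measure_Un_le) auto
    also have "measure S E0 = 0" using E0(1) by (simp add: measure_eq_0_null_sets)
    also have "measure S (space S - G n) = 1 - measure S (G n)" using G(1) by (rule S.prob_compl)
    finally have ME: "measure S E \<le> \<epsilon>" using E1(2) E2(2) elim(1) unfolding e_def by simp
    have Rl: "R1 * rate n (lam n) \<le> R * rate n (lam n)" "R2 * rate n (lam n) \<le> R * rate n (lam n)"
      unfolding R_def using rate_pos[OF n lam(1)] by (auto intro!: mult_right_mono)
    show ?case
    proof (intro bexI[of _ E] conjI ballI ME)
      show "E \<in> sets S" unfolding E_def using E1 E2 E0 G by auto
      fix \<omega> assume "\<omega> \<in> space S - E"
      then have \<omega>: "\<omega> \<in> space S" "\<omega> \<in> space S - E1" "\<omega> \<in> space S - E2" "\<omega> \<in> space S - E0" "\<omega> \<in> G n"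
        unfolding E_def by auto
      have "convex_on UNIV (crit M \<eta> n (\<lambda>i. X i \<omega>))" using E0(2)[OF \<omega>(4)] n by blast
      from penalized_rate[OF n lam(1) R1(1) this E1(3)[OF \<omega>(2)] G(3)[OF \<omega>(5)]]
      show "sqnorm (lam n) (\<tau>hat n \<omega> - \<tau>0) \<le> R * rate n (lam n)" using Rl by linarith
      from R2[OF n lam(1) l \<omega>(1) E2(3)[OF \<omega>(3)] G(4)[OF \<omega>(5)]]
      show "sqnorm (lam n) (\<tau>til n \<omega> - \<tau>0) \<le> R * rate n (lam n)" using Rl by linarith
    qed
  qed
  moreover have "0 < R" unfolding R_def using R1(1) by simp
  ultimately show ?thesis by blast
qed

lemma bounded_in_prob_sqnorm:
  assumes lam: "\<And>n. 0 < lam n"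
    and sqnorm: "\<And>\<epsilon>. 0 < \<epsilon> \<Longrightarrow> \<epsilon> \<le> 1 \<Longrightarrow> \<exists>R. \<forall>\<^sub>F n in sequentially.
      \<exists>E\<in>sets S. measure S E \<le> \<epsilon> \<and> (\<forall>\<omega>\<in>space S - E. sqnorm (lam n) (d n \<omega>) \<le> R * rate n (lam n))"
  shows "bounded_in_prob S
    (\<lambda>n \<omega>. var M \<eta> \<tau>0 (L_joint L\<theta> Lh (d n \<omega>)) + lam n * JB (snd (d n \<omega>)) (snd (d n \<omega>)))
    (\<lambda>n. inverse (real n) * lam n powr (- 1 / r) + lam n)"
proof (rule bounded_in_probI)
  obtain k1 k2 where k: "0 < k1" "0 < k2"
    "\<And>\<delta>. k1 * form \<delta> \<delta> \<le> var M \<eta> \<tau>0 (L_joint L\<theta> Lh \<delta>)"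
    "\<And>\<delta>. var M \<eta> \<tau>0 (L_joint L\<theta> Lh \<delta>) \<le> k2 * form \<delta> \<delta>"
    by (rule var_form_equiv) blast
  define m where "m = max k2 1"
  have m: "1 \<le> m" "k2 \<le> m" unfolding m_def by auto
  define Y where "Y n \<delta> = var M \<eta> \<tau>0 (L_joint L\<theta> Lh \<delta>) + lam n * JB (snd \<delta>) (snd \<delta>)" for n \<delta>
  have le_sqnorm: "\<bar>Y n \<delta>\<bar> \<le> m * sqnorm (lam n) \<delta>" for n \<delta>
  proof -
    have 0: "0 \<le> form \<delta> \<delta>" "0 \<le> lam n * pen \<delta> \<delta>" using form_pos pen_pos lam[of n] by auto
    have "0 \<le> k1 * form \<delta> \<delta>" using k(1) 0 by simp
    then have "0 \<le> var M \<eta> \<tau>0 (L_joint L\<theta> Lh \<delta>)" using k(3)[of \<delta>] by linarith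
    moreover have "k2 * form \<delta> \<delta> \<le> m * form \<delta> \<delta>" "1 * (lam n * pen \<delta> \<delta>) \<le> m * (lam n * pen \<delta> \<delta>)"
      by (rule mult_right_mono[OF m(2) 0(1)], rule mult_right_mono[OF m(1) 0(2)])
    ultimately show ?thesis
      using k(4)[of \<delta>] 0(2) unfolding Y_def sqnorm_def pen_def[symmetric] distrib_left by linarith
  qed
  fix \<epsilon> :: real assume "0 < \<epsilon>" "\<epsilon> \<le> 1"
  from sqnorm[OF this] obtain R where R: "\<forall>\<^sub>F n in sequentially.
      \<exists>E\<in>sets S. measure S E \<le> \<epsilon> \<and> (\<forall>\<omega>\<in>space S - E. sqnorm (lam n) (d n \<omega>) \<le> R * rate n (lam n))" by blast
  have "\<bar>Y n \<delta>\<bar> \<le> m * R * rate n (lam n)" if "sqnorm (lam n) \<delta> \<le> R * rate n (lam n)" for n \<delta>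
    using order_trans[OF le_sqnorm mult_left_mono[OF that, of m]] m by (simp add: mult.assoc)
  with R have "\<forall>\<^sub>F n in sequentially. \<exists>E\<in>sets S. measure S E \<le> \<epsilon> \<and>
      (\<forall>\<omega>\<in>space S - E. \<bar>Y n (d n \<omega>)\<bar> \<le> m * R * rate n (lam n))"
    by (elim eventually_mono) blast
  then show "\<exists>K. \<forall>\<^sub>F n in sequentially. \<exists>E\<in>sets S. measure S E \<le> \<epsilon> \<and> (\<forall>\<omega>\<in>space S - E.
      \<bar>var M \<eta> \<tau>0 (L_joint L\<theta> Lh (d n \<omega>)) + lam n * JB (snd (d n \<omega>)) (snd (d n \<omega>))\<bar>
      \<le> K * (inverse (real n) * lam n powr (- 1 / r) + lam n))"
    unfolding Y_def rate_def by blast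
qed

end

theorem theorem2:
  fixes M :: "'x measure"
    and \<eta> :: "(real ^ 'p) \<times> 'h::{real_inner, complete_space} \<Rightarrow> 'x \<Rightarrow> real"
    and \<tau>0 :: "(real ^ 'p) \<times> 'h"
    and JB :: "'h \<Rightarrow> 'h \<Rightarrow> real"
    and L\<theta> :: "real ^ 'p \<Rightarrow> 'x \<Rightarrow> real"
    and Lh :: "'h \<Rightarrow> 'x \<Rightarrow> real"
    and N\<theta> :: "(real ^ 'p) set"
    and Nh :: "'h set"
    and \<phi> :: "nat \<Rightarrow> 'h"
    and \<rho> :: "nat \<Rightarrow> real"
    and r C1 C2 :: real
    and S :: "'w measure"
    and X :: "nat \<Rightarrow> 'w \<Rightarrow> 'x"
    and lam :: "nat \<Rightarrow> real"
    and \<tau>hat \<tau>til :: "nat \<Rightarrow> 'w \<Rightarrow> (real ^ 'p) \<times> 'h"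
  assumes model: "density_model M \<eta> \<tau>0"
    and prob: "prob_space S"
    and indep: "prob_space.indep_vars S (\<lambda>_. M) X {1..}"
    and distr: "\<And>i. i \<ge> 1 \<Longrightarrow> distributed S M (X i) (\<lambda>x. ennreal (dens M \<eta> \<tau>0 x))"
    and a1: "penalty_form JB"
    and a2: "comparison_operators M \<eta> \<tau>0 JB L\<theta> Lh"
    and nbhd_theta: "open N\<theta>" "fst \<tau>0 \<in> N\<theta>"
    and nbhd_h: "open Nh" "snd \<tau>0 \<in> Nh"
    and a3: "smooth_identifiable M \<eta> \<tau>0 (N\<theta> \<times> Nh) S X"
    and a4: "derivative_comparison M \<eta> \<tau>0 (N\<theta> \<times> Nh) L\<theta> Lh C1 C2"
    and a5: "derivative_variation M \<eta> \<tau>0 (N\<theta> \<times> Nh) L\<theta> Lh C1"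
    and a6: "convex (N\<theta> \<times> Nh)" "variance_comparison M \<eta> \<tau>0 (N\<theta> \<times> Nh)"
    and a7: "completely_continuous (\<lambda>g. var M \<eta> \<tau>0 (Lh g)) (\<lambda>g. JB g g)"
    and eigen: "eigensystem (\<lambda>f g. cov M \<eta> \<tau>0 (Lh f) (Lh g)) JB \<phi> \<rho>"
    and a8: "eigenvalue_growth \<rho> r"
    and convex_crit: "AE \<omega> in S. \<forall>n\<ge>1. convex_on UNIV (crit M \<eta> n (\<lambda>i. X i \<omega>))"
    and lam_pos: "\<And>n. 0 < lam n"
    and lam_lim: "lam \<longlonglongrightarrow> 0"
    and n_lam_lim: "filterlim (\<lambda>n. real n * lam n powr (1 / r)) at_top sequentially"
    and estimators: "with_prob_tending_to_1 S (\<lambda>n \<omega>.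
      penalized_estimate (pen_crit M \<eta> JB (lam n) n (\<lambda>i. X i \<omega>)) (N\<theta> \<times> Nh) (\<tau>hat n \<omega>) \<and>
      (\<forall>\<tau>. quad_crit M \<eta> \<tau>0 JB (lam n) n (\<lambda>i. X i \<omega>) (\<tau>til n \<omega>)
            \<le> quad_crit M \<eta> \<tau>0 JB (lam n) n (\<lambda>i. X i \<omega>) \<tau>) \<and>
      \<tau>til n \<omega> \<in> N\<theta> \<times> Nh)"
  shows "bounded_in_prob S
      (\<lambda>n \<omega>. var M \<eta> \<tau>0 (L_joint L\<theta> Lh (\<tau>hat n \<omega> - \<tau>til n \<omega>))
             + lam n * JB (snd (\<tau>hat n \<omega> - \<tau>til n \<omega>)) (snd (\<tau>hat n \<omega> - \<tau>til n \<omega>)))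
      (\<lambda>n. inverse (real n) * lam n powr (- 1 / r) + lam n)
    \<and> bounded_in_prob S
      (\<lambda>n \<omega>. var M \<eta> \<tau>0 (L_joint L\<theta> Lh (\<tau>hat n \<omega> - \<tau>0))
             + lam n * JB (snd (\<tau>hat n \<omega> - \<tau>0)) (snd (\<tau>hat n \<omega> - \<tau>0)))
      (\<lambda>n. inverse (real n) * lam n powr (- 1 / r) + lam n)"
proof -
  interpret density_eigen M \<eta> \<tau>0 "N\<theta> \<times> Nh" S X JB L\<theta> Lh C1 C2 \<phi> \<rho> r
    using assms
    by (intro density_eigen.intro density_ops.intro density_setup.intro density_ops_axioms.intro
        density_eigen_axioms.intro) (auto simp: mem_Times_iff intro: open_Times)
  obtain \<Lambda> C c where iid: "iid_likelihood P0 loss (\<lambda>a. D_joint \<eta> (\<tau>0 + a)) {v. \<tau>0 + v \<in> N\<theta> \<times> Nh} form \<Lambda> C c S X"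
    by (rule iid_likelihood_instance)
  obtain CT where CT: "1 \<le> CT"
    "\<And>l K. 0 < l \<Longrightarrow> l \<le> 1 \<Longrightarrow> (\<Sum>i<K. 1 / (1 + l * \<rho>' i)) \<le> CT * l powr (- 1 / r)"
    by (rule effective_dim) blast
  interpret density_eigen_iid M \<eta> \<tau>0 "N\<theta> \<times> Nh" S X JB L\<theta> Lh C1 C2 \<phi> \<rho> r \<Lambda> C c CT
    by (intro density_eigen_iid.intro density_eigen_axioms density_eigen_iid_axioms.intro iid CT)
  note rates = estimator_rates[OF lam_pos lam_lim estimators]
  have sqnorm_diff: "sqnorm (lam n) (a - b) \<le> 2 * sqnorm (lam n) a + 2 * sqnorm (lam n) b" for n a b
    using psd_form_triangle(2)[OF form_bilinear form_sym form_pos, of a b]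
      mult_left_mono[OF psd_form_triangle(2)[OF pen_bilinear pen_sym pen_pos, of a b], of "lam n"] lam_pos[of n]
    unfolding sqnorm_def by (simp add: algebra_simps)
  \<comment> \<open>The distance between the two estimators is bounded through
    \<open>\<tau>0\<close>, so both claims come from their individual rates.\<close>
  have diff: "sqnorm (lam n) (a - b) \<le> 4 * R * rate n (lam n)"
    if "sqnorm (lam n) (a - \<tau>0) \<le> R * rate n (lam n) \<and> sqnorm (lam n) (b - \<tau>0) \<le> R * rate n (lam n)" for n a b R
    using sqnorm_diff[of n "a - \<tau>0" "b - \<tau>0"] that by simp
  show ?thesis
  proof (intro conjI bounded_in_prob_sqnorm lam_pos)
    fix \<epsilon> :: real assume "0 < \<epsilon>" "\<epsilon> \<le> 1"
    from rates[OF this] obtain R where R: "\<forall>\<^sub>F n in sequentially. \<exists>E\<in>sets S. measure S E \<le> \<epsilon> \<and>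
      (\<forall>\<omega>\<in>space S - E. sqnorm (lam n) (\<tau>hat n \<omega> - \<tau>0) \<le> R * rate n (lam n)
        \<and> sqnorm (lam n) (\<tau>til n \<omega> - \<tau>0) \<le> R * rate n (lam n))"
      by blast
    show "\<exists>R. \<forall>\<^sub>F n in sequentially. \<exists>E\<in>sets S. measure S E \<le> \<epsilon> \<and>
      (\<forall>\<omega>\<in>space S - E. sqnorm (lam n) (\<tau>hat n \<omega> - \<tau>0) \<le> R * rate n (lam n))"
      by (rule exI[of _ R], rule eventually_mono[OF R]) blast
    show "\<exists>R. \<forall>\<^sub>F n in sequentially. \<exists>E\<in>sets S. measure S E \<le> \<epsilon> \<and>
      (\<forall>\<omega>\<in>space S - E. sqnorm (lam n) (\<tau>hat n \<omega> - \<tau>til n \<omega>) \<le> R * rate n (lam n))"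
      by (rule exI[of _ "4 * R"], rule eventually_mono[OF R]) (use diff in blast)
  qed
qed

end
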